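(* Let $n\ge3$ and let $f:I\to\mathbb{Q}_n$ be a $1$-generic conformal geodesic, and let $e$ be a special third order frame along $f$. Then the linear subspace $$V(s)=\mathrm{span}\Big\{e_0(s),e_1(s),e_2(s),e_{n+1}(s),X(s),\frac{\nabla X}{ds}(s)\Big\}\subset\mathbb{R}^{n+2}$$ is a Lorentzian (time-like) subspace independent of $s\in I$; calling it $V$, one has $4\le\dim V\le6$, and the projectivization of the null cone of $V$ is a conformal sphere of dimension $\dim V-2$ containing $f(I)$.
   Context: On $\mathbb{R}^{n+2}$ (coordinates $0,\dots,n+1$) take $\langle v,w\rangle=\sum_{A=1}^nv^Aw^A-v^0w^{n+1}-v^{n+1}w^0$; $\mathbb{Q}_n$ is its projectivized null cone and $\mathrm{M\ddot{o}b}(n)$ the identity component of its isometry group. A conformal $k$-sphere is the projectivized null cone of a $(k+2)$-dimensional Lorentzian subspace. A frame along $f$ is a smooth $e=(e_0|\dots|e_{n+1})$ into $\mathrm{M\ddot{o}b}(n)$ with $[e_0]=f$; $\phi=e^{-1}de$, i.e. $de_b=\sum_a\phi^a_be_a$. Indices $2\le\alpha\le n$, $3\le b,c\le n$. Second order frames: $\phi^\alpha_0=\phi^\alpha_1=0$; with $\phi^0_\alpha=p^\alpha\phi^1_0$, $f$ is 1-generic if $\sum_\alpha(p^\alpha)^2\ne0$ everywhere; $ds=(\sum_\alpha(p^\alpha)^2)^{1/4}\phi^1_0$ is the conformal arclength. Special third order frames: second order frames with $\phi^1_0=\phi^0_2=ds$, $\phi^0_b=0$, $\phi^0_0=0$.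 In such a frame $\phi^0_1=\mu_1ds$, $\phi^b_2=q^bds$, $X=\sum_bq^be_b$ (section of $\Theta=\mathrm{span}\{e_3,\dots,e_n\}$), and $\nabla e_b=\sum_c\phi^c_be_c$ defines the connection on $\Theta$ (metric: $\{e_b\}$ orthonormal). A 1-generic $f$ is a conformal geodesic if it is a critical point of $\int_Dds$ for every compact subinterval $D$ under smooth variations through immersions supported in the interior of $D$. *)

theory Defs
  imports "HOL-Analysis.Analysis" "HOL-Library.Function_Algebras"
begin

text \<open>Vectors of R^(n+2) are represented as functions nat => real vanishing
  outside the index range 0..n+1.\<close>

definition isvec :: "nat \<Rightarrow> (nat \<Rightarrow> real) \<Rightarrow> bool" where
  "isvec n v \<longleftrightarrow> (\<forall>A. n + 1 < A \<longrightarrow> v A = 0)"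

definition sc :: "real \<Rightarrow> (nat \<Rightarrow> real) \<Rightarrow> (nat \<Rightarrow> real)" where
  "sc c v = (\<lambda>A. c * v A)"

lemma vector_space_sc: "vector_space sc"
  by unfold_locales (auto simp: sc_def algebra_simps plus_fun_def)

definition vspan :: "(nat \<Rightarrow> real) set \<Rightarrow> (nat \<Rightarrow> real) set" where
  "vspan S = module.span sc S"

definition vdim :: "(nat \<Rightarrow> real) set \<Rightarrow> nat" where
  "vdim S = vector_space.dim sc S"

definition lor :: "nat \<Rightarrow> (nat \<Rightarrow> real) \<Rightarrow> (nat \<Rightarrow> real) \<Rightarrow> real" where
  "lor n v w = (\<Sum>A\<in>{1..n}. v A * w A) - v 0 * w (n + 1) - v (n + 1) * w 0"

definition proj :: "(nat \<Rightarrow> real) \<Rightarrow> (nat \<Rightarrow> real) set" where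
  "proj v = {sc c v | c. c \<noteq> 0}"

definition proj_null :: "nat \<Rightarrow> (nat \<Rightarrow> real) set \<Rightarrow> (nat \<Rightarrow> real) set set" where
  "proj_null n W = {proj v | v. v \<in> W \<and> v \<noteq> 0 \<and> lor n v v = 0}"

definition Qn :: "nat \<Rightarrow> (nat \<Rightarrow> real) set set" where
  "Qn n = proj_null n {v. isvec n v}"

definition lorentzian_subspace :: "nat \<Rightarrow> (nat \<Rightarrow> real) set \<Rightarrow> bool" where
  "lorentzian_subspace n W \<longleftrightarrow>
     (\<exists>(d::nat) b. 1 \<le> d \<and> (\<forall>i<d. isvec n (b i)) \<and> W = vspan (b ` {..<d}) \<and>
        (\<forall>i<d. \<forall>j<d. lor n (b i) (b j) = (if i \<noteq> j then 0 else if i = 0 then -1 else 1)))"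

definition conformal_sphere :: "nat \<Rightarrow> nat \<Rightarrow> (nat \<Rightarrow> real) set set \<Rightarrow> bool" where
  "conformal_sphere n k S \<longleftrightarrow>
     (\<exists>W. lorentzian_subspace n W \<and> vdim W = k + 2 \<and> S = proj_null n W)"

text \<open>A matrix M :: nat => nat => real, entry M A b (row A, column b), indices 0..n+1.\<close>
definition col :: "nat \<Rightarrow> (nat \<Rightarrow> nat \<Rightarrow> real) \<Rightarrow> nat \<Rightarrow> (nat \<Rightarrow> real)" where
  "col n M b = (\<lambda>A. if A \<le> n + 1 then M A b else 0)"

definition mv :: "nat \<Rightarrow> (nat \<Rightarrow> nat \<Rightarrow> real) \<Rightarrow> (nat \<Rightarrow> real) \<Rightarrow> (nat \<Rightarrow> real)" where
  "mv n M v = (\<lambda>A. if A \<le> n + 1 then (\<Sum>b\<in>{0..n+1}. M A b * v b) else 0)"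

definition lor_isometry :: "nat \<Rightarrow> (nat \<Rightarrow> nat \<Rightarrow> real) \<Rightarrow> bool" where
  "lor_isometry n M \<longleftrightarrow>
     (\<forall>v w. isvec n v \<longrightarrow> isvec n w \<longrightarrow> lor n (mv n M v) (mv n M w) = lor n v w)"

definition mob :: "nat \<Rightarrow> (nat \<Rightarrow> nat \<Rightarrow> real) \<Rightarrow> bool" where
  "mob n M \<longleftrightarrow> lor_isometry n M \<and>
     (\<exists>\<gamma> :: real \<Rightarrow> nat \<Rightarrow> nat \<Rightarrow> real.
        (\<forall>A b. continuous_on {0..1} (\<lambda>s. \<gamma> s A b)) \<and>
        (\<forall>s\<in>{0..1}. lor_isometry n (\<gamma> s)) \<and>
        (\<forall>A\<le>n+1. \<forall>b\<le>n+1. \<gamma> 0 A b = (if A = b then 1 else 0) \<and> \<gamma> 1 A b = M A b))"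

definition Cinf_on :: "real set \<Rightarrow> (real \<Rightarrow> real) \<Rightarrow> bool" where
  "Cinf_on I g \<longleftrightarrow> (\<forall>k. \<forall>t\<in>I. ((deriv ^^ k) g) differentiable (at t))"

inductive_set partials :: "(real \<times> real \<Rightarrow> real) \<Rightarrow> (real \<times> real \<Rightarrow> real) set"
  for g :: "real \<times> real \<Rightarrow> real" where
  base: "g \<in> partials g"
| d1: "h \<in> partials g \<Longrightarrow> (\<lambda>z. deriv (\<lambda>x. h (x, snd z)) (fst z)) \<in> partials g"
| d2: "h \<in> partials g \<Longrightarrow> (\<lambda>z. deriv (\<lambda>y. h (fst z, y)) (snd z)) \<in> partials g"

definition Cinf2_on :: "(real \<times> real) set \<Rightarrow> (real \<times> real \<Rightarrow> real) \<Rightarrow> bool" where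
  "Cinf2_on U g \<longleftrightarrow> (\<forall>h\<in>partials g. \<forall>z\<in>U. h differentiable (at z))"

text \<open>A frame e along f: e t A b is the A-th coordinate of e_b(t).\<close>
definition frame :: "nat \<Rightarrow> real set \<Rightarrow> (real \<Rightarrow> (nat \<Rightarrow> real) set) \<Rightarrow>
    (real \<Rightarrow> nat \<Rightarrow> nat \<Rightarrow> real) \<Rightarrow> bool" where
  "frame n I f e \<longleftrightarrow>
     (\<forall>A\<le>n+1. \<forall>b\<le>n+1. Cinf_on I (\<lambda>t. e t A b)) \<and>
     (\<forall>t\<in>I. mob n (e t)) \<and> (\<forall>t\<in>I. f t = proj (col n (e t) 0))"

text \<open>phi n e t a b is the dt-coefficient of phi^a_b = (e^-1 de)^a_b,
  i.e. de_b = sum_a phi^a_b e_a.\<close>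
definition phi :: "nat \<Rightarrow> (real \<Rightarrow> nat \<Rightarrow> nat \<Rightarrow> real) \<Rightarrow> real \<Rightarrow> nat \<Rightarrow> nat \<Rightarrow> real" where
  "phi n e t = (THE c. (\<forall>a b. (n + 1 < a \<or> n + 1 < b) \<longrightarrow> c a b = 0) \<and>
      (\<forall>A\<le>n+1. \<forall>b\<le>n+1. deriv (\<lambda>s. e s A b) t = (\<Sum>a\<in>{0..n+1}. e t A a * c a b)))"

definition second_order_frame :: "nat \<Rightarrow> real set \<Rightarrow> (real \<Rightarrow> (nat \<Rightarrow> real) set) \<Rightarrow>
    (real \<Rightarrow> nat \<Rightarrow> nat \<Rightarrow> real) \<Rightarrow> bool" where
  "second_order_frame n I f e \<longleftrightarrow> frame n I f e \<and>
     (\<forall>t\<in>I. \<forall>\<alpha>\<in>{2..n}. phi n e t \<alpha> 0 = 0 \<and> phi n e t \<alpha> 1 = 0)"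

definition pcoef :: "nat \<Rightarrow> (real \<Rightarrow> nat \<Rightarrow> nat \<Rightarrow> real) \<Rightarrow> nat \<Rightarrow> real \<Rightarrow> real" where
  "pcoef n e \<alpha> t = phi n e t 0 \<alpha> / phi n e t 1 0"

definition psq :: "nat \<Rightarrow> (real \<Rightarrow> nat \<Rightarrow> nat \<Rightarrow> real) \<Rightarrow> real \<Rightarrow> real" where
  "psq n e t = (\<Sum>\<alpha>\<in>{2..n}. (pcoef n e \<alpha> t)\<^sup>2)"

text \<open>dt-coefficient of the conformal arclength ds = (sum p^2)^(1/4) phi^1_0.\<close>
definition dsc :: "nat \<Rightarrow> (real \<Rightarrow> nat \<Rightarrow> nat \<Rightarrow> real) \<Rightarrow> real \<Rightarrow> real" where
  "dsc n e t = psq n e t powr (1/4) * phi n e t 1 0"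

text \<open>f is 1-generic: it is an immersion (phi^1_0 /= 0, so p is defined) and in a
  second order frame sum p^2 /= 0 everywhere.\<close>
definition one_generic :: "nat \<Rightarrow> real set \<Rightarrow> (real \<Rightarrow> (nat \<Rightarrow> real) set) \<Rightarrow> bool" where
  "one_generic n I f \<longleftrightarrow> (\<exists>e. second_order_frame n I f e \<and>
     (\<forall>t\<in>I. phi n e t 1 0 \<noteq> 0 \<and> psq n e t \<noteq> 0))"

definition arclength_density :: "nat \<Rightarrow> real set \<Rightarrow> (real \<Rightarrow> (nat \<Rightarrow> real) set) \<Rightarrow>
    (real \<Rightarrow> real) \<Rightarrow> bool" where
  "arclength_density n I g h \<longleftrightarrow> (\<exists>e. second_order_frame n I g e \<and>
     (\<forall>t\<in>I. phi n e t 1 0 \<noteq> 0 \<and> psq n e t \<noteq> 0 \<and> h t = psq n e t powr (1/4) * \<bar>phi n e t 1 0\<bar>))"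

text \<open>G t and its derivative are linearly independent: proj o G is an immersion.\<close>
definition lift_immersion :: "nat \<Rightarrow> real set \<Rightarrow> (real \<Rightarrow> nat \<Rightarrow> real) \<Rightarrow> bool" where
  "lift_immersion n I G \<longleftrightarrow>
     (\<forall>t\<in>I. \<not> (\<exists>c. (\<lambda>A. deriv (\<lambda>s. G s A) t) = sc c (G t)))"

definition variation :: "nat \<Rightarrow> real set \<Rightarrow> (real \<Rightarrow> (nat \<Rightarrow> real) set) \<Rightarrow> real \<Rightarrow> real \<Rightarrow>
    real \<Rightarrow> (real \<Rightarrow> real \<Rightarrow> nat \<Rightarrow> real) \<Rightarrow> bool" where
  "variation n I f a b d F \<longleftrightarrow> 0 < d \<and>
     (\<forall>A\<le>n+1. Cinf2_on ({-d<..<d} \<times> I) (\<lambda>z. F (fst z) (snd z) A)) \<and>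
     (\<forall>\<epsilon>\<in>{-d<..<d}. \<forall>t\<in>I. isvec n (F \<epsilon> t) \<and> F \<epsilon> t \<noteq> 0 \<and> lor n (F \<epsilon> t) (F \<epsilon> t) = 0) \<and>
     (\<forall>\<epsilon>\<in>{-d<..<d}. lift_immersion n I (F \<epsilon>)) \<and>
     (\<forall>t\<in>I. proj (F 0 t) = f t) \<and>
     (\<exists>K. compact K \<and> K \<subseteq> {a<..<b} \<and>
        (\<forall>\<epsilon>\<in>{-d<..<d}. \<forall>t\<in>I - K. proj (F \<epsilon> t) = f t))"

definition conformal_geodesic :: "nat \<Rightarrow> real set \<Rightarrow> (real \<Rightarrow> (nat \<Rightarrow> real) set) \<Rightarrow> bool" where
  "conformal_geodesic n I f \<longleftrightarrow> one_generic n I f \<and>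
     (\<forall>a b d F h. a < b \<longrightarrow> {a..b} \<subseteq> I \<longrightarrow> variation n I f a b d F \<longrightarrow>
        (\<forall>\<epsilon>\<in>{-d<..<d}. arclength_density n I (\<lambda>t. proj (F \<epsilon> t)) (h \<epsilon>)) \<longrightarrow>
        ((\<lambda>\<epsilon>. integral {a..b} (h \<epsilon>)) has_real_derivative 0) (at 0))"

definition special_third_order_frame :: "nat \<Rightarrow> real set \<Rightarrow> (real \<Rightarrow> (nat \<Rightarrow> real) set) \<Rightarrow>
    (real \<Rightarrow> nat \<Rightarrow> nat \<Rightarrow> real) \<Rightarrow> bool" where
  "special_third_order_frame n I f e \<longleftrightarrow> second_order_frame n I f e \<and>
     (\<forall>t\<in>I. phi n e t 1 0 = dsc n e t \<and> phi n e t 0 2 = dsc n e t \<and>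
        (\<forall>b\<in>{3..n}. phi n e t 0 b = 0) \<and> phi n e t 0 0 = 0)"

definition qcoef :: "nat \<Rightarrow> (real \<Rightarrow> nat \<Rightarrow> nat \<Rightarrow> real) \<Rightarrow> nat \<Rightarrow> real \<Rightarrow> real" where
  "qcoef n e b t = phi n e t b 2 / dsc n e t"

definition Xvec :: "nat \<Rightarrow> (real \<Rightarrow> nat \<Rightarrow> nat \<Rightarrow> real) \<Rightarrow> real \<Rightarrow> (nat \<Rightarrow> real)" where
  "Xvec n e t = (\<Sum>b\<in>{3..n}. sc (qcoef n e b t) (col n (e t) b))"

definition nablaX_ds :: "nat \<Rightarrow> (real \<Rightarrow> nat \<Rightarrow> nat \<Rightarrow> real) \<Rightarrow> real \<Rightarrow> (nat \<Rightarrow> real)" where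
  "nablaX_ds n e t = (\<Sum>c\<in>{3..n}.
      sc ((deriv (qcoef n e c) t + (\<Sum>b\<in>{3..n}. qcoef n e b t * phi n e t c b)) / dsc n e t)
         (col n (e t) c))"

definition Vspace :: "nat \<Rightarrow> (real \<Rightarrow> nat \<Rightarrow> nat \<Rightarrow> real) \<Rightarrow> real \<Rightarrow> (nat \<Rightarrow> real) set" where
  "Vspace n e s = vspan {col n (e s) 0, col n (e s) 1, col n (e s) 2, col n (e s) (n + 1),
                         Xvec n e s, nablaX_ds n e s}"

end

theory Submission
  imports Defs
begin

text \<open>Write \<open>D\<close> for the derivative with respect to conformal arclength. In a special third order frame
  \<open>D e_0 = e_1\<close>, \<open>D e_1 = \<mu> e_0 + e_(n+1)\<close>, \<open>D e_2 = e_0 + X\<close>, \<open>D e_(n+1) = \<mu> e_1 + e_2\<close> and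
  \<open>D X = \<nabla>X - \<langle>X, X\<rangle> e_2\<close>. For a null lift with derivatives \<open>g_1, g_2, g_3\<close> the fourth power of the
  arclength density is a rational function of the products \<open>\<langle>g_i, g_j\<rangle>\<close>. Applying it to
  \<open>e_0 + \<epsilon> \<eta> e_b + (\<epsilon> \<eta>)^2 / 2 e_(n+1)\<close>, with \<open>\<eta>\<close> a bump function and \<open>b \<ge> 3\<close>, the first variation is a
  multiple of \<open>\<integral> \<langle>D^3 e_0, D^3 (\<eta> e_b)\<rangle> + 4 \<mu> \<langle>D^2 e_0, D^2 (\<eta> e_b)\<rangle> ds\<close>; integration by parts gives
  \<open>\<nabla>\<nabla>X = (\<langle>X, X\<rangle> + 2 \<mu>) X\<close>. Hence \<open>e_0, e_1, e_2, e_(n+1), X, \<nabla>X\<close> solve a homogeneous linear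
  differential system, so that a vector orthogonal to all of them at one point of the interval is
  orthogonal to them at every point. As the span is Lorentzian, it is constant.\<close>

section \<open>Smooth functions of one variable\<close>

text \<open>Criticality in \<open>conformal_geodesic\<close> can be used only if every varied curve
  has a second order frame in the identity component. So frames must be constructed along the varied
  curves; computing invariants does not suffice. The frame is therefore given by an algebraic
  formula. It is smooth in \<open>t\<close> and continuous in \<open>\<epsilon>\<close>, and
  shrinking \<open>\<epsilon>\<close> to 0 joins it to \<open>e\<close> within the isometry group,
  so no description of the components of that group is needed. Varying in the directions
  \<open>e_b\<close>, \<open>b \<ge> 3\<close>, already gives the equation for the second covariant
  derivative of \<open>X\<close>. In these directions \<open><g_1, g_1>\<close> and
  \<open><g_1, g_2>\<close> are stationary at \<open>\<epsilon> = 0\<close>, which leaves two terms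
  of the long rational expression. \<open>X\<close> and its covariant derivative may vanish or
  become dependent at some points, so the rank of \<open>V\<close> is not known to be constant
  beforehand and no smooth basis is at hand. Pairing the six generators with one fixed vector needs
  no rank assumption. The form is positive definite on the span of \<open>X\<close> and its
  covariant derivative, which is orthogonal to the other four generators; this gives orthogonal
  projections and the bounds 4 and 6.\<close>

lemma has_real_derivative_cong_ev:
  assumes "(f has_real_derivative D) (at x)" "\<forall>\<^sub>F y in nhds x. f y = g y"
  shows "(g has_real_derivative D) (at x)"
  using assms(1) DERIV_cong_ev[OF refl assms(2) refl, of D] by simp

text \<open>The recursion peels off the first derivative, so closure under products, inverses and
  roots follows by induction on \<open>k\<close>: their derivatives are built from functions already
  known to be \<open>Ck_on k\<close>, while the iterated derivatives in \<open>Cinf_on\<close> have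
  no convenient closed form.\<close>

primrec Ck_on :: "nat \<Rightarrow> real set \<Rightarrow> (real \<Rightarrow> real) \<Rightarrow> bool" where
  "Ck_on 0 I g \<longleftrightarrow> True"
| "Ck_on (Suc k) I g \<longleftrightarrow> (\<forall>t\<in>I. g differentiable (at t)) \<and> Ck_on k I (deriv g)"

lemma Cinf_on_iff_Ck_on: "Cinf_on I g \<longleftrightarrow> (\<forall>k. Ck_on k I g)"
proof -
  have *: "Ck_on k I g \<longleftrightarrow> (\<forall>j<k. \<forall>t\<in>I. ((deriv ^^ j) g) differentiable (at t))" for k g
  proof (induction k arbitrary: g)
    case (Suc k)
    then show ?case
      by (simp add: All_less_Suc2 funpow_Suc_right del: funpow.simps(2))
  qed simp
  show ?thesis
    unfolding Cinf_on_def * by blast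
qed

lemma Ck_on_cong:
  assumes "open I" "\<And>t. t \<in> I \<Longrightarrow> f t = g t" "Ck_on k I f"
  shows "Ck_on k I g"
  using assms(2,3)
proof (induction k arbitrary: f g)
  case (Suc k)
  have ev: "\<forall>\<^sub>F s in nhds t. f s = g s" if "t \<in> I" for t
    using eventually_nhds_in_open[OF assms(1) that] by eventually_elim (use Suc in auto)
  have "g differentiable (at t)" if "t \<in> I" for t
  proof -
    have "f differentiable (at t)" using Suc.prems(2) that by simp
    then obtain D where "(f has_field_derivative D) (at t)"
      by (rule real_differentiableE)
    then have "(g has_field_derivative D) (at t)"
      using has_real_derivative_cong_ev ev[OF that] by blast
    then show ?thesis by (auto simp: real_differentiable_def)
  qed
  moreover have "Ck_on k I (deriv g)"
    by (rule Suc.IH[of "deriv f"], rule deriv_cong_ev[OF ev refl]) (use Suc.prems in simp_all)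
  ultimately show ?case by simp
qed simp

lemma Ck_on_SucI:
  assumes "open I" "\<And>t. t \<in> I \<Longrightarrow> (g has_real_derivative g' t) (at t)" "Ck_on k I g'"
  shows "Ck_on (Suc k) I g"
proof -
  have "Ck_on k I (deriv g)"
    by (rule Ck_on_cong[OF assms(1) _ assms(3)]) (use assms(2) DERIV_imp_deriv in fastforce)
  then show ?thesis
    using assms(2) by (auto simp: real_differentiable_def)
qed

lemma Ck_on_SucD: "Ck_on (Suc k) I g \<Longrightarrow> Ck_on k I g"
  by (induction k arbitrary: g) auto

lemma Ck_on_has_deriv:
  "Ck_on (Suc k) I g \<Longrightarrow> t \<in> I \<Longrightarrow> (g has_real_derivative deriv g t) (at t)"
  by (auto simp: DERIV_deriv_iff_real_differentiable)

lemma Ck_on_const: "Ck_on k I (\<lambda>_. c)"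
proof (induction k arbitrary: c)
  case (Suc k)
  have "deriv (\<lambda>_::real. c) = (\<lambda>_. 0)" by auto
  then show ?case using Suc by simp
qed simp

lemma Ck_on_add:
  assumes "open I" "Ck_on k I f" "Ck_on k I g"
  shows "Ck_on k I (\<lambda>t. f t + g t)"
  using assms(2,3)
proof (induction k arbitrary: f g)
  case (Suc k)
  show ?case
    by (rule Ck_on_SucI[OF assms(1), of _ "\<lambda>t. deriv f t + deriv g t"])
      (use Suc in \<open>auto intro!: derivative_eq_intros Ck_on_has_deriv Suc.IH\<close>)
qed simp

lemma Ck_on_mult:
  assumes "open I" "Ck_on k I f" "Ck_on k I g"
  shows "Ck_on k I (\<lambda>t. f t * g t)"
  using assms(2,3)
proof (induction k arbitrary: f g)
  case (Suc k)
  show ?case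
  proof (rule Ck_on_SucI[OF assms(1), of _ "\<lambda>t. deriv f t * g t + deriv g t * f t"])
    show "((\<lambda>t. f t * g t) has_real_derivative deriv f t * g t + deriv g t * f t) (at t)"
      if "t \<in> I" for t
      by (rule DERIV_mult) (use Suc.prems that Ck_on_has_deriv in blast)+
    show "Ck_on k I (\<lambda>t. deriv f t * g t + deriv g t * f t)"
      by (intro Ck_on_add[OF assms(1)] Suc.IH Ck_on_SucD[OF Suc.prems(1)] Ck_on_SucD[OF Suc.prems(2)])
        (use Suc.prems in auto)
  qed
qed simp

lemma Ck_on_inverse:
  assumes "open I" "\<And>t. t \<in> I \<Longrightarrow> g t \<noteq> 0" "Ck_on k I g"
  shows "Ck_on k I (\<lambda>t. inverse (g t))"
  using assms(3)
proof (induction k)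
  case (Suc k)
  have IH: "Ck_on k I (\<lambda>t. inverse (g t))" using Suc.IH Ck_on_SucD[OF Suc.prems] by blast
  show ?case
  proof (rule Ck_on_SucI[OF assms(1), of _ "\<lambda>t. (- 1) * (inverse (g t) * deriv g t * inverse (g t))"])
    show "((\<lambda>t. inverse (g t)) has_real_derivative (- 1) * (inverse (g t) * deriv g t * inverse (g t))) (at t)"
      if "t \<in> I" for t
      using DERIV_inverse'[OF Ck_on_has_deriv[OF Suc.prems that]] assms(2)[OF that] by simp
    show "Ck_on k I (\<lambda>t. (- 1) * (inverse (g t) * deriv g t * inverse (g t)))"
      by (intro Ck_on_mult[OF assms(1)] IH Ck_on_const) (use Suc.prems in auto)
  qed
qed simp

lemma Ck_on_sqrt:
  assumes "open I" "\<And>t. t \<in> I \<Longrightarrow> 0 < g t" "Ck_on k I g"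
  shows "Ck_on k I (\<lambda>t. sqrt (g t))"
  using assms(3)
proof (induction k)
  case (Suc k)
  have IH: "Ck_on k I (\<lambda>t. sqrt (g t))" using Suc.IH Ck_on_SucD[OF Suc.prems] by blast
  show ?case
  proof (rule Ck_on_SucI[OF assms(1), of _ "\<lambda>t. deriv g t * (inverse (sqrt (g t)) * (1 / 2))"])
    show "((\<lambda>t. sqrt (g t)) has_real_derivative deriv g t * (inverse (sqrt (g t)) * (1 / 2))) (at t)"
      if "t \<in> I" for t
      using assms(2)[OF that] by (auto intro!: derivative_eq_intros Ck_on_has_deriv[OF Suc.prems that])
    show "Ck_on k I (\<lambda>t. deriv g t * (inverse (sqrt (g t)) * (1 / 2)))"
      by (intro Ck_on_mult[OF assms(1)] Ck_on_inverse[OF assms(1)] IH Ck_on_const)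
        (use Suc.prems assms(2) in force)+
  qed
qed simp

lemma Cinf_on_cong: "open I \<Longrightarrow> (\<And>t. t \<in> I \<Longrightarrow> f t = g t) \<Longrightarrow> Cinf_on I f \<Longrightarrow> Cinf_on I g"
  unfolding Cinf_on_iff_Ck_on using Ck_on_cong by blast

lemma Cinf_on_const: "Cinf_on I (\<lambda>_. c)"
  unfolding Cinf_on_iff_Ck_on using Ck_on_const by blast

lemma Cinf_on_add:
  "open I \<Longrightarrow> Cinf_on I f \<Longrightarrow> Cinf_on I g \<Longrightarrow> Cinf_on I (\<lambda>t. f t + g t)"
  unfolding Cinf_on_iff_Ck_on using Ck_on_add by blast

lemma Cinf_on_mult:
  "open I \<Longrightarrow> Cinf_on I f \<Longrightarrow> Cinf_on I g \<Longrightarrow> Cinf_on I (\<lambda>t. f t * g t)"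
  unfolding Cinf_on_iff_Ck_on using Ck_on_mult by blast

lemma Cinf_on_minus: "open I \<Longrightarrow> Cinf_on I f \<Longrightarrow> Cinf_on I (\<lambda>t. - f t)"
  using Cinf_on_mult[of I "\<lambda>_. - 1" f] Cinf_on_const by simp

lemma Cinf_on_diff:
  "open I \<Longrightarrow> Cinf_on I f \<Longrightarrow> Cinf_on I g \<Longrightarrow> Cinf_on I (\<lambda>t. f t - g t)"
  using Cinf_on_add[of I f "\<lambda>t. - g t"] Cinf_on_minus by simp

lemma Cinf_on_divide:
  assumes "open I" "Cinf_on I f" "Cinf_on I g" "\<And>t. t \<in> I \<Longrightarrow> g t \<noteq> 0"
  shows "Cinf_on I (\<lambda>t. f t / g t)"
proof -
  have "Cinf_on I (\<lambda>t. inverse (g t))"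
    using assms Ck_on_inverse unfolding Cinf_on_iff_Ck_on by blast
  then show ?thesis
    using Cinf_on_mult[OF assms(1,2)] by (simp add: divide_inverse)
qed

lemma Cinf_on_sqrt:
  "open I \<Longrightarrow> Cinf_on I g \<Longrightarrow> (\<And>t. t \<in> I \<Longrightarrow> 0 < g t) \<Longrightarrow> Cinf_on I (\<lambda>t. sqrt (g t))"
  unfolding Cinf_on_iff_Ck_on using Ck_on_sqrt by blast

lemma Cinf_on_power: "open I \<Longrightarrow> Cinf_on I f \<Longrightarrow> Cinf_on I (\<lambda>t. f t ^ k)"
  by (induction k) (auto intro: Cinf_on_mult Cinf_on_const)

lemma Cinf_on_sum:
  assumes "open I" "\<And>i. i \<in> S \<Longrightarrow> Cinf_on I (f i)"
  shows "Cinf_on I (\<lambda>t. \<Sum>i\<in>S. f i t)"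
  using assms(2) by (induction S rule: infinite_finite_induct) (auto intro: Cinf_on_add Cinf_on_const assms(1))

lemma Cinf_on_has_deriv:
  "Cinf_on I g \<Longrightarrow> t \<in> I \<Longrightarrow> (g has_real_derivative deriv g t) (at t)"
  unfolding Cinf_on_iff_Ck_on using Ck_on_has_deriv by blast

lemma Cinf_on_deriv: "Cinf_on I g \<Longrightarrow> Cinf_on I (deriv g)"
  unfolding Cinf_on_iff_Ck_on using Ck_on.simps(2) by blast

lemma Cinf_on_continuous_on: "Cinf_on I g \<Longrightarrow> continuous_on I g"
  by (meson Cinf_on_has_deriv DERIV_isCont continuous_at_imp_continuous_on)

lemma Cinf_on_affine_compose:
  assumes "Cinf_on UNIV g"
  shows "Cinf_on I (\<lambda>t. g (a * t + b))"
proof -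
  \<comment> \<open>The factor \<open>c\<close> is carried along to absorb the \<open>a\<close> that
    the chain rule produces at each differentiation.\<close>
  have "Ck_on k I (\<lambda>t. c * g (a * t + b))" if "Cinf_on UNIV g" for k c g
    using that
  proof (induction k arbitrary: g c)
    case (Suc k)
    have d: "((\<lambda>t. c * g (a * t + b)) has_real_derivative (c * a) * deriv g (a * t + b)) (at t)" for t
      by (auto intro!: derivative_eq_intros DERIV_chain2[OF Cinf_on_has_deriv[OF Suc.prems]])
    then have "deriv (\<lambda>t. c * g (a * t + b)) = (\<lambda>t. (c * a) * deriv g (a * t + b))"
      using DERIV_imp_deriv by blast
    then show ?case
      using d Suc.IH[OF Cinf_on_deriv[OF Suc.prems]] by (auto simp: real_differentiable_def simp del: mult.assoc)
  qed simp
  from this[OF assms, of _ 1] show ?thesis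
    by (simp add: Cinf_on_iff_Ck_on)
qed

section \<open>A smooth bump function\<close>

definition flat_fun :: "real poly \<Rightarrow> real \<Rightarrow> real" where
  "flat_fun p x = (if 0 < x then poly p (1 / x) * exp (- (1 / x)) else 0)"

lemma poly_times_exp_minus_tendsto_0: "((\<lambda>x. poly p x * exp (- x)) \<longlongrightarrow> (0::real)) at_top"
proof -
  have "((\<lambda>x. \<Sum>i\<le>degree p. coeff p i * (x ^ i / exp x)) \<longlongrightarrow> (\<Sum>i\<le>degree p. coeff p i * 0)) at_top"
    by (intro tendsto_sum tendsto_mult tendsto_const tendsto_power_div_exp_0)
  then show ?thesis
    by (simp add: poly_altdef exp_minus field_simps sum_divide_distrib)
qed

text \<open>Differentiating \<open>p(1/x)\<close> and \<open>exp(-1/x)\<close> each brings out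
  \<open>1/x^2\<close>, with a minus sign for the first. With \<open>y = 1/x\<close> the family is
  thus closed under derivation through \<open>p \<mapsto> y^2 (p - p')\<close>, so one formula
  covers all orders. At 0 the exponential beats every power of \<open>1/x\<close>.\<close>

lemma flat_fun_has_deriv:
  "(flat_fun p has_real_derivative flat_fun ([:0, 0, 1:] * (p - pderiv p)) x) (at x)"
proof -
  consider "x > 0" | "x < 0" | "x = 0" by linarith
  then show ?thesis
  proof cases
    case 1
    have "((\<lambda>x. poly p (1 / x) * exp (- (1 / x))) has_real_derivative
        poly ([:0, 0, 1:] * (p - pderiv p)) (1 / x) * exp (- (1 / x))) (at x)"
      using 1 by (auto intro!: derivative_eq_intros DERIV_chain2[OF poly_DERIV] simp: field_simps power2_eq_square)
    moreover have "\<forall>\<^sub>F y in nhds x. poly p (1 / y) * exp (- (1 / y)) = flat_fun p y"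
      using eventually_nhds_in_open[of "{0<..}" x] 1
      by (auto elim!: eventually_mono simp: flat_fun_def)
    ultimately have "(flat_fun p has_real_derivative
        poly ([:0, 0, 1:] * (p - pderiv p)) (1 / x) * exp (- (1 / x))) (at x)"
      by (rule has_real_derivative_cong_ev)
    then show ?thesis using 1 by (simp add: flat_fun_def)
  next
    case 2
    have "\<forall>\<^sub>F y in nhds x. 0 = flat_fun p y"
      using eventually_nhds_in_open[of "{..<0}" x] 2
      by (auto elim!: eventually_mono simp: flat_fun_def)
    then have "(flat_fun p has_real_derivative 0) (at x)"
      using has_real_derivative_cong_ev[OF DERIV_const] by blast
    then show ?thesis using 2 by (simp add: flat_fun_def)
  next
    case 3
    have "((\<lambda>h. flat_fun p h / h) \<longlongrightarrow> 0) (at 0)"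
    proof (rule filterlim_split_at)
      have "\<forall>\<^sub>F h in at_left 0. 0 = flat_fun p h / h"
        by (auto simp: eventually_at_filter flat_fun_def)
      then show "((\<lambda>h. flat_fun p h / h) \<longlongrightarrow> 0) (at_left 0)"
        by (rule Lim_transform_eventually[OF tendsto_const])
      \<comment> \<open>\<open>pCons 0 p\<close> is \<open>p\<close> times the variable: the extra
        factor \<open>1/h\<close> of the difference quotient.\<close>
      have "((\<lambda>h. poly (pCons 0 p) (inverse h) * exp (- (inverse h))) \<longlongrightarrow> 0) (at_right 0)"
        by (rule filterlim_compose[OF poly_times_exp_minus_tendsto_0 filterlim_inverse_at_top_right])
      moreover have "\<forall>\<^sub>F h in at_right 0. poly (pCons 0 p) (inverse h) * exp (- (inverse h)) = flat_fun p h / h"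
        by (auto simp: eventually_at_filter flat_fun_def field_simps)
      ultimately show "((\<lambda>h. flat_fun p h / h) \<longlongrightarrow> 0) (at_right 0)"
        by (rule Lim_transform_eventually)
    qed
    then show ?thesis
      using 3 by (simp add: DERIV_def flat_fun_def)
  qed
qed

lemma Cinf_on_flat_fun: "Cinf_on I (flat_fun p)"
proof -
  have "Ck_on k I (flat_fun p)" for k
  proof (induction k arbitrary: p)
    case (Suc k)
    have "deriv (flat_fun p) = flat_fun ([:0, 0, 1:] * (p - pderiv p))"
      using flat_fun_has_deriv DERIV_imp_deriv by blast
    then show ?case
      using Suc flat_fun_has_deriv by (auto simp: real_differentiable_def simp del: mult_pCons_left)
  qed simp
  then show ?thesis by (simp add: Cinf_on_iff_Ck_on)
qed

lemma smooth_bump_exists: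
  assumes "l < r"
  shows "\<exists>\<eta>. Cinf_on I \<eta> \<and> (\<forall>t. 0 \<le> \<eta> t) \<and> (\<forall>t\<in>{l<..<r}. 0 < \<eta> t) \<and> (\<forall>t. t \<notin> {l..r} \<longrightarrow> \<eta> t = 0)"
proof -
  define \<eta> where "\<eta> t = flat_fun 1 (1 * t + (- l)) * flat_fun 1 ((- 1) * t + r)" for t
  have "Cinf_on UNIV \<eta>"
    unfolding \<eta>_def by (intro Cinf_on_mult Cinf_on_affine_compose Cinf_on_flat_fun open_UNIV)
  then have "Cinf_on I \<eta>" by (auto simp: Cinf_on_def)
  then show ?thesis
    by (intro exI[of _ \<eta>]) (auto simp: \<eta>_def flat_fun_def)
qed

section \<open>The Lorentz form and its orthonormal frames\<close>

interpretation vs: vector_space sc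
  by (rule vector_space_sc)

lemma lor_commute: "lor n v w = lor n w v"
  by (simp add: lor_def mult.commute)

lemma lor_add_left: "lor n (u + v) w = lor n u w + lor n v w"
  by (simp add: lor_def plus_fun_def algebra_simps sum.distrib)

lemma lor_diff_left: "lor n (u - v) w = lor n u w - lor n v w"
  by (simp add: lor_def fun_diff_def algebra_simps sum_subtractf)

lemma lor_sc_left: "lor n (sc c v) w = c * lor n v w"
  by (simp add: lor_def sc_def algebra_simps sum_distrib_left)

lemma lor_zero_left: "lor n 0 w = 0"
  by (simp add: lor_def)

lemma lor_sum_left: "lor n (\<Sum>i\<in>S. v i) w = (\<Sum>i\<in>S. lor n (v i) w)"
  by (induction S rule: infinite_finite_induct)
    (simp_all only: sum.infinite sum.empty sum.insert lor_add_left lor_zero_left if_False simp_thms)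

lemma lor_minus_left: "lor n (- v) w = - lor n v w"
  using lor_diff_left[of n 0 v w] by (simp add: lor_zero_left)

lemmas lor_left = lor_add_left lor_diff_left lor_minus_left lor_sc_left lor_zero_left lor_sum_left

lemma lor_right:
  "lor n w (u + v) = lor n w u + lor n w v"
  "lor n w (u - v) = lor n w u - lor n w v"
  "lor n w (- v) = - lor n w v"
  "lor n w (sc c v) = c * lor n w v"
  "lor n w 0 = 0"
  "lor n w (\<Sum>i\<in>S. x i) = (\<Sum>i\<in>S. lor n w (x i))"
  unfolding lor_commute[of n w] by (simp_all add: lor_left)

lemmas lor_simps = lor_left lor_right

lemma sum_fun_apply: "(\<Sum>i\<in>S. (v i :: nat \<Rightarrow> real)) A = (\<Sum>i\<in>S. v i A)"
  by (induction S rule: infinite_finite_induct) auto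

lemma isvec_closed:
  "isvec n v \<Longrightarrow> isvec n w \<Longrightarrow> isvec n (v + w)"
  "isvec n v \<Longrightarrow> isvec n w \<Longrightarrow> isvec n (v - w)"
  "isvec n v \<Longrightarrow> isvec n (sc c v)"
  "isvec n 0"
  by (auto simp: isvec_def sc_def)

lemma isvec_sum: "(\<And>i. i \<in> S \<Longrightarrow> isvec n (v i)) \<Longrightarrow> isvec n (\<Sum>i\<in>S. v i)"
  by (induction S rule: infinite_finite_induct) (auto intro: isvec_closed)

lemma isvec_col: "isvec n (col n M b)"
  by (simp add: isvec_def col_def)

lemma sum_upto_Suc_split:
  fixes f :: "nat \<Rightarrow> 'a::comm_monoid_add"
  shows "(\<Sum>a\<in>{0..n+1}. f a) = f 0 + (\<Sum>a\<in>{1..n}. f a) + f (n + 1)"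
  by (simp add: sum.atLeast_Suc_atMost add.assoc)

text \<open>The Gram matrix of the standard basis with respect to \<open>lor\<close>. Frames are
  functions of the column index in what follows, so that \<open>lor_frame\<close> applies both to
  \<open>col n M\<close> and to families of vectors built by hand.\<close>

definition gramJ :: "nat \<Rightarrow> nat \<Rightarrow> nat \<Rightarrow> real" where
  "gramJ n a b = (if a = 0 then (if b = n + 1 then -1 else 0)
     else if a = n + 1 then (if b = 0 then -1 else 0) else if a = b then 1 else 0)"

definition lor_frame :: "nat \<Rightarrow> (nat \<Rightarrow> nat \<Rightarrow> real) \<Rightarrow> bool" where
  "lor_frame n E \<longleftrightarrow> (\<forall>a\<le>n+1. isvec n (E a)) \<and>
     (\<forall>a\<le>n+1. \<forall>b\<le>n+1. lor n (E a) (E b) = gramJ n a b)"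

lemma lor_gramJ: "lor n v w = (\<Sum>a\<in>{0..n+1}. \<Sum>b\<in>{0..n+1}. v a * w b * gramJ n a b)"
proof -
  have *: "(\<Sum>b\<in>{1..n}. v a * w b * gramJ n a b) = v a * w a" if "a \<in> {1..n}" for a
  proof -
    have "(\<Sum>b\<in>{1..n}. v a * w b * gramJ n a b) = (\<Sum>b\<in>{1..n}. if b = a then v a * w b else 0)"
      using that by (intro sum.cong) (auto simp: gramJ_def)
    then show ?thesis using that by simp
  qed
  have 0: "(\<Sum>b\<in>{1..n}. v 0 * w b * gramJ n 0 b) = 0"
      "(\<Sum>b\<in>{1..n}. v (n+1) * w b * gramJ n (n+1) b) = 0"
    by (auto simp: gramJ_def intro!: sum.neutral)
  have 1: "(\<Sum>a\<in>{1..n}. v a * w 0 * gramJ n a 0 + (\<Sum>b\<in>{1..n}. v a * w b * gramJ n a b) +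
      v a * w (n+1) * gramJ n a (n+1)) = (\<Sum>a\<in>{1..n}. v a * w a)"
    by (intro sum.cong refl) (subst *, auto simp: gramJ_def)
  show ?thesis
    unfolding sum_upto_Suc_split 0 1 by (simp add: gramJ_def lor_def)
qed

lemma mv_eq_sum: "mv n M v = (\<Sum>b\<in>{0..n+1}. sc (v b) (col n M b))"
  by (rule ext) (simp add: mv_def sum_fun_apply sc_def col_def mult.commute)

lemma lor_mv: "lor n (mv n M v) (mv n M w) =
    (\<Sum>a\<in>{0..n+1}. \<Sum>b\<in>{0..n+1}. v a * w b * lor n (col n M a) (col n M b))"
  unfolding mv_eq_sum lor_left unfolding lor_right by (simp add: sum_distrib_left mult.assoc del: sum.cl_ivl_Suc)

text \<open>By bilinearity an isometry need only be tested on the standard basis, whose images are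
  the columns. Membership in \<open>mob\<close> thereby becomes a table of products plus a
  connecting path.\<close>

lemma lor_isometry_iff_lor_frame: "lor_isometry n M \<longleftrightarrow> lor_frame n (col n M)"
proof
  assume L: "lor_isometry n M"
  define uv where "uv b = (\<lambda>A::nat. if A = b then 1 else (0::real))" for b
  have mv: "mv n M (uv b) = col n M b" if "b \<le> n + 1" for b
    using that by (intro ext) (simp add: mv_def col_def uv_def if_distrib cong: if_cong)
  have iv: "isvec n (uv b)" if "b \<le> n + 1" for b
    using that by (simp add: isvec_def uv_def)
  have J: "lor n (uv a) (uv b) = gramJ n a b" if "a \<le> n + 1" "b \<le> n + 1" for a b
  proof -
    have "lor n (uv a) (uv b) = (\<Sum>a'\<in>{0..n+1}. if a' = a then (\<Sum>b'\<in>{0..n+1}. if b' = b then gramJ n a b else 0) else 0)"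
      unfolding lor_gramJ uv_def by (intro sum.cong refl) (auto simp: mult_if_delta simp del: sum.cl_ivl_Suc)
    then show ?thesis using that by (simp del: sum.cl_ivl_Suc)
  qed
  have "lor n (col n M a) (col n M b) = gramJ n a b" if "a \<le> n + 1" "b \<le> n + 1" for a b
    using L iv mv J that unfolding lor_isometry_def by metis
  then show "lor_frame n (col n M)"
    by (simp add: lor_frame_def isvec_col)
next
  assume "lor_frame n (col n M)"
  then have "lor n (col n M a) (col n M b) = gramJ n a b" if "a \<in> {0..n+1}" "b \<in> {0..n+1}" for a b
    using that by (simp add: lor_frame_def)
  then show "lor_isometry n M"
    unfolding lor_isometry_def lor_mv lor_gramJ[of n v w for v w]
    by (intro allI impI sum.cong refl) simp
qed

lemma lor_frameD:
  assumes "lor_frame n E"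
  shows "lor n (E 0) (E 0) = 0" "lor n (E 0) (E (n+1)) = -1" "lor n (E (n+1)) (E 0) = -1"
    "lor n (E (n+1)) (E (n+1)) = 0"
    "\<And>i. i \<in> {1..n} \<Longrightarrow> lor n (E 0) (E i) = 0"
    "\<And>i. i \<in> {1..n} \<Longrightarrow> lor n (E i) (E 0) = 0"
    "\<And>i. i \<in> {1..n} \<Longrightarrow> lor n (E (n+1)) (E i) = 0"
    "\<And>i. i \<in> {1..n} \<Longrightarrow> lor n (E i) (E (n+1)) = 0"
    "\<And>i j. i \<in> {1..n} \<Longrightarrow> j \<in> {1..n} \<Longrightarrow> lor n (E i) (E j) = (if i = j then 1 else 0)"
  using assms by (auto simp: lor_frame_def gramJ_def)

lemma lor_frameI:
  assumes "\<And>a. a \<le> n + 1 \<Longrightarrow> isvec n (E a)"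
    and "lor n (E 0) (E 0) = 0" "lor n (E 0) (E (n+1)) = -1" "lor n (E (n+1)) (E (n+1)) = 0"
    and "\<And>i. i \<in> {1..n} \<Longrightarrow> lor n (E i) (E 0) = 0"
    and "\<And>i. i \<in> {1..n} \<Longrightarrow> lor n (E i) (E (n+1)) = 0"
    and "\<And>i j. i \<in> {1..n} \<Longrightarrow> j \<in> {1..n} \<Longrightarrow> lor n (E i) (E j) = (if i = j then 1 else 0)"
  shows "lor_frame n E"
proof -
  have "lor n (E a) (E b) = gramJ n a b" if "a \<le> n+1" "b \<le> n+1" for a b
  proof -
    have "a = 0 \<or> a = n+1 \<or> a \<in> {1..n}" "b = 0 \<or> b = n+1 \<or> b \<in> {1..n}"
      using that by auto
    then show ?thesis
      by (elim disjE) (use assms(2-) in \<open>auto simp: gramJ_def lor_commute[of n "E 0" "E b"]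
          lor_commute[of n "E (n+1)" "E b"] lor_commute[of n "E (Suc n)" "E 0"] lor_commute[of n "E (Suc n)" "E b"]\<close>)
  qed
  then show ?thesis using assms(1) by (simp add: lor_frame_def)
qed

text \<open>The legs \<open>E 0\<close> and \<open>E (n+1)\<close> are null with product -1, so each
  reads off minus the coefficient of the other; the remaining legs are orthonormal and read off
  their own.\<close>

lemma lor_frame_coeff:
  assumes "lor_frame n E"
  shows "lor n (\<Sum>a\<in>{0..n+1}. sc (c a) (E a)) (E 0) = - c (n+1)"
    "lor n (\<Sum>a\<in>{0..n+1}. sc (c a) (E a)) (E (n+1)) = - c 0"
    "i \<in> {1..n} \<Longrightarrow> lor n (\<Sum>a\<in>{0..n+1}. sc (c a) (E a)) (E i) = c i"
proof -
  note F = lor_frameD[OF assms]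
  have 0: "(\<Sum>a\<in>{1..n}. c a * lor n (E a) (E 0)) = 0" "(\<Sum>a\<in>{1..n}. c a * lor n (E a) (E (n+1))) = 0"
    by (intro sum.neutral ballI, simp only: F mult_zero_right)+
  show "lor n (\<Sum>a\<in>{0..n+1}. sc (c a) (E a)) (E 0) = - c (n+1)"
    "lor n (\<Sum>a\<in>{0..n+1}. sc (c a) (E a)) (E (n+1)) = - c 0"
    unfolding lor_simps sum_upto_Suc_split 0 F by simp_all
  show "lor n (\<Sum>a\<in>{0..n+1}. sc (c a) (E a)) (E i) = c i" if i: "i \<in> {1..n}"
  proof -
    have "(\<Sum>a\<in>{1..n}. c a * lor n (E a) (E i)) = (\<Sum>a\<in>{1..n}. if a = i then c a else 0)"
      by (rule sum.cong) (use i in \<open>auto simp: F(9)\<close>)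
    then show ?thesis
      unfolding lor_simps sum_upto_Suc_split F(5)[OF i] F(7)[OF i] using i by simp
  qed
qed

text \<open>The products make the \<open>n + 2\<close> legs independent. They span all vectors
  because a vector outside their span would give \<open>n + 3\<close> independent vectors in the
  span of the \<open>n + 2\<close> standard ones. The coefficients then come from
  \<open>lor_frame_coeff\<close>.\<close>

lemma lor_frame_expand:
  assumes E: "lor_frame n E" and v: "isvec n v"
  shows "v = sc (- lor n v (E (n+1))) (E 0) + (\<Sum>i\<in>{1..n}. sc (lor n v (E i)) (E i))
      + sc (- lor n v (E 0)) (E (n+1))"
proof -
  define uv where "uv b = (\<lambda>A::nat. if A = b then 1 else (0::real))" for b
  let ?A = "{0..n+1}"
  have in_uv: "x \<in> vs.span (uv ` ?A)" if "isvec n x" for x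
  proof -
    have "x = (\<Sum>b\<in>?A. sc (x b) (uv b))"
      using that by (intro ext) (auto simp: sum_fun_apply sc_def uv_def isvec_def if_distrib cong: if_cong)
    then show ?thesis
      by (metis (mono_tags, lifting) vs.span_sum vs.span_scale vs.span_base image_eqI)
  qed
  have zero: "c i = 0" if "(\<Sum>a\<in>?A. sc (c a) (E a)) = 0" "i \<in> ?A" for c i
    using lor_frame_coeff[OF E, where c = c] that
    by (cases "i = 0"; cases "i = n + 1") (auto simp: lor_zero_left simp del: sum.cl_ivl_Suc)
  have inj: "inj_on E ?A"
  proof (rule inj_onI, rule ccontr)
    fix i j assume ij: "i \<in> ?A" "j \<in> ?A" "E i = E j" "i \<noteq> j"
    define c where "c a = (if a = i then 1 else if a = j then -1 else (0::real))" for a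
    have "(\<Sum>a\<in>?A. sc (c a) (E a)) = (\<Sum>a\<in>{i,j}. sc (c a) (E a))"
      by (rule sum.mono_neutral_right) (use ij in \<open>auto simp: c_def sc_def\<close>)
    also have "\<dots> = 0" using ij by (intro ext) (auto simp: c_def sc_def)
    finally show False using zero[of c i] ij by (simp add: c_def)
  qed
  have indep: "vs.independent (E ` ?A)"
  proof (rule vs.independent_if_scalars_zero)
    fix f x assume "(\<Sum>x\<in>E ` ?A. sc (f x) x) = 0" "x \<in> E ` ?A"
    then show "f x = 0"
      using zero[of "\<lambda>a. f (E a)"] unfolding sum.reindex[OF inj] o_def by blast
  qed simp
  have "v \<in> vs.span (E ` ?A)"
  proof (rule ccontr)
    assume nv: "v \<notin> vs.span (E ` ?A)"
    have "vs.independent (insert v (E ` ?A))"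
      using indep nv vs.independent_insert by metis
    moreover have "insert v (E ` ?A) \<subseteq> vs.span (uv ` ?A)"
      using v E in_uv by (auto simp: lor_frame_def)
    ultimately have "card (insert v (E ` ?A)) \<le> card (uv ` ?A)"
      using vs.independent_span_bound[of "uv ` ?A"] by blast
    moreover have "v \<notin> E ` ?A" using nv vs.span_base by blast
    ultimately show False
      using card_image_le[of ?A uv] card_image[OF inj] by simp
  qed
  then obtain u where u: "v = (\<Sum>x\<in>E ` ?A. sc (u x) x)"
    using vs.span_finite[of "E ` ?A"] by auto
  define c where "c a = u (E a)" for a
  have v: "v = (\<Sum>a\<in>?A. sc (c a) (E a))"
    unfolding u c_def sum.reindex[OF inj] o_def by (rule refl)
  have "lor n v (E 0) = - c (n+1)" "lor n v (E (n+1)) = - c 0"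
      "\<And>i. i \<in> {1..n} \<Longrightarrow> lor n v (E i) = c i"
    unfolding v using lor_frame_coeff[OF E, where c = c] by blast+
  then show ?thesis
    by (subst (1) v) (simp only: sum_upto_Suc_split, simp)
qed

lemma lor_frame_parseval:
  assumes E: "lor_frame n E" and v: "isvec n v"
  shows "lor n v w = (\<Sum>i\<in>{1..n}. lor n v (E i) * lor n w (E i))
     - lor n v (E (n+1)) * lor n w (E 0) - lor n v (E 0) * lor n w (E (n+1))"
  by (subst lor_frame_expand[OF E v]) (simp add: lor_simps lor_commute[of n w])

lemma lor_frame_eq_0:
  assumes E: "lor_frame n E" and v: "isvec n v" and "\<And>a. a \<le> n+1 \<Longrightarrow> lor n v (E a) = 0"
  shows "v = 0"
  by (subst lor_frame_expand[OF E v]) (use assms(3) in \<open>auto simp: sc_def zero_fun_def\<close>)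

lemma lor_frame_eqI:
  assumes "lor_frame n E" "isvec n v" "isvec n w" "\<And>a. a \<le> n+1 \<Longrightarrow> lor n v (E a) = lor n w (E a)"
  shows "v = w"
proof -
  have "v - w = 0"
    by (rule lor_frame_eq_0[OF assms(1)]) (auto intro: isvec_closed assms simp: lor_left assms(4))
  then show ?thesis by simp
qed

section \<open>The coefficients of the Maurer-Cartan form as products\<close>

definition dcol :: "nat \<Rightarrow> (real \<Rightarrow> nat \<Rightarrow> nat \<Rightarrow> real) \<Rightarrow> real \<Rightarrow> nat \<Rightarrow> nat \<Rightarrow> real" where
  "dcol n e t b = (\<lambda>A. if A \<le> n + 1 then deriv (\<lambda>s. e s A b) t else 0)"

lemma isvec_dcol: "isvec n (dcol n e t b)"
  by (simp add: isvec_def dcol_def)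

text \<open>\<open>phi\<close> is a definite description, so existence and uniqueness both have to
  be shown: expanding the derivative of each column in the frame solves the defining system, and
  pairing with the legs recovers every coefficient of a solution.\<close>

lemma phi_eq_lor:
  assumes "lor_frame n (col n (e t))" "b \<le> n + 1"
  shows "phi n e t 0 b = - lor n (dcol n e t b) (col n (e t) (n+1))"
    "phi n e t (n+1) b = - lor n (dcol n e t b) (col n (e t) 0)"
    "i \<in> {1..n} \<Longrightarrow> phi n e t i b = lor n (dcol n e t b) (col n (e t) i)"
proof -
  let ?E = "col n (e t)"
  define c where "c a b = (if n + 1 < a \<or> n + 1 < b then 0
     else if a = 0 then - lor n (dcol n e t b) (?E (n+1))
     else if a = n + 1 then - lor n (dcol n e t b) (?E 0)
     else lor n (dcol n e t b) (?E a))" for a b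
  have sys: "(\<forall>A\<le>n+1. \<forall>b\<le>n+1. deriv (\<lambda>s. e s A b) t = (\<Sum>a\<in>{0..n+1}. e t A a * d a b)) \<longleftrightarrow>
      (\<forall>b\<le>n+1. dcol n e t b = (\<Sum>a\<in>{0..n+1}. sc (d a b) (?E a)))" for d
    by (auto simp: fun_eq_iff sum_fun_apply sc_def col_def dcol_def mult.commute simp del: sum.cl_ivl_Suc)
  have "phi n e t = c"
    unfolding phi_def sys
  proof (rule the_equality)
    have "dcol n e t b = (\<Sum>a\<in>{0..n+1}. sc (c a b) (?E a))" if b: "b \<le> n+1" for b
    proof -
      have "(\<Sum>a\<in>{1..n}. sc (c a b) (?E a)) = (\<Sum>a\<in>{1..n}. sc (lor n (dcol n e t b) (?E a)) (?E a))"
        by (rule sum.cong) (use b in \<open>auto simp: c_def\<close>)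
      then show ?thesis
        using b by (subst lor_frame_expand[OF assms(1) isvec_dcol, of e t b])
          (simp only: sum_upto_Suc_split, simp add: c_def)
    qed
    then show "(\<forall>a b. n + 1 < a \<or> n + 1 < b \<longrightarrow> c a b = 0) \<and>
        (\<forall>b\<le>n+1. dcol n e t b = (\<Sum>a\<in>{0..n+1}. sc (c a b) (?E a)))"
      by (auto simp: c_def)
  next
    fix d assume d: "(\<forall>a b. n + 1 < a \<or> n + 1 < b \<longrightarrow> d a b = 0) \<and>
        (\<forall>b\<le>n+1. dcol n e t b = (\<Sum>a\<in>{0..n+1}. sc (d a b) (?E a)))"
    show "d = c"
    proof (intro ext)
      fix a b
      show "d a b = c a b"
      proof (cases "n + 1 < a \<or> n + 1 < b")
        case False
        then have "dcol n e t b = (\<Sum>a\<in>{0..n+1}. sc (d a b) (?E a))" using d by auto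
        then have "lor n (dcol n e t b) (?E 0) = - d (n+1) b" "lor n (dcol n e t b) (?E (n+1)) = - d 0 b"
            "\<And>i. i \<in> {1..n} \<Longrightarrow> lor n (dcol n e t b) (?E i) = d i b"
          using lor_frame_coeff[OF assms(1), where c = "\<lambda>a. d a b"] by auto
        then show ?thesis using False by (auto simp: c_def)
      qed (use d in \<open>auto simp: c_def\<close>)
    qed
  qed
  then show "phi n e t 0 b = - lor n (dcol n e t b) (?E (n+1))"
    "phi n e t (n+1) b = - lor n (dcol n e t b) (?E 0)"
    "i \<in> {1..n} \<Longrightarrow> phi n e t i b = lor n (dcol n e t b) (?E i)"
    using assms(2) by (auto simp: c_def)
qed

section \<open>Second order frames of a null lift\<close>

declare One_nat_def [simp del]

text \<open>\<open>g'\<close> is the derivative of \<open>g\<close> with respect to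
  \<open>s\<close>, where \<open>ds = \<sigma> dt\<close>. Being a relation, it allows derivatives
  to be replaced by expressions that agree with them on \<open>I\<close> only. With weight 1 it is
  ordinary differentiation, used for frames in \<open>t\<close> and for variations in
  \<open>\<epsilon>\<close>.\<close>

definition has_sderiv_on :: "real set \<Rightarrow> (real \<Rightarrow> real) \<Rightarrow> (real \<Rightarrow> real) \<Rightarrow> (real \<Rightarrow> real) \<Rightarrow> bool" where
  "has_sderiv_on I \<sigma> g g' \<longleftrightarrow> (\<forall>t\<in>I. (g has_real_derivative \<sigma> t * g' t) (at t))"

definition has_vderiv_on :: "real set \<Rightarrow> (real \<Rightarrow> real) \<Rightarrow> (real \<Rightarrow> nat \<Rightarrow> real) \<Rightarrow> (real \<Rightarrow> nat \<Rightarrow> real) \<Rightarrow> bool" where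
  "has_vderiv_on I \<sigma> v v' \<longleftrightarrow> (\<forall>A. has_sderiv_on I \<sigma> (\<lambda>t. v t A) (\<lambda>t. v' t A))"

definition vsmooth_on :: "real set \<Rightarrow> (real \<Rightarrow> nat \<Rightarrow> real) \<Rightarrow> bool" where
  "vsmooth_on I v \<longleftrightarrow> (\<forall>A. Cinf_on I (\<lambda>t. v t A))"

lemma sderiv_const: "has_sderiv_on I \<sigma> (\<lambda>_. c) (\<lambda>_. 0)"
  by (simp add: has_sderiv_on_def)

lemma sderiv_add: "has_sderiv_on I \<sigma> f f' \<Longrightarrow> has_sderiv_on I \<sigma> g g' \<Longrightarrow>
    has_sderiv_on I \<sigma> (\<lambda>t. f t + g t) (\<lambda>t. f' t + g' t)"
  by (auto simp: has_sderiv_on_def algebra_simps intro!: derivative_eq_intros)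

lemma sderiv_diff: "has_sderiv_on I \<sigma> f f' \<Longrightarrow> has_sderiv_on I \<sigma> g g' \<Longrightarrow>
    has_sderiv_on I \<sigma> (\<lambda>t. f t - g t) (\<lambda>t. f' t - g' t)"
  by (auto simp: has_sderiv_on_def algebra_simps intro!: derivative_eq_intros)

lemma sderiv_mult: "has_sderiv_on I \<sigma> f f' \<Longrightarrow> has_sderiv_on I \<sigma> g g' \<Longrightarrow>
    has_sderiv_on I \<sigma> (\<lambda>t. f t * g t) (\<lambda>t. f' t * g t + f t * g' t)"
  by (fastforce simp: has_sderiv_on_def algebra_simps intro!: derivative_eq_intros)

lemma sderiv_sum: "(\<And>i. i \<in> S \<Longrightarrow> has_sderiv_on I \<sigma> (f i) (f' i)) \<Longrightarrow>
    has_sderiv_on I \<sigma> (\<lambda>t. \<Sum>i\<in>S. f i t) (\<lambda>t. \<Sum>i\<in>S. f' i t)"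
  by (induction S rule: infinite_finite_induct) (auto intro: sderiv_add sderiv_const)

lemma sderiv_unique:
  assumes "open I" "has_sderiv_on I \<sigma> f f'" "has_sderiv_on I \<sigma> g g'" "\<And>t. t \<in> I \<Longrightarrow> f t = g t"
    "t \<in> I" "\<sigma> t \<noteq> 0"
  shows "f' t = g' t"
proof -
  have "\<forall>\<^sub>F s in nhds t. f s = g s"
    using eventually_nhds_in_open[OF assms(1,5)] by eventually_elim (rule assms(4))
  then have "(g has_real_derivative \<sigma> t * f' t) (at t)"
    using has_real_derivative_cong_ev assms(2,5) unfolding has_sderiv_on_def by blast
  then show ?thesis
    using DERIV_unique assms(3,5,6) unfolding has_sderiv_on_def by fastforce
qed

lemma sderiv_cong:
  assumes "open I" "has_sderiv_on I \<sigma> f f'" "\<And>t. t \<in> I \<Longrightarrow> f t = g t" "\<And>t. t \<in> I \<Longrightarrow> f' t = g' t"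
  shows "has_sderiv_on I \<sigma> g g'"
  unfolding has_sderiv_on_def
proof
  fix t assume t: "t \<in> I"
  have "\<forall>\<^sub>F s in nhds t. f s = g s"
    using eventually_nhds_in_open[OF assms(1) t] by eventually_elim (rule assms(3))
  then show "(g has_real_derivative \<sigma> t * g' t) (at t)"
    using has_real_derivative_cong_ev assms(2) t assms(4)[OF t] unfolding has_sderiv_on_def by metis
qed

lemma sderiv_exists:
  "Cinf_on I g \<Longrightarrow> (\<And>t. t \<in> I \<Longrightarrow> \<sigma> t \<noteq> 0) \<Longrightarrow> has_sderiv_on I \<sigma> g (\<lambda>t. deriv g t / \<sigma> t)"
  by (simp add: has_sderiv_on_def Cinf_on_has_deriv)

lemma Cinf_on_sderiv:
  "open I \<Longrightarrow> Cinf_on I g \<Longrightarrow> Cinf_on I \<sigma> \<Longrightarrow> (\<And>t. t \<in> I \<Longrightarrow> \<sigma> t \<noteq> 0) \<Longrightarrow> Cinf_on I (\<lambda>t. deriv g t / \<sigma> t)"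
  by (intro Cinf_on_divide Cinf_on_deriv)

lemma vderiv_add: "has_vderiv_on I \<sigma> v v' \<Longrightarrow> has_vderiv_on I \<sigma> w w' \<Longrightarrow>
    has_vderiv_on I \<sigma> (\<lambda>t. v t + w t) (\<lambda>t. v' t + w' t)"
  by (auto simp: has_vderiv_on_def intro: sderiv_add)

lemma vderiv_diff: "has_vderiv_on I \<sigma> v v' \<Longrightarrow> has_vderiv_on I \<sigma> w w' \<Longrightarrow>
    has_vderiv_on I \<sigma> (\<lambda>t. v t - w t) (\<lambda>t. v' t - w' t)"
  by (auto simp: has_vderiv_on_def intro: sderiv_diff)

lemma vderiv_sc: "has_sderiv_on I \<sigma> c c' \<Longrightarrow> has_vderiv_on I \<sigma> v v' \<Longrightarrow>
    has_vderiv_on I \<sigma> (\<lambda>t. sc (c t) (v t)) (\<lambda>t. sc (c' t) (v t) + sc (c t) (v' t))"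
  by (auto simp: has_vderiv_on_def sc_def intro: sderiv_mult)

lemma vderiv_unique:
  assumes "open I" "has_vderiv_on I \<sigma> v v'" "has_vderiv_on I \<sigma> w w'" "\<And>t. t \<in> I \<Longrightarrow> v t = w t"
    "t \<in> I" "\<sigma> t \<noteq> 0"
  shows "v' t = w' t"
proof
  fix A
  show "v' t A = w' t A"
    by (rule sderiv_unique[OF assms(1), of \<sigma> "\<lambda>t. v t A" "\<lambda>t. v' t A" "\<lambda>t. w t A" "\<lambda>t. w' t A"])
      (use assms(2-) in \<open>auto simp: has_vderiv_on_def\<close>)
qed

lemma vderiv_cong:
  assumes "open I" "has_vderiv_on I \<sigma> v v'" "\<And>t. t \<in> I \<Longrightarrow> v t = w t" "\<And>t. t \<in> I \<Longrightarrow> v' t = w' t"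
  shows "has_vderiv_on I \<sigma> w w'"
  unfolding has_vderiv_on_def
proof
  fix A
  show "has_sderiv_on I \<sigma> (\<lambda>t. w t A) (\<lambda>t. w' t A)"
    by (rule sderiv_cong[OF assms(1), of \<sigma> "\<lambda>t. v t A" "\<lambda>t. v' t A"])
      (use assms(2-) in \<open>auto simp: has_vderiv_on_def\<close>)
qed

lemma sderiv_lor:
  assumes "has_vderiv_on I \<sigma> v v'" "has_vderiv_on I \<sigma> w w'"
  shows "has_sderiv_on I \<sigma> (\<lambda>t. lor n (v t) (w t)) (\<lambda>t. lor n (v' t) (w t) + lor n (v t) (w' t))"
proof -
  have "has_sderiv_on I \<sigma> (\<lambda>t. v t A * w t B) (\<lambda>t. v' t A * w t B + v t A * w' t B)" for A B
    using assms sderiv_mult unfolding has_vderiv_on_def by blast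
  then have "has_sderiv_on I \<sigma> (\<lambda>t. lor n (v t) (w t)) (\<lambda>t. (\<Sum>A\<in>{1..n}. v' t A * w t A + v t A * w' t A)
      - (v' t 0 * w t (n+1) + v t 0 * w' t (n+1)) - (v' t (n+1) * w t 0 + v t (n+1) * w' t 0))"
    unfolding lor_def by (intro sderiv_diff sderiv_sum)
  then show ?thesis
    by (simp add: lor_def[of n "v' t" for t] lor_def[of n "v t" "w' t" for t] sum.distrib algebra_simps)
qed

text \<open>The source of the skew-symmetry relations below: each comes from a product that is
  constant along the curve.\<close>

lemma lor_const_deriv:
  assumes "open I" "has_vderiv_on I \<sigma> v v'" "has_vderiv_on I \<sigma> w w'"
    "\<And>t. t \<in> I \<Longrightarrow> lor n (v t) (w t) = c" "t \<in> I" "\<sigma> t \<noteq> 0"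
  shows "lor n (v' t) (w t) + lor n (v t) (w' t) = 0"
  by (rule sderiv_unique[OF assms(1) sderiv_lor[OF assms(2,3)] sderiv_const assms(4-6)])

lemma vsmooth_add: "open I \<Longrightarrow> vsmooth_on I v \<Longrightarrow> vsmooth_on I w \<Longrightarrow> vsmooth_on I (\<lambda>t. v t + w t)"
  by (auto simp: vsmooth_on_def intro: Cinf_on_add)

lemma vsmooth_diff: "open I \<Longrightarrow> vsmooth_on I v \<Longrightarrow> vsmooth_on I w \<Longrightarrow> vsmooth_on I (\<lambda>t. v t - w t)"
  by (auto simp: vsmooth_on_def intro: Cinf_on_diff)

lemma vsmooth_sc: "open I \<Longrightarrow> Cinf_on I c \<Longrightarrow> vsmooth_on I v \<Longrightarrow> vsmooth_on I (\<lambda>t. sc (c t) (v t))"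
  by (auto simp: vsmooth_on_def sc_def intro: Cinf_on_mult)

lemma vsmooth_sum: "open I \<Longrightarrow> (\<And>i. i \<in> S \<Longrightarrow> vsmooth_on I (v i)) \<Longrightarrow> vsmooth_on I (\<lambda>t. \<Sum>i\<in>S. v i t)"
  by (auto simp: vsmooth_on_def sum_fun_apply intro: Cinf_on_sum)

lemma Cinf_on_lor: "open I \<Longrightarrow> vsmooth_on I v \<Longrightarrow> vsmooth_on I w \<Longrightarrow> Cinf_on I (\<lambda>t. lor n (v t) (w t))"
  unfolding vsmooth_on_def lor_def by (intro Cinf_on_diff Cinf_on_sum Cinf_on_mult) auto

lemma vsmooth_cong: "open I \<Longrightarrow> (\<And>t. t \<in> I \<Longrightarrow> v t = w t) \<Longrightarrow> vsmooth_on I v \<Longrightarrow> vsmooth_on I w"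
  unfolding vsmooth_on_def by (auto intro: Cinf_on_cong[of I "\<lambda>t. v t A" for A])

text \<open>A total function in place of the relation \<open>has_vderiv_on\<close>, which is what
  makes iterated derivatives expressible.\<close>

definition vdiv_deriv :: "(real \<Rightarrow> real) \<Rightarrow> (real \<Rightarrow> nat \<Rightarrow> real) \<Rightarrow> real \<Rightarrow> nat \<Rightarrow> real" where
  "vdiv_deriv \<sigma> v t = (\<lambda>A. deriv (\<lambda>s. v s A) t / \<sigma> t)"

lemma vderiv_exists:
  "vsmooth_on I v \<Longrightarrow> (\<And>t. t \<in> I \<Longrightarrow> \<sigma> t \<noteq> 0) \<Longrightarrow> has_vderiv_on I \<sigma> v (vdiv_deriv \<sigma> v)"
  unfolding vsmooth_on_def has_vderiv_on_def vdiv_deriv_def using sderiv_exists by blast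

lemma vsmooth_vdiv_deriv:
  "open I \<Longrightarrow> vsmooth_on I v \<Longrightarrow> Cinf_on I \<sigma> \<Longrightarrow> (\<And>t. t \<in> I \<Longrightarrow> \<sigma> t \<noteq> 0) \<Longrightarrow> vsmooth_on I (vdiv_deriv \<sigma> v)"
  unfolding vsmooth_on_def vdiv_deriv_def using Cinf_on_sderiv by blast

lemma isvec_vderiv:
  assumes "open I" "has_vderiv_on I \<sigma> v v'" "\<And>t. t \<in> I \<Longrightarrow> isvec n (v t)" "t \<in> I" "\<sigma> t \<noteq> 0"
  shows "isvec n (v' t)"
  unfolding isvec_def
proof (intro allI impI)
  fix A assume "n + 1 < A"
  then show "v' t A = 0"
    using sderiv_unique[OF assms(1) _ sderiv_const[of I \<sigma> 0] _ assms(4,5), of "\<lambda>t. v t A" "\<lambda>t. v' t A"]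
      assms(2,3) by (simp add: has_vderiv_on_def isvec_def)
qed

text \<open>\<open>g0, g1, g2\<close> stand for a null lift and its first two derivatives. A second order frame is
  forced to have \<open>e_1\<close> along \<open>g1\<close> and \<open>e_(n+1)\<close> the null vector of \<open>span (g0, g1, g2)\<close> dual to
  \<open>g0\<close>; the other legs come from \<open>hat\<close> by the rotation that takes \<open>hat 1\<close> to \<open>e_1\<close>, followed by a
  shift along \<open>g0\<close>.\<close>

definition lift_conormal :: "nat \<Rightarrow> (nat \<Rightarrow> real) \<Rightarrow> (nat \<Rightarrow> real) \<Rightarrow> (nat \<Rightarrow> real) \<Rightarrow> nat \<Rightarrow> real" where
  "lift_conormal n g0 g1 g2 = sc (1 / lor n g1 g1) g2 - sc (lor n g1 g2 / (lor n g1 g1)^2) g1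
     + sc ((lor n g2 g2 / (lor n g1 g1)^2 - (lor n g1 g2)^2 / (lor n g1 g1)^3) / 2) g0"

definition lift_tangent :: "nat \<Rightarrow> (nat \<Rightarrow> real) \<Rightarrow> nat \<Rightarrow> real" where
  "lift_tangent n g1 = sc (1 / sqrt (lor n g1 g1)) g1"

definition lift_rot :: "nat \<Rightarrow> (nat \<Rightarrow> real) \<Rightarrow> (nat \<Rightarrow> nat \<Rightarrow> real) \<Rightarrow> nat \<Rightarrow> nat \<Rightarrow> real" where
  "lift_rot n u hat b = hat b - sc (lor n u (hat b) / (1 + lor n u (hat 1))) (hat 1 + u)"

definition lift_frame :: "nat \<Rightarrow> (nat \<Rightarrow> real) \<Rightarrow> (nat \<Rightarrow> real) \<Rightarrow> (nat \<Rightarrow> real) \<Rightarrow> (nat \<Rightarrow> nat \<Rightarrow> real) \<Rightarrow> nat \<Rightarrow> nat \<Rightarrow> real" where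
  "lift_frame n g0 g1 g2 hat b =
     (if b = 0 then g0 else if b = n + 1 then lift_conormal n g0 g1 g2
      else if b = 1 then lift_tangent n g1
      else lift_rot n (lift_tangent n g1) hat b
        + sc (lor n (lift_rot n (lift_tangent n g1) hat b) (lift_conormal n g0 g1 g2)) g0)"

text \<open>\<open><g1, g1>\<close> times the squared length of the part orthogonal to
  \<open>g1\<close> of \<open>W\<close>, the derivative of the conormal taken modulo
  \<open>g0\<close> and \<open>g1\<close>. Multiplied by \<open>\<sigma>^4\<close> it is the fourth
  power of the arclength density.\<close>

definition arclength_quartic :: "nat \<Rightarrow> (nat \<Rightarrow> real) \<Rightarrow> (nat \<Rightarrow> real) \<Rightarrow> (nat \<Rightarrow> real) \<Rightarrow> real" where
  "arclength_quartic n g1 g2 g3 =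
     lor n g3 g3 / lor n g1 g1 - 6 * lor n g1 g2 * lor n g2 g3 / (lor n g1 g1)^2
     + 9 * (lor n g1 g2)^2 * lor n g2 g2 / (lor n g1 g1)^3
     - (lor n g1 g3 / lor n g1 g1 - 3 * (lor n g1 g2)^2 / (lor n g1 g1)^2)^2"

text \<open>Positivity of \<open><g1, hat 1>\<close> keeps the denominator
  \<open>1 + <u, hat 1>\<close> of the rotation away from 0. The final shift makes the legs
  orthogonal to the conormal and changes no other product, since \<open>g0\<close> is null and
  orthogonal to the tangent and to all rotated legs.\<close>

lemma lor_frame_lift_frame:
  assumes "1 \<le> n" "isvec n g0" "isvec n g1" "isvec n g2"
    and null: "lor n g0 g0 = 0" "lor n g0 g1 = 0" "lor n g0 g2 = - lor n g1 g1" and R: "0 < lor n g1 g1"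
    and hat: "\<And>i. i \<in> {1..n} \<Longrightarrow> isvec n (hat i)" "\<And>i. i \<in> {1..n} \<Longrightarrow> lor n g0 (hat i) = 0"
      "\<And>i j. i \<in> {1..n} \<Longrightarrow> j \<in> {1..n} \<Longrightarrow> lor n (hat i) (hat j) = (if i = j then 1 else 0)"
    and pos: "0 < lor n g1 (hat 1)"
  shows "lor_frame n (lift_frame n g0 g1 g2 hat)"
proof -
  define R where "R = lor n g1 g1"
  define u where "u = lift_tangent n g1"
  define l where "l = lift_conormal n g0 g1 g2"
  define x where "x b = lift_rot n u hat b" for b
  note [simp] = null
  have null' [simp]: "lor n g1 g0 = 0" "lor n g2 g0 = - R" "lor n g2 g1 = lor n g1 g2"
    using null by (simp_all add: lor_commute[of n g1 g0] lor_commute[of n g2] R_def)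
  have R0: "R > 0" "lor n g1 g1 = R" using R by (auto simp: R_def)
  have u: "lor n u u = 1" "lor n u g0 = 0" "lor n g0 u = 0"
    using R0 by (simp_all add: u_def lift_tangent_def lor_simps)
  have l: "lor n l g0 = -1" "lor n l l = 0" "lor n l u = 0" "lor n u l = 0" "lor n g0 l = -1"
    using R0 by (simp_all add: l_def lift_conormal_def u_def lift_tangent_def lor_simps
        field_simps power2_eq_square power3_eq_cube power4_eq_xxxx)
  have p: "0 < lor n u (hat 1)" using pos R0 by (simp add: u_def lift_tangent_def lor_simps)
  have n1: "1 \<in> {1..n}" using assms(1) by simp
  have hg: "lor n (hat i) g0 = 0" if "i \<in> {1..n}" for i
    using hat(2)[OF that] lor_commute by simp
  have xg: "lor n (x i) g0 = 0" "lor n g0 (x i) = 0" if "i \<in> {1..n}" for i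
    using hg[OF that] hg[OF n1] hat(2)[OF that] hat(2)[OF n1] u
    by (simp_all add: x_def lift_rot_def lor_simps)
  define P where "P = 1 + lor n u (hat 1)"
  have P: "P \<noteq> 0" using p by (simp add: P_def)
  have hu: "lor n (hat i) u = lor n u (hat i)" "lor n (hat 1) u = P - 1" "lor n u (hat 1) = P - 1" for i
    by (simp_all add: lor_commute P_def)
  have xu: "lor n u (x i) = 0" for i
    unfolding x_def lift_rot_def lor_simps hu(3) u using P by simp
  then have xu': "lor n (x i) u = 0" for i
    by (simp add: lor_commute)
  have xx: "lor n (x i) (x j) = (if i = j then 1 else 0)" if "i \<in> {2..n}" "j \<in> {2..n}" for i j
  proof -
    have h: "lor n (hat 1) (hat 1) = 1" "lor n (hat i) (hat 1) = 0" "lor n (hat 1) (hat j) = 0"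
      "lor n (hat i) (hat j) = (if i = j then 1 else 0)"
      using that n1 by (auto simp: hat(3))
    show ?thesis
      unfolding x_def lift_rot_def lor_simps h hu u using P by (simp add: field_simps)
  qed
  have ivu: "isvec n u" "isvec n l"
    using assms by (auto simp: u_def lift_tangent_def l_def lift_conormal_def intro!: isvec_closed)
  have ivx: "isvec n (x i)" if "i \<in> {1..n}" for i
    using hat(1)[OF that] hat(1)[OF n1] ivu unfolding x_def lift_rot_def by (intro isvec_closed)
  have E: "lift_frame n g0 g1 g2 hat b = (if b = 0 then g0 else if b = n + 1 then l
      else if b = 1 then u else x b + sc (lor n (x b) l) g0)" for b
    by (simp add: lift_frame_def u_def l_def x_def)
  show ?thesis
  proof (rule lor_frameI)
    show "isvec n (lift_frame n g0 g1 g2 hat a)" if "a \<le> n + 1" for a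
      unfolding E using that assms(2) ivu ivx by (auto intro!: isvec_closed)
    show "lor n (lift_frame n g0 g1 g2 hat i) (lift_frame n g0 g1 g2 hat j) = (if i = j then 1 else 0)"
      if "i \<in> {1..n}" "j \<in> {1..n}" for i j
      using that xx[of i j] u xu xu' xg[of i] xg[of j]
      by (cases "i = 1"; cases "j = 1") (auto simp: E lor_simps)
  next
    fix i assume i: "i \<in> {1..n}"
    show "lor n (lift_frame n g0 g1 g2 hat i) (lift_frame n g0 g1 g2 hat 0) = 0"
      using i u xg[OF i] by (simp add: E lor_simps)
    show "lor n (lift_frame n g0 g1 g2 hat i) (lift_frame n g0 g1 g2 hat (n+1)) = 0"
      using i l xg[OF i] by (simp add: E lor_simps)
  qed (use l in \<open>simp_all add: E\<close>)

qed

text \<open>The frame is of second order because the derivatives of its first two legs stay in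
  \<open>span (g0, g1, g2)\<close>, to which the legs with index at least 2 are orthogonal. By
  skew-symmetry the coefficients \<open>phi^0_b\<close> are components of the derivative of the
  conormal, so the Parseval identity expresses the sum of their squares without mentioning the
  individual legs.\<close>

lemma arclength_density_lift_frame:
  fixes g0 g1 g2 g3 :: "real \<Rightarrow> nat \<Rightarrow> real"
  assumes "1 \<le> n" "open I" and \<sigma>0: "\<And>t. t \<in> I \<Longrightarrow> \<sigma> t \<noteq> 0"
    and d: "has_vderiv_on I \<sigma> g0 g1" "has_vderiv_on I \<sigma> g1 g2" "has_vderiv_on I \<sigma> g2 g3"
    and sm: "vsmooth_on I g0" "vsmooth_on I g1" "vsmooth_on I g2" "\<And>i. i \<in> {1..n} \<Longrightarrow> vsmooth_on I (\<lambda>t. hat t i)"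
    and iv: "\<And>t. t \<in> I \<Longrightarrow> isvec n (g0 t)"
    and null: "\<And>t. t \<in> I \<Longrightarrow> lor n (g0 t) (g0 t) = 0"
    and R: "\<And>t. t \<in> I \<Longrightarrow> 0 < lor n (g1 t) (g1 t)"
    and hat: "\<And>t i. t \<in> I \<Longrightarrow> i \<in> {1..n} \<Longrightarrow> isvec n (hat t i)" "\<And>t i. t \<in> I \<Longrightarrow> i \<in> {1..n} \<Longrightarrow> lor n (g0 t) (hat t i) = 0"
      "\<And>t i j. t \<in> I \<Longrightarrow> i \<in> {1..n} \<Longrightarrow> j \<in> {1..n} \<Longrightarrow> lor n (hat t i) (hat t j) = (if i = j then 1 else 0)"
    and pos: "\<And>t. t \<in> I \<Longrightarrow> 0 < lor n (g1 t) (hat t 1)"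
    and M: "\<And>t. t \<in> I \<Longrightarrow> 0 < arclength_quartic n (g1 t) (g2 t) (g3 t)"
    and E: "E = (\<lambda>t A b. lift_frame n (g0 t) (g1 t) (g2 t) (hat t) b A)"
    and mob: "\<And>t. t \<in> I \<Longrightarrow> mob n (E t)"
  shows "arclength_density n I (\<lambda>t. proj (g0 t))
      (\<lambda>t. \<bar>\<sigma> t\<bar> * arclength_quartic n (g1 t) (g2 t) (g3 t) powr (1/4))"
proof -
  define L where "L b t = lift_frame n (g0 t) (g1 t) (g2 t) (hat t) b" for b t
  have iv1: "isvec n (g1 t)" if "t \<in> I" for t
    by (rule isvec_vderiv[OF assms(2) d(1) iv that \<sigma>0[OF that]])
  have iv2: "isvec n (g2 t)" if "t \<in> I" for t
    by (rule isvec_vderiv[OF assms(2) d(2) iv1 that \<sigma>0[OF that]])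
  have nl: "lor n (g0 t) (g1 t) = 0" if "t \<in> I" for t
    using lor_const_deriv[OF assms(2) d(1) d(1) null that \<sigma>0[OF that]]
    by (simp add: lor_commute[of n "g1 t"])
  have n2: "lor n (g0 t) (g2 t) = - lor n (g1 t) (g1 t)" if "t \<in> I" for t
    using lor_const_deriv[OF assms(2) d(1) d(2) nl that \<sigma>0[OF that]] by simp
  have n3: "lor n (g0 t) (g3 t) = - 3 * lor n (g1 t) (g2 t)" if "t \<in> I" for t
  proof -
    have "has_sderiv_on I \<sigma> (\<lambda>t. lor n (g0 t) (g2 t) + lor n (g1 t) (g1 t))
       (\<lambda>t. (lor n (g1 t) (g2 t) + lor n (g0 t) (g3 t)) + (lor n (g2 t) (g1 t) + lor n (g1 t) (g2 t)))"
      by (intro sderiv_add sderiv_lor d)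
    from sderiv_unique[OF assms(2) this sderiv_const[of I \<sigma> 0] _ that \<sigma>0[OF that]] n2
    show ?thesis by (simp add: lor_commute[of n "g2 t" "g1 t"])
  qed
  have F: "lor_frame n (\<lambda>b. L b t)" if "t \<in> I" for t
    unfolding L_def
    by (rule lor_frame_lift_frame) (use assms(1) iv iv1 iv2 null nl n2 R hat pos that in auto)
  have colE: "col n (E t) b = L b t" if "t \<in> I" "b \<le> n + 1" for t b
    using F[OF that(1)] that(2) by (auto simp: fun_eq_iff col_def E L_def lor_frame_def isvec_def)
  have smL: "vsmooth_on I (L b)" if "b \<le> n + 1" for b
  proof -
    have CR: "Cinf_on I (\<lambda>t. lor n (g1 t) (g1 t))" "Cinf_on I (\<lambda>t. lor n (g1 t) (g2 t))" "Cinf_on I (\<lambda>t. lor n (g2 t) (g2 t))"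
      by (intro Cinf_on_lor assms(2) sm)+
    have R': "sqrt (lor n (g1 t) (g1 t)) \<noteq> 0" "lor n (g1 t) (g1 t) \<noteq> 0" "lor n (g1 t) (g1 t) ^ k \<noteq> 0" if "t \<in> I" for t k
      using R[OF that] by auto
    have su: "vsmooth_on I (\<lambda>t. lift_tangent n (g1 t))"
      unfolding lift_tangent_def by (intro vsmooth_sc Cinf_on_divide Cinf_on_sqrt Cinf_on_const CR assms(2) sm R R')
    have sl: "vsmooth_on I (\<lambda>t. lift_conormal n (g0 t) (g1 t) (g2 t))"
      unfolding lift_conormal_def
      by (intro vsmooth_add vsmooth_diff vsmooth_sc Cinf_on_divide Cinf_on_diff Cinf_on_power Cinf_on_const CR assms(2) sm R') auto
    have n1: "1 \<in> {1..n}" using assms(1) by simp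
    have P: "1 + lor n (lift_tangent n (g1 t)) (hat t 1) \<noteq> 0" if "t \<in> I" for t
      using pos[OF that] R[OF that] by (auto simp: lift_tangent_def lor_simps intro!: add_pos_pos less_imp_neq[symmetric] divide_pos_pos)
    have sx: "vsmooth_on I (\<lambda>t. lift_rot n (lift_tangent n (g1 t)) (hat t) b)" if "b \<in> {1..n}"
      unfolding lift_rot_def
      by (intro vsmooth_add vsmooth_diff vsmooth_sc Cinf_on_divide Cinf_on_add Cinf_on_lor Cinf_on_const assms(2) su P sm n1 that)
    consider "b = 0" | "b = n+1" | "b = 1" "b \<noteq> n+1" | "b \<in> {1..n}" "b \<noteq> 1" using \<open>b \<le> n+1\<close> by fastforce
    then show ?thesis
    proof cases
      case 4
      then have "L b = (\<lambda>t. lift_rot n (lift_tangent n (g1 t)) (hat t) b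
        + sc (lor n (lift_rot n (lift_tangent n (g1 t)) (hat t) b) (lift_conormal n (g0 t) (g1 t) (g2 t))) (g0 t))"
        by (auto simp: L_def lift_frame_def)
      then show ?thesis
        using sx[OF 4(1)] sl sm assms(2) by (auto intro!: vsmooth_add vsmooth_sc Cinf_on_lor)
    qed (use sm su sl in \<open>simp_all add: L_def[abs_def] lift_frame_def\<close>)
  qed
  define L' where "L' b = vdiv_deriv \<sigma> (L b)" for b
  have dL: "has_vderiv_on I \<sigma> (L b) (L' b)" if "b \<le> n + 1" for b
    unfolding L'_def using vderiv_exists smL[OF that] \<sigma>0 by blast
  have ivL': "isvec n (L' b t)" if "b \<le> n + 1" "t \<in> I" for b t
    using isvec_vderiv[OF assms(2) dL[OF that(1)] _ that(2) \<sigma>0[OF that(2)]] F that by (auto simp: lor_frame_def)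
  have dcolE: "dcol n E t b = sc (\<sigma> t) (L' b t)" if "t \<in> I" "b \<le> n + 1" for t b
  proof
    fix A
    show "dcol n E t b A = sc (\<sigma> t) (L' b t) A"
      using ivL'[OF that(2,1)] \<sigma>0[OF that(1)]
      by (auto simp: dcol_def sc_def E L'_def vdiv_deriv_def L_def isvec_def)
  qed
  have L'0: "L' 0 t = g1 t" if "t \<in> I" for t
    by (rule vderiv_unique[OF assms(2) dL[of 0] d(1)]) (use that \<sigma>0 in \<open>auto simp: L_def lift_frame_def\<close>)
  define R2 where "R2 t = lor n (g1 t) (g1 t)" for t
  have R2: "R2 t > 0" "lor n (g1 t) (g1 t) = R2 t" if "t \<in> I" for t using R[OF that] by (auto simp: R2_def)
  have L0: "L 0 t = g0 t" "L 1 t = lift_tangent n (g1 t)" "L (n+1) t = lift_conormal n (g0 t) (g1 t) (g2 t)" for t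
    using assms(1) by (auto simp: L_def lift_frame_def)
  have CR2: "Cinf_on I R2" unfolding R2_def by (intro Cinf_on_lor assms(2) sm)
  \<comment> \<open>Existence of \<open>a'\<close> is enough: it only multiplies \<open>g1\<close>,
    which is orthogonal to the legs with index at least 2.\<close>
  obtain a' where a': "has_sderiv_on I \<sigma> (\<lambda>t. 1 / sqrt (R2 t)) a'"
  proof
    have "sqrt (R2 t) \<noteq> 0" if "t \<in> I" for t using R2[OF that] by simp
    then show "has_sderiv_on I \<sigma> (\<lambda>t. 1 / sqrt (R2 t)) (\<lambda>t. deriv (\<lambda>t. 1 / sqrt (R2 t)) t / \<sigma> t)"
      by (intro sderiv_exists \<sigma>0 Cinf_on_divide Cinf_on_const Cinf_on_sqrt CR2 assms(2) R2(1))
  qed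
  have L'1: "lor n (L' 1 t) (L b t) = 0" if "t \<in> I" "b \<in> {2..n}" for t b
  proof -
    have "has_vderiv_on I \<sigma> (L 1) (\<lambda>t. sc (a' t) (g1 t) + sc (1 / sqrt (R2 t)) (g2 t))"
      by (rule vderiv_cong[OF assms(2) vderiv_sc[OF a' d(2)]]) (auto simp: L0 lift_tangent_def R2_def)
    then have "L' 1 t = sc (a' t) (g1 t) + sc (1 / sqrt (R2 t)) (g2 t)"
      using vderiv_unique[OF assms(2) dL[of 1] _ _ that(1) \<sigma>0[OF that(1)]] assms(1) by auto
    moreover have "lor n (g1 t) (L b t) = 0"
      using lor_frameD(9)[OF F[OF that(1)], of 1 b] assms(1) that R2[OF that(1)]
      by (auto simp: L0 lift_tangent_def lor_simps)
    moreover have "lor n (g2 t) (L b t) = 0"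
      using lor_frameD(5,7)[OF F[OF that(1)], of b] that R2[OF that(1)] calculation(2)
      by (auto simp: L0 lift_conormal_def lor_simps)
    ultimately show ?thesis by (simp add: lor_simps)
  qed
  \<comment> \<open>The factor 3 collects 2 from the derivative of \<open>1 / R2\<close> and 1 from
    \<open>D g1 = g2\<close> in the \<open>g1\<close> term of the conormal.\<close>
  define W where "W t = sc (1 / R2 t) (g3 t) - sc (3 * lor n (g1 t) (g2 t) / R2 t ^ 2) (g2 t)" for t
  have psum: "(\<Sum>b\<in>{2..n}. (lor n (L b t) (L' (n+1) t))^2) = lor n (W t) (W t) - (lor n (W t) (g1 t))^2 / R2 t"
    if t: "t \<in> I" for t
  proof -
    have CR: "Cinf_on I (\<lambda>t. lor n (g1 t) (g2 t))" "Cinf_on I (\<lambda>t. lor n (g2 t) (g2 t))"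
      by (intro Cinf_on_lor assms(2) sm)+
    have R': "R2 t ^ k \<noteq> 0" if "t \<in> I" for t k
      using R2[OF that] by auto
    define c1 where "c1 t = lor n (g1 t) (g2 t) / (R2 t)^2" for t
    define c0 where "c0 t = (lor n (g2 t) (g2 t) / (R2 t)^2 - (lor n (g1 t) (g2 t))^2 / (R2 t)^3) / 2" for t
    have sc1: "Cinf_on I c1" unfolding c1_def by (intro Cinf_on_divide Cinf_on_power CR CR2 assms(2) R')
    have sc0: "Cinf_on I c0" unfolding c0_def
      by (intro Cinf_on_divide Cinf_on_diff Cinf_on_power Cinf_on_const CR CR2 assms(2) R') auto
    obtain c1' c0' where c': "has_sderiv_on I \<sigma> c1 c1'" "has_sderiv_on I \<sigma> c0 c0'"
      using sderiv_exists[OF sc1, of \<sigma>] sderiv_exists[OF sc0, of \<sigma>] \<sigma>0 by blast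
    have dR: "has_sderiv_on I \<sigma> (\<lambda>t. 1 / R2 t) (\<lambda>t. - 2 * lor n (g1 t) (g2 t) / (R2 t)^2)"
      unfolding has_sderiv_on_def
    proof
      fix t assume t: "t \<in> I"
      have "(R2 has_real_derivative \<sigma> t * (2 * lor n (g1 t) (g2 t))) (at t)"
        using sderiv_lor[OF d(2) d(2), of n] t unfolding has_sderiv_on_def R2_def by (auto simp: lor_commute[of n "g2 t"])
      then show "((\<lambda>t. 1 / R2 t) has_real_derivative \<sigma> t * (- 2 * lor n (g1 t) (g2 t) / (R2 t)\<^sup>2)) (at t)"
        using R2[OF t] by (auto intro!: derivative_eq_intros simp: power2_eq_square)
    qed
    have "has_vderiv_on I \<sigma> (\<lambda>t. sc (1 / R2 t) (g2 t) - sc (c1 t) (g1 t) + sc (c0 t) (g0 t))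
      (\<lambda>t. (sc (- 2 * lor n (g1 t) (g2 t) / (R2 t)^2) (g2 t) + sc (1 / R2 t) (g3 t))
         - (sc (c1' t) (g1 t) + sc (c1 t) (g2 t)) + (sc (c0' t) (g0 t) + sc (c0 t) (g1 t)))"
      by (intro vderiv_add vderiv_diff vderiv_sc c' dR d)
    then have "has_vderiv_on I \<sigma> (L (n+1)) (\<lambda>t. (sc (- 2 * lor n (g1 t) (g2 t) / (R2 t)^2) (g2 t) + sc (1 / R2 t) (g3 t))
         - (sc (c1' t) (g1 t) + sc (c1 t) (g2 t)) + (sc (c0' t) (g0 t) + sc (c0 t) (g1 t)))"
      by (rule vderiv_cong[OF assms(2)]) (auto simp: L0 lift_conormal_def R2_def c1_def c0_def)
    then have eq: "L' (n+1) t = (sc (- 2 * lor n (g1 t) (g2 t) / (R2 t)^2) (g2 t) + sc (1 / R2 t) (g3 t))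
         - (sc (c1' t) (g1 t) + sc (c1 t) (g2 t)) + (sc (c0' t) (g0 t) + sc (c0 t) (g1 t))"
      using vderiv_unique[OF assms(2) dL[of "n+1"] _ _ t \<sigma>0[OF t]] by auto
    \<comment> \<open>The uncomputed derivatives \<open>c1'\<close> and \<open>c0'\<close> occur
      only along \<open>g1\<close> and \<open>g0\<close>. The first cancels when the tangential
      component is subtracted, the second because \<open>g0\<close> is null and orthogonal to
      \<open>W\<close> and \<open>g1\<close>.\<close>
    have eq: "L' (n+1) t = W t + sc (c0 t - c1' t) (g1 t) + sc (c0' t) (g0 t)"
      unfolding eq W_def c1_def by (rule ext) (simp add: sc_def field_simps)
    have Wg: "lor n (W t) (g0 t) = 0"
      using n2[OF t] n3[OF t] R2[OF t]
      by (simp add: W_def lor_simps lor_commute[of n _ "g0 t"] power2_eq_square)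
    have l'l: "lor n (L' (n+1) t) (L (n+1) t) = 0"
      using lor_const_deriv[OF assms(2) dL[OF order_refl] dL[OF order_refl] lor_frameD(4)[OF F] t \<sigma>0[OF t]]
      by (simp add: lor_commute[of n "L (n + 1) t"])
    have split: "(\<Sum>i\<in>{1..n}. f i) = f 1 + (\<Sum>i\<in>{2..n}. f i)" for f :: "nat \<Rightarrow> real"
      using assms(1) by (simp add: sum.atLeast_Suc_atMost numeral_2_eq_2)
    have "lor n (L' (n+1) t) (L' (n+1) t) = (\<Sum>i\<in>{1..n}. (lor n (L' (n+1) t) (L i t))^2)"
      using lor_frame_parseval[OF F[OF t] ivL'[of "n+1" t], of "L' (n+1) t"] t l'l by (simp add: power2_eq_square)
    then have "(\<Sum>b\<in>{2..n}. (lor n (L b t) (L' (n+1) t))^2) =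
        lor n (L' (n+1) t) (L' (n+1) t) - (lor n (L' (n+1) t) (L 1 t))^2"
      unfolding split lor_commute[of n "L b t" "L' (n+1) t" for b] by simp
    also have "lor n (L' (n+1) t) (L 1 t) = (lor n (W t) (g1 t) + (c0 t - c1' t) * R2 t) / sqrt (R2 t)"
      unfolding eq L0 lift_tangent_def lor_simps R2[OF t] nl[OF t] by simp
    also have "lor n (L' (n+1) t) (L' (n+1) t) = lor n (W t) (W t) + 2 * (c0 t - c1' t) * lor n (W t) (g1 t)
        + (c0 t - c1' t)^2 * R2 t"
      using nl[OF t] null[OF t] Wg
      unfolding eq lor_simps R2[OF t] 
      by (simp add: lor_commute[of n "g0 t" "W t"] lor_commute[of n "g1 t" "W t"] lor_commute[of n "g1 t" "g0 t"] algebra_simps power2_eq_square)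
    finally show ?thesis
      using R2[OF t] by (simp add: power_divide field_simps power2_eq_square)
  qed
  have qW: "arclength_quartic n (g1 t) (g2 t) (g3 t) = R2 t * (lor n (W t) (W t) - (lor n (W t) (g1 t))^2 / R2 t)"
    if t: "t \<in> I" for t
    using R2(1)[OF t]
    unfolding arclength_quartic_def W_def lor_simps R2(2)[OF t] lor_commute[of n "g3 t" "g2 t"] lor_commute[of n "g3 t" "g1 t"]
      lor_commute[of n "g2 t" "g1 t"]
    by (simp add: field_simps power2_eq_square power3_eq_cube)
  have ph: "phi n E t 1 0 = \<sigma> t * sqrt (R2 t)" "\<And>b. b \<in> {2..n} \<Longrightarrow> phi n E t b 0 = 0"
      "\<And>b. b \<in> {2..n} \<Longrightarrow> phi n E t b 1 = 0"
      "\<And>b. b \<in> {2..n} \<Longrightarrow> phi n E t 0 b = \<sigma> t * lor n (L b t) (L' (n+1) t)" if t: "t \<in> I" for t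
  proof -
    have "lor_frame n (col n (E t))"
      using F[OF t] colE[OF t] by (simp add: lor_frame_def)
    note P = phi_eq_lor[where e = E and t = t, OF this]
    have g1: "g1 t = sc (sqrt (R2 t)) (L 1 t)"
      using R2[OF t] by (auto simp: L0 lift_tangent_def sc_def)
    show "phi n E t 1 0 = \<sigma> t * sqrt (R2 t)"
      using P(3)[of 0 1] assms(1) t lor_frameD(9)[OF F[OF t], of 1 1] by (simp add: dcolE colE L'0 lor_simps g1)
    show "phi n E t b 0 = 0" if b: "b \<in> {2..n}" for b
      using P(3)[of 0 b] assms(1) t b lor_frameD(9)[OF F[OF t], of 1 b] by (simp add: dcolE colE L'0 lor_simps g1)
    show "phi n E t b 1 = 0" if b: "b \<in> {2..n}" for b
      using P(3)[of 1 b] assms(1) t b L'1[OF t b] by (simp add: dcolE colE lor_simps)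
    show "phi n E t 0 b = \<sigma> t * lor n (L b t) (L' (n+1) t)" if b: "b \<in> {2..n}" for b
    proof -
      have "lor n (L' b t) (L (n+1) t) + lor n (L b t) (L' (n+1) t) = 0"
      proof (rule lor_const_deriv[OF assms(2) dL dL _ t \<sigma>0[OF t]])
        show "lor n (L b s) (L (n+1) s) = 0" if "s \<in> I" for s
          using lor_frameD(8)[OF F[OF that], of b] b by simp
      qed (use b in auto)
      then have "- lor n (L' b t) (L (n+1) t) = lor n (L b t) (L' (n+1) t)" by simp
      then show ?thesis
        using P(1)[of b] b t by (simp add: dcolE colE lor_simps flip: mult_minus_right)
    qed
  qed
  have psq: "psq n E t = arclength_quartic n (g1 t) (g2 t) (g3 t) / (R2 t)^2" if t: "t \<in> I" for t
  proof -
    have "psq n E t = (\<Sum>b\<in>{2..n}. (lor n (L b t) (L' (n+1) t))^2 / R2 t)"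
      unfolding psq_def pcoef_def using R2[OF t] \<sigma>0[OF t]
      by (intro sum.cong refl) (simp add: ph[OF t] power_divide power_mult_distrib)
    also have "\<dots> = (lor n (W t) (W t) - (lor n (W t) (g1 t))^2 / R2 t) / R2 t"
      by (simp add: psum[OF t] flip: sum_divide_distrib)
    finally show ?thesis using R2(1)[OF t] by (simp add: qW[OF t] power2_eq_square)
  qed
  have "frame n I (\<lambda>t. proj (g0 t)) E"
    unfolding frame_def
  proof (intro conjI allI impI ballI)
    show "Cinf_on I (\<lambda>t. E t A b)" if "b \<le> n + 1" for A b
      using smL[OF that] by (auto simp: vsmooth_on_def L_def E)
  qed (auto simp: mob colE L0)
  then have second_order_e: "second_order_frame n I (\<lambda>t. proj (g0 t)) E"
    by (auto simp: second_order_frame_def ph)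
  show ?thesis
    unfolding arclength_density_def
  proof (intro exI[of _ E] conjI ballI second_order_e)
    fix t assume t: "t \<in> I"
    note r = R2(1)[OF t] and m = M[OF t]
    show "phi n E t 1 0 \<noteq> 0" using r \<sigma>0[OF t] by (simp add: ph[OF t])
    show "psq n E t \<noteq> 0" using r m by (simp add: psq[OF t])
    \<comment> \<open>The denominator of \<open>psq\<close> cancels against the factor
      \<open>sqrt (R2 t)\<close> of \<open>phi^1_0\<close>.\<close>
    have "((R2 t)^2) powr (1/4) = sqrt (R2 t)"
      using r by (simp add: powr_half_sqrt powr_powr flip: powr_realpow powr_numeral)
    then show "\<bar>\<sigma> t\<bar> * arclength_quartic n (g1 t) (g2 t) (g3 t) powr (1/4) =
        psq n E t powr (1/4) * \<bar>phi n E t 1 0\<bar>"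
      using r m by (simp add: psq[OF t] ph[OF t] abs_mult powr_divide)
  qed
qed

section \<open>Structure equations of a special third order frame\<close>

lemma frame_lor_frame: "frame n I f e \<Longrightarrow> t \<in> I \<Longrightarrow> lor_frame n (col n (e t))"
  by (auto simp: frame_def mob_def lor_isometry_iff_lor_frame)

lemma frame_vsmooth:
  assumes "frame n I f e" "b \<le> n + 1"
  shows "vsmooth_on I (\<lambda>t. col n (e t) b)"
  unfolding vsmooth_on_def
proof
  fix A show "Cinf_on I (\<lambda>t. col n (e t) b A)"
    by (cases "A \<le> n + 1") (use assms in \<open>auto simp: col_def frame_def Cinf_on_const\<close>)
qed

lemma frame_vderiv:
  assumes "frame n I f e" "b \<le> n + 1" "\<And>t. t \<in> I \<Longrightarrow> \<sigma> t \<noteq> 0"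
  shows "has_vderiv_on I \<sigma> (\<lambda>t. col n (e t) b) (\<lambda>t. sc (1 / \<sigma> t) (dcol n e t b))"
  unfolding has_vderiv_on_def has_sderiv_on_def
proof (intro allI ballI)
  fix A t assume t: "t \<in> I"
  show "((\<lambda>t. col n (e t) b A) has_real_derivative \<sigma> t * sc (1 / \<sigma> t) (dcol n e t b) A) (at t)"
    using assms(1,2) assms(3)[OF t] t
    by (cases "A \<le> n + 1") (auto simp: col_def frame_def sc_def dcol_def intro: Cinf_on_has_deriv)
qed

lemma proj_self: "v \<in> proj v"
  by (auto simp: proj_def sc_def intro!: exI[of _ 1])

text \<open>\<open>one_generic\<close> only provides some second order frame \<open>d\<close>, not
  \<open>e\<close>. Both zeroth legs span the same line. If \<open>phi^1_0\<close> vanished for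
  \<open>e\<close>, the derivative of \<open>e_0\<close> would be a multiple of \<open>e_0\<close>,
  hence that of \<open>d_0\<close> too, and it would be orthogonal to \<open>d_1\<close>,
  contradicting immersion.\<close>

lemma one_generic_phi10:
  assumes "open I" "1 \<le> n" and og: "one_generic n I f" and e: "second_order_frame n I f e" and t: "t \<in> I"
  shows "phi n e t 1 0 \<noteq> 0"
proof
  assume 0: "phi n e t 1 0 = 0"
  obtain d where d: "second_order_frame n I f d" "\<And>t. t \<in> I \<Longrightarrow> phi n d t 1 0 \<noteq> 0"
    using og by (auto simp: one_generic_def)
  have fe: "frame n I f e" and fd: "frame n I f d" using e d by (auto simp: second_order_frame_def)
  \<comment> \<open>The scale factor between the two lifts is written as a product so that its
    smoothness can be read off; the projective equality gives it only pointwise.\<close>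
  define k where "k t = - lor n (col n (d t) 0) (col n (e t) (n+1))" for t
  have k: "col n (d t) 0 = sc (k t) (col n (e t) 0)" if "t \<in> I" for t
  proof -
    have "proj (col n (d t) 0) = proj (col n (e t) 0)" using fe fd that by (simp add: frame_def)
    then have "col n (d t) 0 \<in> proj (col n (e t) 0)" using proj_self by metis
    then obtain c where "col n (d t) 0 = sc c (col n (e t) 0)" by (auto simp: proj_def)
    then show ?thesis using lor_frameD(2)[OF frame_lor_frame[OF fe that]] by (simp add: k_def lor_simps)
  qed
  have v1: "has_vderiv_on I (\<lambda>_. 1) (\<lambda>t. col n (d t) 0) (\<lambda>t. sc (1 / 1) (dcol n d t 0))"
    by (rule frame_vderiv[OF fd]) auto
  have v2: "has_vderiv_on I (\<lambda>_. 1) (\<lambda>t. col n (e t) 0) (\<lambda>t. sc (1 / 1) (dcol n e t 0))"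
    by (rule frame_vderiv[OF fe]) auto
  have "Cinf_on I k"
    unfolding k_def by (intro Cinf_on_minus Cinf_on_lor assms(1) frame_vsmooth[OF fe] frame_vsmooth[OF fd]) auto
  then have v3: "has_sderiv_on I (\<lambda>_. 1) k (\<lambda>t. deriv k t / 1)"
    by (rule sderiv_exists) simp
  have eq: "sc (1 / 1) (dcol n d t 0) = sc (deriv k t / 1) (col n (e t) 0) + sc (k t) (sc (1 / 1) (dcol n e t 0))"
    by (rule vderiv_unique[OF assms(1) v1 vderiv_sc[OF v3 v2] k t]) auto
  note Fe = frame_lor_frame[OF fe t] and Fd = frame_lor_frame[OF fd t]
  have n1: "1 \<in> {1..n}" using assms(2) by simp
  have e0: "dcol n e t 0 = sc (- lor n (dcol n e t 0) (col n (e t) (n+1))) (col n (e t) 0)"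
  proof (rule lor_frame_eqI[OF Fe isvec_dcol isvec_closed(3)[OF isvec_col]])
    fix a assume "a \<le> n + 1"
    then consider "a = 0" | "a = n + 1" | "a = 1" "a \<in> {1..n}" | "a \<in> {2..n}" "a \<in> {1..n}" by fastforce
    then show "lor n (dcol n e t 0) (col n (e t) a) =
        lor n (sc (- lor n (dcol n e t 0) (col n (e t) (n+1))) (col n (e t) 0)) (col n (e t) a)"
    proof cases
      case 1
      have z: "lor n (sc (1 / 1) (dcol n e t 0)) (col n (e t) 0) + lor n (col n (e t) 0) (sc (1 / 1) (dcol n e t 0)) = 0"
        by (rule lor_const_deriv[OF assms(1) v2 v2 lor_frameD(1)[OF frame_lor_frame[OF fe]] t]) auto
      then show ?thesis using 1 lor_frameD(1)[OF Fe]
        by (simp add: lor_simps lor_commute[of n "col n (e t) 0" "dcol n e t 0"])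
    next
      case 4
      then show ?thesis
        using phi_eq_lor(3)[where e = e and t = t and b = 0 and i = a, OF Fe] lor_frameD(5)[OF Fe, of a] e t
        by (simp add: second_order_frame_def lor_simps)
    qed (use phi_eq_lor(3)[where e = e and t = t and b = 0 and i = 1, OF Fe] lor_frameD[OF Fe] 0 in
        \<open>simp_all add: lor_simps\<close>)
  qed
  have "dcol n d t 0 = sc (deriv k t - k t * lor n (dcol n e t 0) (col n (e t) (n+1))) (col n (e t) 0)"
  proof -
    have "dcol n d t 0 = sc (deriv k t) (col n (e t) 0) + sc (k t) (dcol n e t 0)"
      using eq by (simp add: sc_def)
    then show ?thesis
      by (subst (asm) e0) (auto simp: sc_def algebra_simps fun_eq_iff)
  qed
  moreover have "lor n (col n (e t) 0) (col n (d t) 1) = 0"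
  proof -
    have "k t * lor n (col n (e t) 0) (col n (d t) 1) = 0"
      using lor_frameD(5)[OF Fd n1] by (simp add: k[OF t] lor_simps)
    moreover have "k t \<noteq> 0"
    proof
      assume "k t = 0"
      then have "col n (d t) 0 = 0" using k[OF t] by (auto simp: sc_def)
      then show False using lor_frameD(2)[OF Fd] by (simp add: lor_simps)
    qed
    ultimately show ?thesis by simp
  qed
  ultimately have "phi n d t 1 0 = 0"
    using phi_eq_lor(3)[where e = d and t = t and b = 0 and i = 1, OF Fd] n1 by (simp add: lor_simps)
  then show False using d t by blast
qed

locale special_frame =
  fixes n :: nat and I :: "real set" and f :: "real \<Rightarrow> (nat \<Rightarrow> real) set" and e :: "real \<Rightarrow> nat \<Rightarrow> nat \<Rightarrow> real"
  assumes n3: "3 \<le> n" and opI: "open I" and og: "one_generic n I f"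
    and st: "special_third_order_frame n I f e"
begin

text \<open>\<open>C b\<close> is the leg \<open>e_b\<close>, \<open>C' b\<close> its derivative with respect to the arclength parameter \<open>s\<close>
  (\<open>ds = \<sigma> dt\<close>, where \<open>\<sigma>\<close> may be negative), \<open>\<mu>\<close> is \<open>\<mu>_1\<close> and \<open>N\<close> is \<open>\<nabla>X/ds\<close>.\<close>

definition "\<sigma> = dsc n e"
definition "C b t = col n (e t) b"
definition "C' b t = sc (1 / \<sigma> t) (dcol n e t b)"
definition "\<mu> t = - lor n (C' 1 t) (C (n+1) t)"
definition "X t = Xvec n e t"
definition "N t = nablaX_ds n e t"

lemma second_order_e: "second_order_frame n I f e" and frame_e: "frame n I f e"
  using st by (auto simp: special_third_order_frame_def second_order_frame_def)

lemma lor_frame_C: "t \<in> I \<Longrightarrow> lor_frame n (\<lambda>b. C b t)"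
  using frame_lor_frame[OF frame_e] by (simp add: C_def)

lemma phi_1_0: "t \<in> I \<Longrightarrow> phi n e t 1 0 = \<sigma> t"
  using st by (simp add: special_third_order_frame_def \<sigma>_def)

lemma \<sigma>0: "t \<in> I \<Longrightarrow> \<sigma> t \<noteq> 0"
  using one_generic_phi10[OF opI _ og second_order_e] phi_1_0 n3 by fastforce

lemma smooth_C: "b \<le> n + 1 \<Longrightarrow> vsmooth_on I (C b)"
  using frame_vsmooth[OF frame_e] by (simp add: C_def[abs_def])

lemma deriv_C: "b \<le> n + 1 \<Longrightarrow> has_vderiv_on I \<sigma> (C b) (C' b)"
  using frame_vderiv[OF frame_e _ \<sigma>0] by (simp add: C_def[abs_def] C'_def[abs_def])

lemma isvec_C: "isvec n (C b t)"
  by (simp add: C_def isvec_col)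

lemma isvec_C': "isvec n (C' b t)"
  unfolding C'_def by (intro isvec_closed isvec_dcol)

lemma phi_C':
  assumes "t \<in> I" "b \<le> n + 1"
  shows "phi n e t 0 b = - \<sigma> t * lor n (C' b t) (C (n+1) t)"
    "phi n e t (n+1) b = - \<sigma> t * lor n (C' b t) (C 0 t)"
    "i \<in> {1..n} \<Longrightarrow> phi n e t i b = \<sigma> t * lor n (C' b t) (C i t)"
  using phi_eq_lor[where e = e and t = t and b = b, OF frame_lor_frame[OF frame_e assms(1)] assms(2)] \<sigma>0[OF assms(1)]
  by (simp_all add: C'_def C_def lor_simps)

text \<open>\<open>dsc\<close> contains a fourth root. Its smoothness comes instead from the
  normalisation \<open>phi^1_0 = ds\<close>, which makes it the product of the derivative of
  \<open>e_0\<close> with \<open>e_1\<close>.\<close>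

lemma Cinf_\<sigma>: "Cinf_on I \<sigma>"
proof -
  have sd: "vsmooth_on I (\<lambda>t. dcol n e t 0)"
    unfolding vsmooth_on_def
  proof
    fix A show "Cinf_on I (\<lambda>t. dcol n e t 0 A)"
      by (cases "A \<le> n + 1") (use frame_e in \<open>auto simp: dcol_def frame_def Cinf_on_const intro: Cinf_on_deriv\<close>)
  qed
  show ?thesis
  proof (rule Cinf_on_cong[OF opI])
    show "Cinf_on I (\<lambda>t. lor n (dcol n e t 0) (C 1 t))"
      by (intro Cinf_on_lor opI sd smooth_C) simp
    show "lor n (dcol n e t 0) (C 1 t) = \<sigma> t" if "t \<in> I" for t
      using phi_1_0[OF that] phi_eq_lor(3)[where e = e and t = t and b = 0 and i = 1, OF frame_lor_frame[OF frame_e that]] n3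
      by (simp add: C_def)
  qed
qed

lemma smooth_C': "b \<le> n + 1 \<Longrightarrow> vsmooth_on I (C' b)"
proof -
  assume b: "b \<le> n + 1"
  have "vdiv_deriv \<sigma> (C b) t = C' b t" if "t \<in> I" for t
    by (rule vderiv_unique[OF opI vderiv_exists[OF smooth_C[OF b] \<sigma>0] deriv_C[OF b] _ that \<sigma>0[OF that]]) auto
  then show ?thesis
    using vsmooth_cong[OF opI _ vsmooth_vdiv_deriv[OF opI smooth_C[OF b] Cinf_\<sigma> \<sigma>0]] by blast
qed

lemma Cinf_\<mu>: "Cinf_on I \<mu>"
  unfolding \<mu>_def[abs_def] using n3 by (intro Cinf_on_minus Cinf_on_lor opI smooth_C smooth_C') auto

lemma index_cases:
  assumes "a \<le> n + 1"
  obtains "a = 0" | "a = n + 1" | "a = 1" | "a = 2" | "a \<in> {3..n}"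
  using assms by fastforce

lemma index_range: "1 \<in> {1..n}" "2 \<in> {1..n}" "b \<in> {3..n} \<Longrightarrow> b \<in> {1..n}" "b \<in> {3..n} \<Longrightarrow> b \<le> n + 1"
    "b \<in> {1..n} \<Longrightarrow> b \<le> n + 1" "0 \<le> n + 1" "n + 1 \<le> n + 1" "1 \<le> n + 1" "2 \<le> n + 1"
  using n3 by auto

lemmas lor_C = lor_frameD[OF lor_frame_C]

lemma lor_C_table:
  assumes "t \<in> I"
  shows "lor n (C 1 t) (C 1 t) = 1" "lor n (C 2 t) (C 2 t) = 1" "lor n (C 1 t) (C 2 t) = 0" "lor n (C 2 t) (C 1 t) = 0"
    "b \<in> {3..n} \<Longrightarrow> lor n (C b t) (C 1 t) = 0" "b \<in> {3..n} \<Longrightarrow> lor n (C b t) (C 2 t) = 0"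
    "b \<in> {3..n} \<Longrightarrow> lor n (C 1 t) (C b t) = 0" "b \<in> {3..n} \<Longrightarrow> lor n (C 2 t) (C b t) = 0"
    "b \<in> {3..n} \<Longrightarrow> c \<in> {3..n} \<Longrightarrow> lor n (C b t) (C c t) = (if b = c then 1 else 0)"
    "lor n (C 0 t) (C 1 t) = 0" "lor n (C 0 t) (C 2 t) = 0" "lor n (C 1 t) (C 0 t) = 0" "lor n (C 2 t) (C 0 t) = 0"
    "lor n (C (n+1) t) (C 1 t) = 0" "lor n (C (n+1) t) (C 2 t) = 0" "lor n (C 1 t) (C (n+1) t) = 0" "lor n (C 2 t) (C (n+1) t) = 0"
    "b \<in> {3..n} \<Longrightarrow> lor n (C b t) (C 0 t) = 0" "b \<in> {3..n} \<Longrightarrow> lor n (C 0 t) (C b t) = 0"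
    "b \<in> {3..n} \<Longrightarrow> lor n (C b t) (C (n+1) t) = 0" "b \<in> {3..n} \<Longrightarrow> lor n (C (n+1) t) (C b t) = 0"
    "lor n (C 0 t) (C 0 t) = 0" "lor n (C 0 t) (C (n+1) t) = -1" "lor n (C (n+1) t) (C 0 t) = -1"
    "lor n (C (n+1) t) (C (n+1) t) = 0"
  using lor_C[OF assms] n3 by (simp_all add: lor_C(9)[OF assms])

lemma lor_C_antisym:
  assumes "t \<in> I" "a \<le> n + 1" "b \<le> n + 1"
  shows "lor n (C' a t) (C b t) = - lor n (C' b t) (C a t)"
proof -
  have "lor n (C' a t) (C b t) + lor n (C a t) (C' b t) = 0"
    by (rule lor_const_deriv[OF opI deriv_C[OF assms(2)] deriv_C[OF assms(3)] _ assms(1) \<sigma>0[OF assms(1)]])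
      (use lor_frame_C assms(2,3) in \<open>simp add: lor_frame_def\<close>)
  then show ?thesis by (simp add: lor_commute[of n "C a t"])
qed

lemma lor_C_prime:
  assumes t: "t \<in> I"
  shows "lor n (C' 0 t) (C 1 t) = 1" "\<And>\<alpha>. \<alpha> \<in> {2..n} \<Longrightarrow> lor n (C' 0 t) (C \<alpha> t) = 0"
    "lor n (C' 0 t) (C (n+1) t) = 0" "\<And>\<alpha>. \<alpha> \<in> {2..n} \<Longrightarrow> lor n (C' 1 t) (C \<alpha> t) = 0"
    "lor n (C' 2 t) (C (n+1) t) = -1" "\<And>b. b \<in> {3..n} \<Longrightarrow> lor n (C' b t) (C (n+1) t) = 0"
    "a \<le> n + 1 \<Longrightarrow> lor n (C' a t) (C a t) = 0"
proof -
  note s = \<sigma>0[OF t]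
  have P: "phi n e t 0 0 = 0" "phi n e t 0 2 = \<sigma> t" "\<And>b. b \<in> {3..n} \<Longrightarrow> phi n e t 0 b = 0"
    "\<And>\<alpha>. \<alpha> \<in> {2..n} \<Longrightarrow> phi n e t \<alpha> 0 = 0" "\<And>\<alpha>. \<alpha> \<in> {2..n} \<Longrightarrow> phi n e t \<alpha> 1 = 0"
    using st second_order_e t by (auto simp: special_third_order_frame_def second_order_frame_def \<sigma>_def)
  show "lor n (C' 0 t) (C 1 t) = 1"
    using phi_C'(3)[OF t, of 0 1] phi_1_0[OF t] s n3 by simp
  show "lor n (C' 0 t) (C \<alpha> t) = 0" if "\<alpha> \<in> {2..n}" for \<alpha>
    using phi_C'(3)[OF t, of 0 \<alpha>] P(4)[OF that] s that by simp
  show "lor n (C' 0 t) (C (n+1) t) = 0"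
    using phi_C'(1)[OF t, of 0] P(1) s by simp
  show "lor n (C' 1 t) (C \<alpha> t) = 0" if "\<alpha> \<in> {2..n}" for \<alpha>
    using phi_C'(3)[OF t, of 1 \<alpha>] P(5)[OF that] s that by simp
  show "lor n (C' 2 t) (C (n+1) t) = -1"
  proof -
    have "\<sigma> t * (lor n (C' 2 t) (C (n+1) t) + 1) = 0"
      using phi_C'(1)[OF t, of 2] P(2) n3 by (simp add: algebra_simps)
    then show ?thesis using s by (simp add: eq_neg_iff_add_eq_0)
  qed
  show "lor n (C' b t) (C (n+1) t) = 0" if "b \<in> {3..n}" for b
    using phi_C'(1)[OF t, of b] P(3)[OF that] s that by simp
  show "lor n (C' a t) (C a t) = 0" if "a \<le> n + 1" using lor_C_antisym[OF t that that] by simp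
qed

lemma qcoef_eq: "t \<in> I \<Longrightarrow> b \<in> {3..n} \<Longrightarrow> qcoef n e b t = lor n (C' 2 t) (C b t)"
  using phi_C'(3)[of t 2 b] \<sigma>0[of t] n3 by (simp add: qcoef_def \<sigma>_def)

lemma sum_delta_lor:
  assumes t: "t \<in> I" and b: "b \<in> {3..n}"
  shows "(\<Sum>c\<in>{3..n}. k c * lor n (C c t) (C b t)) = k b"
proof -
  have "(\<Sum>c\<in>{3..n}. k c * lor n (C c t) (C b t)) = (\<Sum>c\<in>{3..n}. if c = b then k c else 0)"
    by (rule sum.cong) (use b in \<open>auto simp: lor_C_table(9)[OF t]\<close>)
  then show ?thesis using b by simp
qed

lemma lor_X:
  assumes t: "t \<in> I"
  shows "lor n (X t) (C 0 t) = 0" "lor n (X t) (C 1 t) = 0" "lor n (X t) (C 2 t) = 0" "lor n (X t) (C (n+1) t) = 0"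
    "b \<in> {3..n} \<Longrightarrow> lor n (X t) (C b t) = lor n (C' 2 t) (C b t)"
proof -
  have "X t = (\<Sum>b\<in>{3..n}. sc (qcoef n e b t) (C b t))" by (simp add: X_def Xvec_def C_def)
  then have L: "lor n (X t) w = (\<Sum>b\<in>{3..n}. qcoef n e b t * lor n (C b t) w)" for w by (simp add: lor_simps)
  show "lor n (X t) (C 0 t) = 0" "lor n (X t) (C 1 t) = 0" "lor n (X t) (C 2 t) = 0" "lor n (X t) (C (n+1) t) = 0"
    unfolding L by (intro sum.neutral ballI, simp only: lor_C_table[OF t] mult_zero_right)+
  show "lor n (X t) (C b t) = lor n (C' 2 t) (C b t)" if "b \<in> {3..n}"
    unfolding L using sum_delta_lor[OF t that] qcoef_eq[OF t that] by simp
qed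

lemma isvec_X: "isvec n (X t)" and isvec_N: "isvec n (N t)"
  unfolding X_def Xvec_def N_def nablaX_ds_def by (intro isvec_sum isvec_closed isvec_col)+

lemma lor_N:
  assumes t: "t \<in> I"
  shows "lor n (N t) (C 0 t) = 0" "lor n (N t) (C 1 t) = 0" "lor n (N t) (C 2 t) = 0" "lor n (N t) (C (n+1) t) = 0"
    "c \<in> {3..n} \<Longrightarrow> lor n (N t) (C c t) =
       (deriv (qcoef n e c) t + (\<Sum>b\<in>{3..n}. qcoef n e b t * phi n e t c b)) / \<sigma> t"
proof -
  define k where "k c = (deriv (qcoef n e c) t + (\<Sum>b\<in>{3..n}. qcoef n e b t * phi n e t c b)) / \<sigma> t" for c
  have "N t = (\<Sum>c\<in>{3..n}. sc (k c) (C c t))" by (simp add: N_def nablaX_ds_def C_def k_def \<sigma>_def)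
  then have L: "lor n (N t) w = (\<Sum>c\<in>{3..n}. k c * lor n (C c t) w)" for w by (simp add: lor_simps)
  show "lor n (N t) (C 0 t) = 0" "lor n (N t) (C 1 t) = 0" "lor n (N t) (C 2 t) = 0" "lor n (N t) (C (n+1) t) = 0"
    unfolding L by (intro sum.neutral ballI, simp only: lor_C_table[OF t] mult_zero_right)+
  show "lor n (N t) (C c t) =
       (deriv (qcoef n e c) t + (\<Sum>b\<in>{3..n}. qcoef n e b t * phi n e t c b)) / \<sigma> t" if "c \<in> {3..n}"
    unfolding L sum_delta_lor[OF t that] k_def by (rule refl)
qed

lemma smooth_X: "vsmooth_on I X"
proof (rule vsmooth_cong[OF opI])
  show "vsmooth_on I (\<lambda>t. \<Sum>b\<in>{3..n}. sc (lor n (C' 2 t) (C b t)) (C b t))"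
    by (intro vsmooth_sum vsmooth_sc Cinf_on_lor opI smooth_C smooth_C' index_range) 
  show "(\<Sum>b\<in>{3..n}. sc (lor n (C' 2 t) (C b t)) (C b t)) = X t" if "t \<in> I" for t
    unfolding X_def Xvec_def using qcoef_eq[OF that] by (simp add: C_def)
qed

text \<open>The normalisations fix all products of a derivative of \<open>e_0\<close>,
  \<open>e_1\<close>, \<open>e_2\<close> or \<open>e_(n+1)\<close> with a leg, up to skew-symmetry,
  except those named by \<open>\<mu>\<close> and \<open>q^b\<close>. Each equation then holds
  because both sides have the same products with every leg.\<close>

lemma structure_equations:
  assumes t: "t \<in> I"
  shows "C' 0 t = C 1 t" "C' 1 t = sc (\<mu> t) (C 0 t) + C (n+1) t" "C' 2 t = C 0 t + X t"
    "C' (n+1) t = sc (\<mu> t) (C 1 t) + C 2 t"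
proof -
  have b2: "b \<in> {3..n} \<Longrightarrow> b \<in> {2..n}" "2 \<in> {2..n}" for b using n3 by auto
  show "C' 0 t = C 1 t"
  proof (rule lor_frame_eqI[OF lor_frame_C[OF t] isvec_C' isvec_C])
    show "lor n (C' 0 t) (C a t) = lor n (C 1 t) (C a t)" if "a \<le> n + 1" for a
      using that by (cases a rule: index_cases) (simp_all only: lor_C_prime[OF t] lor_C_table[OF t] index_range b2)
  qed
  show "C' 1 t = sc (\<mu> t) (C 0 t) + C (n+1) t"
  proof (rule lor_frame_eqI[OF lor_frame_C[OF t] isvec_C'])
    show "lor n (C' 1 t) (C a t) = lor n (sc (\<mu> t) (C 0 t) + C (n+1) t) (C a t)" if "a \<le> n + 1" for a
      using that lor_C_antisym[OF t, of 1 0] lor_C_prime(4)[OF t b2(2)]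
      by (cases a rule: index_cases) (simp_all add: lor_C_prime[OF t] lor_C_table[OF t] index_range b2 lor_simps \<mu>_def)
  qed (intro isvec_closed isvec_C)
  show "C' 2 t = C 0 t + X t"
  proof (rule lor_frame_eqI[OF lor_frame_C[OF t] isvec_C'])
    show "lor n (C' 2 t) (C a t) = lor n (C 0 t + X t) (C a t)" if "a \<le> n + 1" for a
      using that lor_C_antisym[OF t index_range(9,8)] lor_C_antisym[OF t index_range(9,6)] lor_C_prime(4)[OF t b2(2)] lor_C_prime(2)[OF t b2(2)]
      by (cases a rule: index_cases) (simp_all add: lor_C_prime(5)[OF t] lor_C_prime(7)[OF t index_range(9)] lor_C_table[OF t] lor_simps lor_X[OF t])
  qed (intro isvec_closed isvec_C isvec_X)
  show "C' (n+1) t = sc (\<mu> t) (C 1 t) + C 2 t"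
  proof (rule lor_frame_eqI[OF lor_frame_C[OF t] isvec_C'])
    show "lor n (C' (n+1) t) (C a t) = lor n (sc (\<mu> t) (C 1 t) + C 2 t) (C a t)" if "a \<le> n + 1" for a
      using that
    proof (cases a rule: index_cases)
      case 5
      then show ?thesis
        using lor_C_antisym[OF t index_range(7) that] lor_C_prime(6)[OF t 5] by (simp add: lor_C_table[OF t] lor_simps)
    qed (use lor_C_antisym[OF t index_range(7,6)] lor_C_antisym[OF t index_range(7,8)] lor_C_antisym[OF t index_range(7,9)] lor_C_prime(3,5,7)[OF t] in
        \<open>simp_all add: lor_C_table[OF t] lor_simps \<mu>_def\<close>)
  qed (intro isvec_closed isvec_C)
qed

lemma deriv_C0: "has_vderiv_on I \<sigma> (C 0) (C 1)"
  and deriv_C1: "has_vderiv_on I \<sigma> (C 1) (\<lambda>t. sc (\<mu> t) (C 0 t) + C (n+1) t)"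
  and deriv_C2: "has_vderiv_on I \<sigma> (C 2) (\<lambda>t. C 0 t + X t)"
  and deriv_C_last: "has_vderiv_on I \<sigma> (C (n+1)) (\<lambda>t. sc (\<mu> t) (C 1 t) + C 2 t)"
     apply (rule vderiv_cong[OF opI deriv_C[OF index_range(6)] refl], rule structure_equations, assumption)
    apply (rule vderiv_cong[OF opI deriv_C[OF index_range(8)] refl], rule structure_equations, assumption)
   apply (rule vderiv_cong[OF opI deriv_C[OF index_range(9)] refl], rule structure_equations, assumption)
  apply (rule vderiv_cong[OF opI deriv_C[OF index_range(7)] refl], rule structure_equations, assumption)
  done

text \<open>The components along \<open>e_c\<close>, \<open>c \<ge> 3\<close>, are the covariant
  derivative by definition of the connection. For the other legs \<open>X\<close> is orthogonal to
  \<open>C a\<close>, so the component is minus the product of \<open>X\<close> with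
  \<open>C' a\<close>; by the structure equations only \<open>a = 2\<close> contributes, through
  \<open>D e_2 = e_0 + X\<close>.\<close>

lemma deriv_X: "has_vderiv_on I \<sigma> X (\<lambda>t. N t - sc (lor n (X t) (X t)) (C 2 t))"
proof (rule vderiv_cong[OF opI vderiv_exists[OF smooth_X \<sigma>0] refl])
  let ?X' = "vdiv_deriv \<sigma> X"
  have d: "has_vderiv_on I \<sigma> X ?X'" by (rule vderiv_exists[OF smooth_X \<sigma>0])
  fix t assume t: "t \<in> I"
  have z: "lor n (?X' t) (C a t) = - lor n (X t) (C' a t)"
    if "a \<le> n + 1" "\<And>t. t \<in> I \<Longrightarrow> lor n (X t) (C a t) = 0" for a
    using lor_const_deriv[OF opI d deriv_C[OF that(1)] that(2) t \<sigma>0[OF t]] by simp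
  show "?X' t = N t - sc (lor n (X t) (X t)) (C 2 t)"
  proof (rule lor_frame_eqI[OF lor_frame_C[OF t]])
    show "isvec n (?X' t)" by (rule isvec_vderiv[OF opI d isvec_X t \<sigma>0[OF t]])
    show "isvec n (N t - sc (lor n (X t) (X t)) (C 2 t))" by (intro isvec_closed isvec_N isvec_C)
    show "lor n (?X' t) (C a t) = lor n (N t - sc (lor n (X t) (X t)) (C 2 t)) (C a t)" if "a \<le> n + 1" for a
      using that
    proof (cases a rule: index_cases)
      case 5
      have q: "has_sderiv_on I \<sigma> (qcoef n e a) (\<lambda>t. lor n (?X' t) (C a t) + lor n (X t) (C' a t))"
        by (rule sderiv_cong[OF opI sderiv_lor[OF d deriv_C[OF that]] _ refl])
          (use 5 in \<open>simp add: lor_X qcoef_eq\<close>)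
      have "(qcoef n e a has_real_derivative \<sigma> t * (lor n (?X' t) (C a t) + lor n (X t) (C' a t))) (at t)"
        using q t by (simp add: has_sderiv_on_def)
      then have dq: "deriv (qcoef n e a) t = \<sigma> t * (lor n (?X' t) (C a t) + lor n (X t) (C' a t))"
        by (rule DERIV_imp_deriv)
      have "lor n (X t) (C' a t) = (\<Sum>b\<in>{3..n}. qcoef n e b t * lor n (C b t) (C' a t))"
        unfolding X_def Xvec_def by (simp add: lor_simps C_def)
      \<comment> \<open>Skew-symmetry: the product of \<open>C b\<close> with \<open>C' a\<close> is
        \<open>- phi^a_b / \<sigma>\<close>, which accounts for the connection term in
        \<open>N\<close>.\<close>
      also have "\<dots> = - (\<Sum>b\<in>{3..n}. qcoef n e b t * phi n e t a b) / \<sigma> t"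
        unfolding sum_negf[symmetric] sum_divide_distrib
      proof (rule sum.cong[OF refl])
        fix b assume b: "b \<in> {3..n}"
        show "qcoef n e b t * lor n (C b t) (C' a t) = - (qcoef n e b t * phi n e t a b) / \<sigma> t"
          using phi_C'(3)[OF t index_range(4)[OF b] index_range(3)[OF 5]] lor_C_antisym[OF t index_range(4)[OF b] that] \<sigma>0[OF t]
          by (simp add: lor_commute[of n "C b t"])
      qed
      finally have s: "(\<Sum>b\<in>{3..n}. qcoef n e b t * phi n e t a b) = - \<sigma> t * lor n (X t) (C' a t)"
        using \<sigma>0[OF t] by (simp add: field_simps)
      have "lor n (N t) (C a t) = lor n (?X' t) (C a t)"
        unfolding lor_N(5)[OF t 5] dq s using \<sigma>0[OF t] by (simp add: field_simps)
      then show ?thesis using 5 by (simp add: lor_simps lor_C_table[OF t])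
    qed (use n3 t in \<open>simp_all add: z structure_equations lor_X lor_N lor_simps lor_C_table\<close>)
  qed
qed

text \<open>Reading \<open>deriv_X\<close> backwards expresses \<open>N\<close> through
  \<open>D X\<close>, \<open>X\<close> and \<open>e_2\<close>, so the coefficients
  \<open>qcoef\<close> and \<open>phi\<close> need not be differentiated.\<close>

lemma smooth_N: "vsmooth_on I N"
proof (rule vsmooth_cong[OF opI])
  let ?X' = "vdiv_deriv \<sigma> X"
  show "vsmooth_on I (\<lambda>t. ?X' t + sc (lor n (X t) (X t)) (C 2 t))"
    using n3 by (intro vsmooth_add vsmooth_sc vsmooth_vdiv_deriv Cinf_on_lor smooth_X opI Cinf_\<sigma> smooth_C) (use \<sigma>0 in auto)
  fix t assume t: "t \<in> I"
  have "?X' t = N t - sc (lor n (X t) (X t)) (C 2 t)"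
    by (rule vderiv_unique[OF opI vderiv_exists[OF smooth_X \<sigma>0] deriv_X refl t \<sigma>0[OF t]])
  then show "?X' t + sc (lor n (X t) (X t)) (C 2 t) = N t" by simp
qed

end

section \<open>Deformations of frames and lifts\<close>

text \<open>\<open>G 0\<close> has a positive minimum on the compact \<open>K\<close>, and uniform
  continuity keeps \<open>G \<epsilon>\<close> within that minimum of \<open>G 0\<close> for one
  \<open>d\<close> valid on all of \<open>K\<close>.\<close>

lemma tube_pos:
  fixes G :: "real \<Rightarrow> real \<Rightarrow> real"
  assumes "compact K" "0 < c" "continuous_on ({-c..c} \<times> K) (\<lambda>z. G (fst z) (snd z))"
    and pos: "\<And>t. t \<in> K \<Longrightarrow> 0 < G 0 t"
  shows "\<exists>d. 0 < d \<and> d \<le> c \<and> (\<forall>\<epsilon> t. \<bar>\<epsilon>\<bar> \<le> d \<longrightarrow> t \<in> K \<longrightarrow> 0 < G \<epsilon> t)"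
proof (cases "K = {}")
  case True
  then show ?thesis using assms(2) by auto
next
  case False
  have "continuous_on K (\<lambda>t. G 0 t)"
  proof -
    have "continuous_on K (\<lambda>t. (0::real, t))" by (intro continuous_intros)
    moreover have "(\<lambda>t. (0, t)) ` K \<subseteq> {-c..c} \<times> K" using assms(2) by auto
    ultimately have "continuous_on K (\<lambda>t. G (fst (0::real, t)) (snd (0::real, t)))"
      by (rule continuous_on_compose2[OF assms(3)])
    then show ?thesis by simp
  qed
  then obtain t0 where t0: "t0 \<in> K" "\<And>t. t \<in> K \<Longrightarrow> G 0 t0 \<le> G 0 t"
    using continuous_attains_inf[OF assms(1) False] by blast
  have "uniformly_continuous_on ({-c..c} \<times> K) (\<lambda>z. G (fst z) (snd z))"
    using assms(1,3) by (intro compact_uniformly_continuous compact_Times compact_Icc)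
  then obtain \<delta> where \<delta>: "0 < \<delta>" "\<And>x y. x \<in> {-c..c} \<times> K \<Longrightarrow> y \<in> {-c..c} \<times> K \<Longrightarrow> dist y x < \<delta> \<Longrightarrow>
      dist (G (fst y) (snd y)) (G (fst x) (snd x)) < G 0 t0"
    using pos[OF t0(1)] unfolding uniformly_continuous_on_def by meson
  define d where "d = min c (\<delta> / 2)"
  have "0 < G \<epsilon> t" if "\<bar>\<epsilon>\<bar> \<le> d" "t \<in> K" for \<epsilon> t
  proof -
    have "dist (G (fst (\<epsilon>, t)) (snd (\<epsilon>, t))) (G (fst (0::real, t)) (snd (0::real, t))) < G 0 t0"
      by (rule \<delta>(2)) (use that \<delta>(1) assms(2) in \<open>auto simp: d_def dist_Pair_Pair\<close>)
    then show ?thesis using t0(2)[OF that(2)] by (simp add: dist_real_def abs_if split: if_splits)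
  qed
  then show ?thesis
    using \<delta>(1) assms(2) by (intro exI[of _ d]) (auto simp: d_def)
qed

section \<open>Paths in the isometry group\<close>

lemma lor_isometry_cong:
  assumes "\<And>A b. A \<le> n + 1 \<Longrightarrow> b \<le> n + 1 \<Longrightarrow> M A b = M' A b"
  shows "lor_isometry n M \<longleftrightarrow> lor_isometry n M'"
proof -
  have "mv n M v = mv n M' v" for v
    using assms by (auto simp: mv_def fun_eq_iff intro!: sum.cong)
  then show ?thesis by (simp add: lor_isometry_def)
qed

text \<open>Path components are closed under paths: an isometry joined to an element of
  \<open>mob\<close> is joined to the identity by concatenation.\<close>

lemma mob_path:
  assumes "mob n M0" and cont: "\<And>A b. A \<le> n + 1 \<Longrightarrow> b \<le> n + 1 \<Longrightarrow> continuous_on {0..1} (\<lambda>s. \<gamma> s A b)"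
    and iso: "\<And>s. s \<in> {0..1} \<Longrightarrow> lor_isometry n (\<gamma> s)"
    and start: "\<And>A b. A \<le> n + 1 \<Longrightarrow> b \<le> n + 1 \<Longrightarrow> \<gamma> (0::real) A b = M0 A b"
  shows "mob n (\<gamma> 1)"
proof -
  obtain \<delta> where \<delta>: "\<And>A b. continuous_on {0..1} (\<lambda>s. \<delta> s A b)" "\<And>s. s \<in> {0..1::real} \<Longrightarrow> lor_isometry n (\<delta> s)"
      "\<And>A b. A \<le> n + 1 \<Longrightarrow> b \<le> n + 1 \<Longrightarrow> \<delta> 0 A b = (if A = b then 1 else 0)"
      "\<And>A b. A \<le> n + 1 \<Longrightarrow> b \<le> n + 1 \<Longrightarrow> \<delta> 1 A b = M0 A b"
    using assms(1) unfolding mob_def by blast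
  \<comment> \<open>\<open>mob\<close> asks every entry of the path to be continuous, also those
    outside the index range, where the two halves need not fit together; these are set to 0.\<close>
  define \<zeta> where "\<zeta> s A b = (if A \<le> n + 1 \<and> b \<le> n + 1 then ((\<lambda>s. \<delta> s A b) +++ (\<lambda>s. \<gamma> s A b)) s else 0)" for s A b
  have "continuous_on {0..1} (\<lambda>s. \<zeta> s A b)" for A b
  proof (cases "A \<le> n + 1 \<and> b \<le> n + 1")
    case True
    then have "path ((\<lambda>s. \<delta> s A b) +++ (\<lambda>s. \<gamma> s A b))"
      by (intro path_join_imp) (auto simp: path_def pathfinish_def pathstart_def \<delta> cont start)
    then show ?thesis using True by (simp add: \<zeta>_def path_def cong: continuous_on_cong)
  next
    case False
    then have "\<zeta> s A b = 0" for s by (auto simp: \<zeta>_def)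
    then show ?thesis by simp
  qed
  moreover have "lor_isometry n (\<zeta> s)" if s: "s \<in> {0..1}" for s
  proof (cases "s \<le> 1/2")
    case True
    have "lor_isometry n (\<delta> (2 * s))" using True s by (intro \<delta>(2)) auto
    then show ?thesis
      using lor_isometry_cong[of n "\<zeta> s" "\<delta> (2 * s)"] True by (simp add: \<zeta>_def joinpaths_def)
  next
    case False
    have "lor_isometry n (\<gamma> (2 * s - 1))" using False s by (intro iso) auto
    then show ?thesis
      using lor_isometry_cong[of n "\<zeta> s" "\<gamma> (2 * s - 1)"] False by (simp add: \<zeta>_def joinpaths_def)
  qed
  moreover have "\<zeta> 0 A b = (if A = b then 1 else 0) \<and> \<zeta> 1 A b = \<gamma> 1 A b" if "A \<le> n + 1" "b \<le> n + 1" for A b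
    using that \<delta>(3) by (simp add: \<zeta>_def joinpaths_def)
  ultimately show ?thesis
    unfolding mob_def using iso[of 1] by (intro conjI exI[of _ \<zeta>]) auto
qed

lemma continuous_on_lor:
  assumes "\<And>A. continuous_on S (\<lambda>x. v x A)" "\<And>A. continuous_on S (\<lambda>x. w x A)"
  shows "continuous_on S (\<lambda>x. lor n (v x) (w x))"
  unfolding lor_def by (intro continuous_intros assms)

lemma continuous_on_lift_frame:
  assumes c: "\<And>A. continuous_on S (\<lambda>s. g0 s A)" "\<And>A. continuous_on S (\<lambda>s. g1 s A)" "\<And>A. continuous_on S (\<lambda>s. g2 s A)"
    "\<And>i A. continuous_on S (\<lambda>s. hat s i A)"
    and R: "\<And>s. s \<in> S \<Longrightarrow> 0 < lor n (g1 s) (g1 s)" and pos: "\<And>s. s \<in> S \<Longrightarrow> 0 < lor n (g1 s) (hat s 1)"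
  shows "continuous_on S (\<lambda>s. lift_frame n (g0 s) (g1 s) (g2 s) (hat s) b A)"
proof -
  have R': "lor n (g1 s) (g1 s) \<noteq> 0" "sqrt (lor n (g1 s) (g1 s)) \<noteq> 0" if "s \<in> S" for s
    using R[OF that] by auto
  have cu: "continuous_on S (\<lambda>s. lift_tangent n (g1 s) A)" for A
    unfolding lift_tangent_def sc_def by (intro continuous_intros continuous_on_lor c R' ballI)
  have cl: "continuous_on S (\<lambda>s. lift_conormal n (g0 s) (g1 s) (g2 s) A)" for A
    unfolding lift_conormal_def sc_def plus_fun_apply fun_diff_def
    by (intro continuous_intros continuous_on_lor c R' ballI) (auto simp: R')
  have P: "1 + lor n (lift_tangent n (g1 s)) (hat s 1) \<noteq> 0" if "s \<in> S" for s
  proof -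
    have "0 < lor n (lift_tangent n (g1 s)) (hat s 1)"
      using R[OF that] pos[OF that] by (simp add: lift_tangent_def lor_simps)
    then show ?thesis by simp
  qed
  have cr: "continuous_on S (\<lambda>s. lift_rot n (lift_tangent n (g1 s)) (hat s) b A)" for b A
    unfolding lift_rot_def sc_def plus_fun_apply fun_diff_def
    by (intro continuous_intros continuous_on_lor c cu ballI P)
  have "continuous_on S (\<lambda>s. (lift_rot n (lift_tangent n (g1 s)) (hat s) b
        + sc (lor n (lift_rot n (lift_tangent n (g1 s)) (hat s) b) (lift_conormal n (g0 s) (g1 s) (g2 s))) (g0 s)) A)"
    unfolding sc_def plus_fun_apply by (intro continuous_intros continuous_on_lor c cr cl)
  then show ?thesis
    unfolding lift_frame_def using c cl cu by (cases "b = 0"; cases "b = n + 1"; cases "b = 1") simp_all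
qed

text \<open>Polynomials in \<open>x\<close> of degree at most 2 whose coefficients are smooth in
  \<open>y\<close> are closed under both partial derivatives, so every member of
  \<open>partials\<close> again has this form.\<close>

lemma Cinf2_on_quadratic:
  assumes I: "open I" and c: "Cinf_on I c0" "Cinf_on I c1" "Cinf_on I c2"
  shows "Cinf2_on ({-d<..<d} \<times> I) (\<lambda>z. c0 (snd z) + fst z * c1 (snd z) + (fst z)\<^sup>2 * c2 (snd z))"
proof -
  define g where "g = (\<lambda>z::real \<times> real. c0 (snd z) + fst z * c1 (snd z) + (fst z)\<^sup>2 * c2 (snd z))"
  \<comment> \<open>The form is asserted only for \<open>y\<close> in the open set \<open>I\<close>;
    outside it \<open>deriv\<close> of the coefficients is uncontrolled.\<close>
  have rep: "\<exists>c0 c1 c2. Cinf_on I c0 \<and> Cinf_on I c1 \<and> Cinf_on I c2 \<and>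
      (\<forall>x. \<forall>y\<in>I. h (x, y) = c0 y + x * c1 y + x\<^sup>2 * c2 y)" if "h \<in> partials g" for h
    using that
  proof (induction rule: partials.induct)
    case base
    then show ?case using c by (intro exI[of _ c0] exI[of _ c1] exI[of _ c2]) (auto simp: g_def)
  next
    case (d1 h)
    then obtain c0 c1 c2 where h: "Cinf_on I c0" "Cinf_on I c1" "Cinf_on I c2"
      "\<And>x y. y \<in> I \<Longrightarrow> h (x, y) = c0 y + x * c1 y + x\<^sup>2 * c2 y" by blast
    have "deriv (\<lambda>x. h (x, y)) x = c1 y + x * (2 * c2 y) + x\<^sup>2 * 0" if "y \<in> I" for x y
      unfolding h(4)[OF that] by (rule DERIV_imp_deriv) (auto intro!: derivative_eq_intros)
    then show ?case
      using h(1-3) by (intro exI[of _ c1] exI[of _ "\<lambda>y. 2 * c2 y"] exI[of _ "\<lambda>_. 0"])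
        (auto intro: Cinf_on_const Cinf_on_mult I)
  next
    case (d2 h)
    then obtain c0 c1 c2 where h: "Cinf_on I c0" "Cinf_on I c1" "Cinf_on I c2"
      "\<And>x y. y \<in> I \<Longrightarrow> h (x, y) = c0 y + x * c1 y + x\<^sup>2 * c2 y" by blast
    have "deriv (\<lambda>y. h (x, y)) y = deriv c0 y + x * deriv c1 y + x\<^sup>2 * deriv c2 y" if "y \<in> I" for x y
    proof (rule DERIV_imp_deriv, rule has_real_derivative_cong_ev)
      show "((\<lambda>y. c0 y + x * c1 y + x\<^sup>2 * c2 y) has_real_derivative deriv c0 y + x * deriv c1 y + x\<^sup>2 * deriv c2 y) (at y)"
        using h(1-3) that by (intro DERIV_add DERIV_cmult Cinf_on_has_deriv)
      show "\<forall>\<^sub>F s in nhds y. c0 s + x * c1 s + x\<^sup>2 * c2 s = h (x, s)"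
        using eventually_nhds_in_open[OF I that] by eventually_elim (simp add: h(4))
    qed
    then show ?case
      using h(1-3) by (intro exI[of _ "deriv c0"] exI[of _ "deriv c1"] exI[of _ "deriv c2"])
        (auto intro: Cinf_on_deriv)
  qed
  have "h differentiable (at z)" if h: "h \<in> partials g" and z: "z \<in> {-d<..<d} \<times> I" for h z
  proof -
    obtain c0 c1 c2 where c: "Cinf_on I c0" "Cinf_on I c1" "Cinf_on I c2"
      "\<And>x y. y \<in> I \<Longrightarrow> h (x, y) = c0 y + x * c1 y + x\<^sup>2 * c2 y" using rep[OF h] by blast
    have z2: "snd z \<in> I" using z by auto
    have cd: "(\<lambda>z. k (snd z)) differentiable (at z)" if "Cinf_on I k" for k
    proof -
      have "(k has_derivative (\<lambda>x. deriv k (snd z) * x)) (at (snd z))"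
        using Cinf_on_has_deriv[OF that z2] by (simp add: has_field_derivative_def)
      then have "((\<lambda>z. k (snd z)) has_derivative (\<lambda>x. deriv k (snd z) * snd x)) (at z)"
        by (rule has_derivative_compose[OF has_derivative_snd[OF has_derivative_ident]])
      then show ?thesis by (auto simp: differentiable_def)
    qed
    have f: "(\<lambda>z::real \<times> real. fst z) differentiable (at z)"
      by (auto simp: differentiable_def intro!: has_derivative_fst has_derivative_ident)
    have D: "(\<lambda>z. c0 (snd z) + fst z * c1 (snd z) + (fst z)\<^sup>2 * c2 (snd z)) differentiable (at z)"
      by (intro differentiable_add differentiable_mult differentiable_power cd f c)
    have op: "open (UNIV \<times> I :: (real \<times> real) set)" by (intro open_Times open_UNIV I)
    obtain D' where "((\<lambda>z. c0 (snd z) + fst z * c1 (snd z) + (fst z)\<^sup>2 * c2 (snd z)) has_derivative D') (at z)"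
      using D by (auto simp: differentiable_def)
    then have "(h has_derivative D') (at z)"
      by (rule has_derivative_transform_within_open[OF _ op]) (use z2 c(4) in \<open>auto simp: mem_Times_iff\<close>)
    then show ?thesis by (auto simp: differentiable_def)
  qed
  then show ?thesis unfolding Cinf2_on_def g_def by blast
qed

section \<open>Variations in the directions complementary to the osculating 4-space\<close>

context special_frame
begin

definition D :: "nat \<Rightarrow> (real \<Rightarrow> nat \<Rightarrow> real) \<Rightarrow> real \<Rightarrow> nat \<Rightarrow> real" where
  "D k v = (vdiv_deriv \<sigma> ^^ k) v"

definition "\<mu>1 t = deriv \<mu> t / \<sigma> t"
definition "\<mu>2 t = deriv \<mu>1 t / \<sigma> t"

lemma D_0: "D 0 v = v"
  by (simp add: D_def)

lemma smooth_D: "vsmooth_on I v \<Longrightarrow> vsmooth_on I (D k v)"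
  by (induction k) (simp_all add: D_def vsmooth_vdiv_deriv[OF opI _ Cinf_\<sigma> \<sigma>0])

lemma deriv_D: "vsmooth_on I v \<Longrightarrow> has_vderiv_on I \<sigma> (D k v) (D (Suc k) v)"
  using vderiv_exists[OF smooth_D[of v k] \<sigma>0] by (simp add: D_def)

lemma isvec_D:
  assumes "vsmooth_on I v" "\<And>t. t \<in> I \<Longrightarrow> isvec n (v t)" "t \<in> I"
  shows "isvec n (D k v t)"
  using assms(3)
proof (induction k arbitrary: t)
  case (Suc k)
  then show ?case by (intro isvec_vderiv[OF opI deriv_D[OF assms(1)]] \<sigma>0)
qed (simp add: D_0 assms(2))

lemma D_Suc_eq:
  assumes "vsmooth_on I v" "\<And>t. t \<in> I \<Longrightarrow> D k v t = w t" "has_vderiv_on I \<sigma> w w'" "t \<in> I"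
  shows "D (Suc k) v t = w' t"
  by (rule vderiv_unique[OF opI deriv_D[OF assms(1)] assms(3,2,4) \<sigma>0[OF assms(4)]])

text \<open>Since \<open>K\<close> is closed, \<open>I - K\<close> is open, and derivatives of a
  function vanishing on an open set vanish there.\<close>

lemma D_support:
  assumes "vsmooth_on I v" "closed K" "\<And>t. t \<in> I - K \<Longrightarrow> v t = 0" "t \<in> I - K"
  shows "D k v t = 0"
  using assms(4)
proof (induction k arbitrary: t)
  case (Suc k)
  have op: "open (I - K)" using opI assms(2) by (rule open_Diff)
  have v: "has_vderiv_on (I - K) \<sigma> (D k v) (D (Suc k) v)"
    using deriv_D[OF assms(1)] by (auto simp: has_vderiv_on_def has_sderiv_on_def)
  have z: "has_vderiv_on (I - K) \<sigma> (\<lambda>_. 0) (\<lambda>_. 0)"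
    by (simp add: has_vderiv_on_def has_sderiv_on_def)
  have "\<sigma> t \<noteq> 0" using Suc.prems \<sigma>0 by blast
  then show ?case
    using vderiv_unique[OF op v z Suc.IH Suc.prems] by simp
qed (simp add: D_0 assms(3))

lemma sderiv_\<mu>: "has_sderiv_on I \<sigma> \<mu> \<mu>1" and Cinf_\<mu>1: "Cinf_on I \<mu>1"
  unfolding \<mu>1_def[abs_def] using sderiv_exists[OF Cinf_\<mu> \<sigma>0] Cinf_on_sderiv[OF opI Cinf_\<mu> Cinf_\<sigma> \<sigma>0] by simp_all

lemma sderiv_\<mu>1: "has_sderiv_on I \<sigma> \<mu>1 \<mu>2" and Cinf_\<mu>2: "Cinf_on I \<mu>2"
  unfolding \<mu>2_def[abs_def] using sderiv_exists[OF Cinf_\<mu>1 \<sigma>0] Cinf_on_sderiv[OF opI Cinf_\<mu>1 Cinf_\<sigma> \<sigma>0] by simp_all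

lemma smooth_C0: "vsmooth_on I (C 0)"
  by (rule smooth_C) simp

lemma D1_C0: "t \<in> I \<Longrightarrow> D 1 (C 0) t = C 1 t"
  using D_Suc_eq[OF smooth_C0 _ deriv_C0, of 0] by (simp add: D_0 One_nat_def)

lemma D2_C0: "t \<in> I \<Longrightarrow> D 2 (C 0) t = sc (\<mu> t) (C 0 t) + C (n+1) t"
  using D_Suc_eq[OF smooth_C0 D1_C0 deriv_C1] by (simp add: numeral_2_eq_2 One_nat_def)

lemma deriv_D2_C0: "has_vderiv_on I \<sigma> (\<lambda>t. sc (\<mu> t) (C 0 t) + C (n+1) t)
    (\<lambda>t. C 2 t + sc (2 * \<mu> t) (C 1 t) + sc (\<mu>1 t) (C 0 t))"
  by (rule vderiv_cong[OF opI vderiv_add[OF vderiv_sc[OF sderiv_\<mu> deriv_C0] deriv_C_last] refl])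
    (simp add: fun_eq_iff sc_def)

lemma D3_C0: "t \<in> I \<Longrightarrow> D 3 (C 0) t = C 2 t + sc (2 * \<mu> t) (C 1 t) + sc (\<mu>1 t) (C 0 t)"
  using D_Suc_eq[OF smooth_C0 D2_C0 deriv_D2_C0] by (simp add: numeral_3_eq_3 numeral_2_eq_2)

end

locale frame_variation = special_frame +
  fixes b :: nat and \<eta> :: "real \<Rightarrow> real" and l r :: real
  assumes b: "b \<in> {3..n}" and sm\<eta>: "Cinf_on I \<eta>" and supp: "\<And>t. t \<notin> {l..r} \<Longrightarrow> \<eta> t = 0"
    and lrI: "{l..r} \<subseteq> I"
begin

definition "Y t = sc (\<eta> t) (C b t)"
text \<open>As \<open><e_0, e_(n+1)> = -1\<close>, the coefficient 1/2 makes the varied lift exactly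
  null for every \<open>\<epsilon>\<close>, not just to first order.\<close>

definition "Z t = sc ((\<eta> t)\<^sup>2 / 2) (C (n+1) t)"
text \<open>\<open>g k \<epsilon>\<close> is the \<open>k\<close>-th arclength derivative of the varied lift and \<open>dg k\<close> its derivative in \<open>\<epsilon>\<close>;
  \<open>hat\<close> is \<open>e_1, \<dots>, e_n\<close> translated so as to be orthogonal to \<open>g 0 \<epsilon>\<close>.\<close>

definition "g k \<epsilon> t = D k (C 0) t + sc \<epsilon> (D k Y t) + sc (\<epsilon>\<^sup>2) (D k Z t)"
definition "dg k \<epsilon> t = D k Y t + sc (2 * \<epsilon>) (D k Z t)"
definition "hat \<epsilon> t i = C i t + sc (if i = b then \<epsilon> * \<eta> t else 0) (C (n+1) t)"

lemma smooth_Y: "vsmooth_on I Y" and smooth_Z: "vsmooth_on I Z"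
  unfolding Y_def[abs_def] Z_def[abs_def] using b
  by (auto intro!: vsmooth_sc smooth_C opI sm\<eta> Cinf_on_divide Cinf_on_power Cinf_on_const)

lemma smooth_g: "vsmooth_on I (g k \<epsilon>)"
  unfolding g_def[abs_def] by (intro vsmooth_add vsmooth_sc opI Cinf_on_const smooth_D smooth_C0 smooth_Y smooth_Z)

lemma deriv_g: "has_vderiv_on I \<sigma> (g k \<epsilon>) (g (Suc k) \<epsilon>)"
proof -
  have "has_vderiv_on I \<sigma> (g k \<epsilon>) (\<lambda>t. D (Suc k) (C 0) t + (sc 0 (D k Y t) + sc \<epsilon> (D (Suc k) Y t))
      + (sc 0 (D k Z t) + sc (\<epsilon>\<^sup>2) (D (Suc k) Z t)))"
    unfolding g_def[abs_def] by (intro vderiv_add vderiv_sc sderiv_const deriv_D smooth_C0 smooth_Y smooth_Z)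
  then show ?thesis by (simp add: g_def[abs_def])
qed

lemma deriv_g_numeral: "has_vderiv_on I \<sigma> (g 0 \<epsilon>) (g 1 \<epsilon>)" "has_vderiv_on I \<sigma> (g 1 \<epsilon>) (g 2 \<epsilon>)" "has_vderiv_on I \<sigma> (g 2 \<epsilon>) (g 3 \<epsilon>)"
  using deriv_g[of 0] deriv_g[of 1] deriv_g[of 2] by (simp_all add: numeral_2_eq_2 numeral_3_eq_3 One_nat_def)

lemma isvec_g: "t \<in> I \<Longrightarrow> isvec n (g k \<epsilon> t)"
  unfolding g_def by (intro isvec_closed isvec_D smooth_C0 smooth_Y smooth_Z) (auto simp: Y_def Z_def intro: isvec_closed isvec_C)

lemma g_support:
  assumes "t \<in> I" "t \<notin> {l..r}"
  shows "g k \<epsilon> t = D k (C 0) t" "hat \<epsilon> t i = C i t"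
proof -
  have "D k Y t = 0" "D k Z t = 0"
    by (rule D_support[of _ "{l..r}"]; use assms smooth_Y smooth_Z supp in \<open>auto simp: Y_def Z_def\<close>)+
  then show "g k \<epsilon> t = D k (C 0) t" by (simp add: g_def)
  show "hat \<epsilon> t i = C i t" using supp[OF assms(2)] by (simp add: hat_def)
qed

lemma g_0: "g k 0 t = D k (C 0) t" and hat_0: "hat 0 t = (\<lambda>i. C i t)"
  by (auto simp: g_def hat_def)

lemma g0_eq: "g 0 \<epsilon> t = C 0 t + sc (\<epsilon> * \<eta> t) (C b t) + sc ((\<epsilon> * \<eta> t)\<^sup>2 / 2) (C (n+1) t)"
  by (simp add: g_def D_0 Y_def Z_def power_mult_distrib)

lemma null0: "t \<in> I \<Longrightarrow> lor n (g 0 \<epsilon> t) (g 0 \<epsilon> t) = 0"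
  using b by (simp add: g0_eq lor_simps lor_C_table power2_eq_square)

lemma null1: "t \<in> I \<Longrightarrow> lor n (g 0 \<epsilon> t) (g 1 \<epsilon> t) = 0"
  using lor_const_deriv[OF opI deriv_g_numeral(1) deriv_g_numeral(1) null0 _ \<sigma>0, of t \<epsilon>] by (simp add: lor_commute[of n "g 1 \<epsilon> t"])

lemma null2: "t \<in> I \<Longrightarrow> lor n (g 0 \<epsilon> t) (g 2 \<epsilon> t) = - lor n (g 1 \<epsilon> t) (g 1 \<epsilon> t)"
  using lor_const_deriv[OF opI deriv_g_numeral(1) deriv_g_numeral(2) null1 _ \<sigma>0, of t \<epsilon>] by simp

lemma hat_orthonormal:
  assumes t: "t \<in> I" and i: "i \<in> {1..n}" and j: "j \<in> {1..n}"
  shows "lor n (hat \<epsilon> t i) (hat \<epsilon> t j) = (if i = j then 1 else 0)"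
  unfolding hat_def lor_simps lor_C(9)[OF t i j] lor_C(8)[OF t i] lor_C(7)[OF t j] lor_C(4)[OF t] by simp

lemma hat_g0:
  assumes t: "t \<in> I" and i: "i \<in> {1..n}"
  shows "lor n (g 0 \<epsilon> t) (hat \<epsilon> t i) = 0"
  unfolding hat_def g0_eq lor_simps lor_C(9)[OF t index_range(3)[OF b] i] lor_C(5)[OF t i] lor_C(7)[OF t i] lor_C(4)[OF t] lor_C(2)[OF t]
    lor_C(8)[OF t index_range(3)[OF b]] by simp

lemma hat_1: "hat \<epsilon> t 1 = C 1 t"
  using b by (simp add: hat_def)

lemma isvec_hat: "isvec n (hat \<epsilon> t i)"
  unfolding hat_def by (intro isvec_closed isvec_C)

lemma smooth_hat: "i \<in> {1..n} \<Longrightarrow> vsmooth_on I (\<lambda>t. hat \<epsilon> t i)"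
  unfolding hat_def by (cases "i = b") (auto intro!: vsmooth_add vsmooth_sc smooth_C opI Cinf_on_mult Cinf_on_const sm\<eta>)

lemma lor_g_at_0:
  assumes "t \<in> I"
  shows "lor n (g 1 0 t) (g 1 0 t) = 1" "lor n (g 1 0 t) (g 2 0 t) = 0" "lor n (g 1 0 t) (g 3 0 t) = 2 * \<mu> t"
    "lor n (g 3 0 t) (g 3 0 t) = 1 + (2 * \<mu> t)\<^sup>2" "lor n (g 1 0 t) (hat 0 t 1) = 1"
    "lor n (g 2 0 t) (g 2 0 t) = - 2 * \<mu> t"
  unfolding g_0 D1_C0[OF assms] D2_C0[OF assms] D3_C0[OF assms] hat_1 lor_simps lor_C_table[OF assms]
  by (simp_all add: power2_eq_square)

text \<open>With \<open><g_1, g_1> = 1\<close> and \<open><g_1, g_2> = 0\<close> the expression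
  reduces to \<open><g_3, g_3> - <g_1, g_3>^2\<close>, where the terms in \<open>\<mu>\<close>
  cancel. This is the unit normalisation of the arclength.\<close>

lemma quartic_0: "t \<in> I \<Longrightarrow> arclength_quartic n (g 1 0 t) (g 2 0 t) (g 3 0 t) = 1"
  by (simp add: arclength_quartic_def lor_g_at_0)

lemma continuous_on_D: "vsmooth_on I v \<Longrightarrow> continuous_on (UNIV \<times> I) (\<lambda>z. D k v (snd z) A)"
  using Cinf_on_continuous_on smooth_D unfolding vsmooth_on_def
  by (intro continuous_on_compose2[of I "\<lambda>t. D k v t A" _ snd]) (auto intro!: continuous_intros)

lemma continuous_on_g: "continuous_on (UNIV \<times> I) (\<lambda>z. g k (fst z) (snd z) A)"
  unfolding g_def plus_fun_apply sc_def by (intro continuous_intros continuous_on_D smooth_C0 smooth_Y smooth_Z)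

lemma continuous_on_dg: "continuous_on (UNIV \<times> I) (\<lambda>z. dg k (fst z) (snd z) A)"
  unfolding dg_def plus_fun_apply sc_def by (intro continuous_intros continuous_on_D smooth_C0 smooth_Y smooth_Z)

lemma continuous_on_lor_g: "continuous_on (UNIV \<times> I) (\<lambda>z. lor n (g i (fst z) (snd z)) (g j (fst z) (snd z)))"
  by (intro continuous_on_lor continuous_on_g)

lemma continuous_on_quartic:
  assumes "S \<subseteq> UNIV \<times> I" "\<And>\<epsilon> t. (\<epsilon>, t) \<in> S \<Longrightarrow> 0 < lor n (g 1 \<epsilon> t) (g 1 \<epsilon> t)"
  shows "continuous_on S (\<lambda>z. arclength_quartic n (g 1 (fst z) (snd z)) (g 2 (fst z) (snd z)) (g 3 (fst z) (snd z)))"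
proof -
  have c: "continuous_on S (\<lambda>z. lor n (g i (fst z) (snd z)) (g j (fst z) (snd z)))" for i j
    using continuous_on_subset[OF continuous_on_lor_g assms(1)] .
  have R: "lor n (g 1 (fst z) (snd z)) (g 1 (fst z) (snd z)) \<noteq> 0" if "z \<in> S" for z
    using assms(2)[of "fst z" "snd z"] that by simp
  show ?thesis
    unfolding arclength_quartic_def by (intro continuous_intros c) (auto simp: R)
qed

text \<open>The three inequalities say that the varied lift is an immersion, that the rotation in
  \<open>lift_frame\<close> is defined, and that the varied curve is still 1-generic.\<close>

definition admissible :: "real \<Rightarrow> bool" where
  "admissible d \<longleftrightarrow> 0 < d \<and> (\<forall>\<epsilon> t. \<bar>\<epsilon>\<bar> \<le> d \<longrightarrow> t \<in> I \<longrightarrow> 0 < lor n (g 1 \<epsilon> t) (g 1 \<epsilon> t) \<and>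
     0 < lor n (g 1 \<epsilon> t) (hat \<epsilon> t 1) \<and> 0 < arclength_quartic n (g 1 \<epsilon> t) (g 2 \<epsilon> t) (g 3 \<epsilon> t))"

text \<open>On the compact support of \<open>\<eta>\<close> the inequalities hold at
  \<open>\<epsilon> = 0\<close> and persist by \<open>tube_pos\<close>. Off the support nothing
  depends on \<open>\<epsilon>\<close>, so one \<open>d\<close> serves the whole of
  \<open>I\<close>, which need not be compact. The third tube uses the first because the quartic
  divides by \<open><g_1, g_1>\<close>.\<close>

lemma admissible_exists: "\<exists>d. admissible d"
proof -
  let ?K = "{l..r}"
  have sub: "{-c..c} \<times> ?K \<subseteq> UNIV \<times> I" for c :: real using lrI by auto
  have "continuous_on ({-1..1} \<times> ?K) (\<lambda>z. lor n (g 1 (fst z) (snd z)) (g 1 (fst z) (snd z)))"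
    by (rule continuous_on_subset[OF continuous_on_lor_g sub])
  then obtain d1 where d1: "0 < d1" "d1 \<le> 1" "\<And>\<epsilon> t. \<bar>\<epsilon>\<bar> \<le> d1 \<Longrightarrow> t \<in> ?K \<Longrightarrow> 0 < lor n (g 1 \<epsilon> t) (g 1 \<epsilon> t)"
    using tube_pos[of ?K 1 "\<lambda>\<epsilon> t. lor n (g 1 \<epsilon> t) (g 1 \<epsilon> t)"] lor_g_at_0(1) lrI by (auto simp: subset_iff)
  have "continuous_on ({-d1..d1} \<times> ?K) (\<lambda>z. lor n (g 1 (fst z) (snd z)) (D 1 (C 0) (snd z)))"
    by (rule continuous_on_subset[OF _ sub]) (intro continuous_on_lor continuous_on_g continuous_on_D smooth_C0)
  then obtain d2 where d2: "0 < d2" "d2 \<le> d1" "\<And>\<epsilon> t. \<bar>\<epsilon>\<bar> \<le> d2 \<Longrightarrow> t \<in> ?K \<Longrightarrow> 0 < lor n (g 1 \<epsilon> t) (D 1 (C 0) t)"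
    using tube_pos[of ?K d1 "\<lambda>\<epsilon> t. lor n (g 1 \<epsilon> t) (D 1 (C 0) t)"] lor_g_at_0(1) lrI d1(1) by (auto simp: subset_iff g_0)
  have "continuous_on ({-d2..d2} \<times> ?K) (\<lambda>z. arclength_quartic n (g 1 (fst z) (snd z)) (g 2 (fst z) (snd z)) (g 3 (fst z) (snd z)))"
    by (rule continuous_on_quartic[OF sub]) (use d1(3) d2(2) in auto)
  then obtain d where d: "0 < d" "d \<le> d2" "\<And>\<epsilon> t. \<bar>\<epsilon>\<bar> \<le> d \<Longrightarrow> t \<in> ?K \<Longrightarrow> 0 < arclength_quartic n (g 1 \<epsilon> t) (g 2 \<epsilon> t) (g 3 \<epsilon> t)"
    using tube_pos[of ?K d2 "\<lambda>\<epsilon> t. arclength_quartic n (g 1 \<epsilon> t) (g 2 \<epsilon> t) (g 3 \<epsilon> t)"] quartic_0 lrI d2(1) by (auto simp: subset_iff)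
  have "admissible d"
    unfolding admissible_def
  proof (intro conjI allI impI d(1))
    fix \<epsilon> t assume e: "\<bar>\<epsilon>\<bar> \<le> d" and t: "t \<in> I"
    have off: "g k \<epsilon> t = g k 0 t" if "t \<notin> ?K" for k using g_support[OF t that] by (simp add: g_0)
    show "0 < lor n (g 1 \<epsilon> t) (g 1 \<epsilon> t)"
      using d1(3)[of \<epsilon> t] d2(2) d(2) e off lor_g_at_0(1)[OF t] by (cases "t \<in> ?K") auto
    show "0 < lor n (g 1 \<epsilon> t) (hat \<epsilon> t 1)"
      using d2(3)[of \<epsilon> t] d(2) e off lor_g_at_0(5)[OF t] by (cases "t \<in> ?K") (auto simp: hat_1 D1_C0[OF t])
    show "0 < arclength_quartic n (g 1 \<epsilon> t) (g 2 \<epsilon> t) (g 3 \<epsilon> t)"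
      using d(3)[of \<epsilon> t] e off quartic_0[OF t] by (cases "t \<in> ?K") auto
  qed
  then show ?thesis ..
qed

text \<open>At \<open>\<epsilon> = 0\<close> the tangent is already \<open>hat 1\<close>, so
  rotation and shift are trivial and the construction returns \<open>e\<close>. This is the known
  endpoint of the path used for \<open>mob\<close>.\<close>

lemma lift_frame_0:
  assumes t: "t \<in> I" and "a \<le> n + 1"
  shows "lift_frame n (g 0 0 t) (g 1 0 t) (g 2 0 t) (hat 0 t) a = C a t"
proof -
  note A = lor_g_at_0[OF t]
  have u: "lift_tangent n (g 1 0 t) = C 1 t" 
    unfolding lift_tangent_def A by (simp add: g_0 D1_C0[OF t])
  have l: "lift_conormal n (g 0 0 t) (g 1 0 t) (g 2 0 t) = C (n+1) t"
    unfolding lift_conormal_def A by (simp add: g_0 D_0 D2_C0[OF t] fun_eq_iff sc_def)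
  have x: "lift_rot n (C 1 t) (\<lambda>i. C i t) i = C i t" if "i \<in> {2..n}" for i
    using lor_C(9)[OF t index_range(1), of i] that by (simp add: lift_rot_def)
  show ?thesis
    unfolding lift_frame_def u l hat_0 using x[of a] lor_C(8)[OF t, of a] assms(2)
    by (cases "a \<in> {2..n}") (auto simp: g_0 D_0)
qed

lemma lift_frame_lor_frame:
  assumes "admissible d" "\<bar>\<epsilon>\<bar> \<le> d" "t \<in> I"
  shows "lor_frame n (lift_frame n (g 0 \<epsilon> t) (g 1 \<epsilon> t) (g 2 \<epsilon> t) (hat \<epsilon> t))"
  by (rule lor_frame_lift_frame)
    (use assms n3 isvec_g isvec_hat null0 null1 null2 hat_g0 hat_orthonormal in \<open>simp_all add: admissible_def\<close>)

lemma lift_frame_isometry: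
  assumes "admissible d" "\<bar>\<epsilon>\<bar> \<le> d" "t \<in> I"
  shows "lor_isometry n (\<lambda>A a. lift_frame n (g 0 \<epsilon> t) (g 1 \<epsilon> t) (g 2 \<epsilon> t) (hat \<epsilon> t) a A)"
proof -
  let ?L = "lift_frame n (g 0 \<epsilon> t) (g 1 \<epsilon> t) (g 2 \<epsilon> t) (hat \<epsilon> t)"
  note F = lift_frame_lor_frame[OF assms]
  have "col n (\<lambda>A a. ?L a A) a = ?L a" if "a \<le> n + 1" for a
    using F that by (auto simp: col_def fun_eq_iff lor_frame_def isvec_def)
  then show ?thesis
    using F by (simp add: lor_isometry_iff_lor_frame lor_frame_def)
qed

lemma lift_frame_mob:
  assumes "admissible d" "\<bar>\<epsilon>\<bar> \<le> d" "t \<in> I"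
  shows "mob n (\<lambda>A a. lift_frame n (g 0 \<epsilon> t) (g 1 \<epsilon> t) (g 2 \<epsilon> t) (hat \<epsilon> t) a A)"
proof -
  define \<gamma> where "\<gamma> s = (\<lambda>A a. lift_frame n (g 0 (s * \<epsilon>) t) (g 1 (s * \<epsilon>) t) (g 2 (s * \<epsilon>) t) (hat (s * \<epsilon>) t) a A)" for s
  have s: "\<bar>s * \<epsilon>\<bar> \<le> d" if "s \<in> {0..1}" for s
    using mult_mono[of s 1 "\<bar>\<epsilon>\<bar>" d] that assms(2) by (simp add: abs_mult)
  \<comment> \<open>Shrinking \<open>\<epsilon>\<close> to 0 connects the varied frame to \<open>e t\<close> inside the isometry group.\<close>
  have "mob n (\<gamma> 1)"
  proof (rule mob_path)
    show "mob n (e t)" using frame_e assms(3) by (simp add: frame_def)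
    have cg: "continuous_on {0..1} (\<lambda>s. g k (s * \<epsilon>) t A)" for k A
      unfolding g_def sc_def plus_fun_apply by (intro continuous_intros)
    have ch: "continuous_on {0..1} (\<lambda>s. hat (s * \<epsilon>) t i A)" for i A
      unfolding hat_def sc_def plus_fun_apply by (cases "i = b") (auto intro!: continuous_intros)
    show "continuous_on {0..1} (\<lambda>s. \<gamma> s A a)" for A a
      unfolding \<gamma>_def by (rule continuous_on_lift_frame)
        (use cg ch s assms(1,3) in \<open>simp_all add: admissible_def\<close>)
    show "lor_isometry n (\<gamma> s)" if "s \<in> {0..1}" for s
      unfolding \<gamma>_def by (rule lift_frame_isometry[OF assms(1) s[OF that] assms(3)])
    show "\<gamma> 0 A a = e t A a" if "A \<le> n + 1" "a \<le> n + 1" for A a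
      using lift_frame_0[OF assms(3) that(2)] that(1) by (simp add: \<gamma>_def C_def col_def)
  qed
  then show ?thesis by (simp add: \<gamma>_def)
qed

lemma density_g:
  assumes "admissible d" "\<bar>\<epsilon>\<bar> \<le> d"
  shows "arclength_density n I (\<lambda>t. proj (g 0 \<epsilon> t))
     (\<lambda>t. \<bar>\<sigma> t\<bar> * arclength_quartic n (g 1 \<epsilon> t) (g 2 \<epsilon> t) (g 3 \<epsilon> t) powr (1/4))"
  by (rule arclength_density_lift_frame[OF _ opI \<sigma>0 deriv_g_numeral smooth_g smooth_g smooth_g _ isvec_g null0 _ _ _ _ _ _ refl, where hat = "hat \<epsilon>"])
    (use assms n3 smooth_hat isvec_hat hat_g0 hat_orthonormal lift_frame_mob in \<open>auto simp: admissible_def\<close>)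

lemma variation_g:
  assumes "admissible d" "{l..r} \<subseteq> {p<..<q}"
  shows "variation n I f p q d (g 0)"
  unfolding variation_def
proof (intro conjI allI impI ballI)
  show "0 < d" using assms(1) by (simp add: admissible_def)
  show "Cinf2_on ({-d<..<d} \<times> I) (\<lambda>z. g 0 (fst z) (snd z) A)" for A
    using Cinf2_on_quadratic[OF opI, of "\<lambda>t. C 0 t A" "\<lambda>t. Y t A" "\<lambda>t. Z t A" d] smooth_C0 smooth_Y smooth_Z
    by (simp add: vsmooth_on_def g_def D_0 sc_def)
  fix \<epsilon> assume e: "\<epsilon> \<in> {-d<..<d}"
  have e': "\<bar>\<epsilon>\<bar> \<le> d" using e by auto
  show "lift_immersion n I (g 0 \<epsilon>)"
    unfolding lift_immersion_def
  proof (intro ballI notI)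
    fix t assume t: "t \<in> I" and "\<exists>c. (\<lambda>A. deriv (\<lambda>s. g 0 \<epsilon> s A) t) = sc c (g 0 \<epsilon> t)"
    then obtain c where c: "(\<lambda>A. deriv (\<lambda>s. g 0 \<epsilon> s A) t) = sc c (g 0 \<epsilon> t)" by blast
    have "deriv (\<lambda>s. g 0 \<epsilon> s A) t = \<sigma> t * g 1 \<epsilon> t A" for A
      using deriv_g_numeral(1)[of \<epsilon>] t by (auto simp: has_vderiv_on_def has_sderiv_on_def intro!: DERIV_imp_deriv)
    then have eq: "sc (\<sigma> t) (g 1 \<epsilon> t) = sc c (g 0 \<epsilon> t)" using c by (simp add: sc_def)
    \<comment> \<open>A velocity parallel to the null lift would itself be null, whereas
      \<open>g 1\<close> is space-like.\<close>
    have "lor n (sc (\<sigma> t) (g 1 \<epsilon> t)) (sc (\<sigma> t) (g 1 \<epsilon> t)) = 0"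
      unfolding eq by (simp add: lor_simps null0[OF t])
    then have "lor n (g 1 \<epsilon> t) (g 1 \<epsilon> t) = 0" using \<sigma>0[OF t] by (simp add: lor_simps)
    moreover have "0 < lor n (g 1 \<epsilon> t) (g 1 \<epsilon> t)" using assms(1) e' t unfolding admissible_def by blast
    ultimately show False by simp
  qed
  fix t assume t: "t \<in> I"
  show "isvec n (g 0 \<epsilon> t)" by (rule isvec_g[OF t])
  show "lor n (g 0 \<epsilon> t) (g 0 \<epsilon> t) = 0" by (rule null0[OF t])
  show "g 0 \<epsilon> t \<noteq> 0"
  proof
    assume "g 0 \<epsilon> t = 0"
    then have "lor n (g 0 \<epsilon> t) (C (n+1) t) = 0" by (simp add: lor_simps)
    then show False using b by (simp add: g0_eq lor_simps lor_C_table[OF t])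
  qed
next
  fix t assume t: "t \<in> I"
  show "proj (g 0 0 t) = f t" using frame_e t by (simp add: g_0 D_0 C_def frame_def)
next
  show "\<exists>K. compact K \<and> K \<subseteq> {p<..<q} \<and> (\<forall>\<epsilon>\<in>{-d<..<d}. \<forall>t\<in>I - K. proj (g 0 \<epsilon> t) = f t)"
  proof (intro exI[of _ "{l..r}"] conjI ballI compact_Icc assms(2))
    fix \<epsilon> t assume "t \<in> I - {l..r}"
    then show "proj (g 0 \<epsilon> t) = f t"
      using g_support(1)[of t 0 \<epsilon>] frame_e by (simp add: D_0 C_def frame_def)
  qed
qed

end

section \<open>The first variation and the Euler-Lagrange equation\<close>

text \<open>The quotients are written through \<open>\<rho> = 1 / t11\<close>, which turns the
  expression into a polynomial. Its derivative can then be seen to be continuous term by term, and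
  it collapses where \<open>\<rho> = 1\<close> and \<open>\<rho>' = 0\<close>.\<close>

lemma quartic_has_deriv:
  fixes t11 t12 t13 t22 t23 t33 :: "real \<Rightarrow> real"
  assumes d: "(t11 has_real_derivative t11') (at x)" "(t12 has_real_derivative t12') (at x)"
    "(t13 has_real_derivative t13') (at x)" "(t22 has_real_derivative t22') (at x)"
    "(t23 has_real_derivative t23') (at x)" "(t33 has_real_derivative t33') (at x)" and nz: "t11 x \<noteq> 0"
  defines "\<rho> \<equiv> 1 / t11 x" and "\<rho>' \<equiv> - t11' / (t11 x)\<^sup>2"
  shows "((\<lambda>x. t33 x / t11 x - 6 * t12 x * t23 x / (t11 x)^2 + 9 * (t12 x)^2 * t22 x / (t11 x)^3
       - (t13 x / t11 x - 3 * (t12 x)^2 / (t11 x)^2)^2) has_real_derivative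
     t33' * \<rho> + t33 x * \<rho>' - 6 * ((t12' * t23 x + t12 x * t23') * \<rho>^2 + t12 x * t23 x * (2 * \<rho> * \<rho>'))
     + 9 * ((2 * t12 x * t12' * t22 x + (t12 x)^2 * t22') * \<rho>^3 + (t12 x)^2 * t22 x * (3 * \<rho>^2 * \<rho>'))
     - 2 * (t13 x * \<rho> - 3 * (t12 x)^2 * \<rho>^2) *
         (t13' * \<rho> + t13 x * \<rho>' - 3 * (2 * t12 x * t12' * \<rho>^2 + (t12 x)^2 * (2 * \<rho> * \<rho>')))) (at x)"
proof -
  define r where "r y = 1 / t11 y" for y
  have dr: "(r has_real_derivative \<rho>') (at x)"
    unfolding r_def \<rho>'_def using nz by (auto intro!: derivative_eq_intros d(1) simp: power2_eq_square)
  have \<rho>: "\<rho> = r x" by (simp add: r_def \<rho>_def)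
  have eq: "(\<lambda>x. t33 x / t11 x - 6 * t12 x * t23 x / (t11 x)^2 + 9 * (t12 x)^2 * t22 x / (t11 x)^3
       - (t13 x / t11 x - 3 * (t12 x)^2 / (t11 x)^2)^2) =
     (\<lambda>x. t33 x * r x - 6 * (t12 x * t23 x * (r x)^2) + 9 * ((t12 x)^2 * t22 x * (r x)^3)
       - (t13 x * r x - 3 * ((t12 x)^2 * (r x)^2))^2)"
    by (simp add: r_def power_one_over divide_inverse power_inverse mult.assoc)
  show ?thesis
    unfolding eq \<rho> by (rule derivative_eq_intros d dr refl)+ (simp add: algebra_simps power2_eq_square power3_eq_cube)
qed

lemma has_real_derivative_powr_comp:
  assumes "(m has_real_derivative m') (at x)" "0 < m x"
  shows "((\<lambda>x. c * m x powr r) has_real_derivative c * (r * m x powr (r - 1) * m')) (at x)"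
  by (rule DERIV_cmult, rule DERIV_chain2[OF has_real_derivative_powr[OF assms(2)] assms(1)])

lemma (in special_frame) deriv_D_numeral:
  assumes "vsmooth_on I v"
  shows "has_vderiv_on I \<sigma> (D 0 v) (D 1 v)" "has_vderiv_on I \<sigma> (D 1 v) (D 2 v)" "has_vderiv_on I \<sigma> (D 2 v) (D 3 v)"
  using deriv_D[OF assms, of 0] deriv_D[OF assms, of 1] deriv_D[OF assms, of 2]
  by (simp_all add: numeral_2_eq_2 numeral_3_eq_3 One_nat_def)

context frame_variation
begin

lemma deriv_g_eps: "has_vderiv_on UNIV (\<lambda>_. 1) (\<lambda>\<epsilon>. g k \<epsilon> t) (\<lambda>\<epsilon>. dg k \<epsilon> t)"
  unfolding has_vderiv_on_def has_sderiv_on_def g_def dg_def plus_fun_apply sc_def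
  by (auto intro!: derivative_eq_intros)

definition "T' i j \<epsilon> t = lor n (dg i \<epsilon> t) (g j \<epsilon> t) + lor n (g i \<epsilon> t) (dg j \<epsilon> t)"

lemma deriv_lor_g: "((\<lambda>\<epsilon>. lor n (g i \<epsilon> t) (g j \<epsilon> t)) has_real_derivative T' i j \<epsilon> t) (at \<epsilon>)"
  using sderiv_lor[OF deriv_g_eps[of i t] deriv_g_eps[of j t], of n] by (simp add: has_sderiv_on_def T'_def)

definition "\<rho> \<epsilon> t = 1 / lor n (g 1 \<epsilon> t) (g 1 \<epsilon> t)"
definition "\<rho>' \<epsilon> t = - T' 1 1 \<epsilon> t / (lor n (g 1 \<epsilon> t) (g 1 \<epsilon> t))\<^sup>2"

text \<open>\<open>quartic_has_deriv\<close> applied to the products of the \<open>g k\<close>. It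
  is needed for all small \<open>\<epsilon>\<close>, since differentiation under the integral sign
  requires the derivative to be continuous in both variables.\<close>

definition "dquartic \<epsilon> t =
  (let t12 = lor n (g 1 \<epsilon> t) (g 2 \<epsilon> t); t13 = lor n (g 1 \<epsilon> t) (g 3 \<epsilon> t); t22 = lor n (g 2 \<epsilon> t) (g 2 \<epsilon> t);
       t23 = lor n (g 2 \<epsilon> t) (g 3 \<epsilon> t); t33 = lor n (g 3 \<epsilon> t) (g 3 \<epsilon> t) in
   T' 3 3 \<epsilon> t * \<rho> \<epsilon> t + t33 * \<rho>' \<epsilon> t
     - 6 * ((T' 1 2 \<epsilon> t * t23 + t12 * T' 2 3 \<epsilon> t) * (\<rho> \<epsilon> t)^2 + t12 * t23 * (2 * \<rho> \<epsilon> t * \<rho>' \<epsilon> t))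
     + 9 * ((2 * t12 * T' 1 2 \<epsilon> t * t22 + t12^2 * T' 2 2 \<epsilon> t) * (\<rho> \<epsilon> t)^3 + t12^2 * t22 * (3 * (\<rho> \<epsilon> t)^2 * \<rho>' \<epsilon> t))
     - 2 * (t13 * \<rho> \<epsilon> t - 3 * t12^2 * (\<rho> \<epsilon> t)^2) *
         (T' 1 3 \<epsilon> t * \<rho> \<epsilon> t + t13 * \<rho>' \<epsilon> t - 3 * (2 * t12 * T' 1 2 \<epsilon> t * (\<rho> \<epsilon> t)^2 + t12^2 * (2 * \<rho> \<epsilon> t * \<rho>' \<epsilon> t))))"

lemma dquartic_deriv:
  assumes "0 < lor n (g 1 \<epsilon> t) (g 1 \<epsilon> t)"
  shows "((\<lambda>\<epsilon>. arclength_quartic n (g 1 \<epsilon> t) (g 2 \<epsilon> t) (g 3 \<epsilon> t)) has_real_derivative dquartic \<epsilon> t) (at \<epsilon>)"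
  unfolding arclength_quartic_def dquartic_def Let_def \<rho>_def \<rho>'_def
  by (rule quartic_has_deriv[OF deriv_lor_g deriv_lor_g deriv_lor_g deriv_lor_g deriv_lor_g deriv_lor_g]) (use assms in simp)

lemma continuous_on_dquartic:
  assumes "S \<subseteq> UNIV \<times> I" "\<And>\<epsilon> t. (\<epsilon>, t) \<in> S \<Longrightarrow> 0 < lor n (g 1 \<epsilon> t) (g 1 \<epsilon> t)"
  shows "continuous_on S (\<lambda>z. dquartic (fst z) (snd z))"
proof -
  have c: "continuous_on S (\<lambda>z. lor n (g i (fst z) (snd z)) (g j (fst z) (snd z)))" for i j
    using continuous_on_subset[OF continuous_on_lor_g assms(1)] .
  have c': "continuous_on S (\<lambda>z. T' i j (fst z) (snd z))" for i j
    unfolding T'_def by (rule continuous_on_subset[OF _ assms(1)]) (intro continuous_intros continuous_on_lor continuous_on_g continuous_on_dg)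
  have R: "lor n (g 1 (fst z) (snd z)) (g 1 (fst z) (snd z)) \<noteq> 0" if "z \<in> S" for z
    using assms(2)[of "fst z" "snd z"] that by simp
  have r: "continuous_on S (\<lambda>z. \<rho> (fst z) (snd z))" "continuous_on S (\<lambda>z. \<rho>' (fst z) (snd z))"
    unfolding \<rho>_def \<rho>'_def by (intro continuous_intros c c'; auto simp: R)+
  show ?thesis
    unfolding dquartic_def Let_def by (intro continuous_intros c c' r)
qed

text \<open>\<open>Y\<close> is a multiple of \<open>e_b\<close>, \<open>b \<ge> 3\<close>, hence
  orthogonal to \<open>D e_0\<close> and to \<open>D^2 e_0\<close>. Differentiating
  \<open><D e_0, Y> = 0\<close> three times gives the three relations in turn; they are the first
  variations of \<open><g_1, g_1>\<close>, \<open><g_1, g_2>\<close> and \<open><g_1, g_3>\<close>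
  up to a factor.\<close>

lemma lor_first_order:
  assumes t: "t \<in> I"
  shows "lor n (D 1 (C 0) t) (D 1 Y t) = 0" (is ?A)
    "lor n (D 2 (C 0) t) (D 1 Y t) + lor n (D 1 (C 0) t) (D 2 Y t) = 0" (is ?B)
    "lor n (D 1 (C 0) t) (D 3 Y t) + lor n (D 3 (C 0) t) (D 1 Y t) = - 2 * lor n (D 2 (C 0) t) (D 2 Y t)"
proof -
  have v: "has_vderiv_on I \<sigma> (D 1 (C 0)) (D 2 (C 0))" "has_vderiv_on I \<sigma> (D 2 (C 0)) (D 3 (C 0))"
    "has_vderiv_on I \<sigma> (D 0 Y) (D 1 Y)" "has_vderiv_on I \<sigma> (D 1 Y) (D 2 Y)" "has_vderiv_on I \<sigma> (D 2 Y) (D 3 Y)"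
    by (intro deriv_D_numeral smooth_C0 smooth_Y)+
  have a: "lor n (D 1 (C 0) t) (D 0 Y t) = 0" if "t \<in> I" for t
    using b by (simp add: D1_C0[OF that] D_0 Y_def lor_simps lor_C_table[OF that])
  have A: "lor n (D 1 (C 0) t) (D 1 Y t) = 0" if t: "t \<in> I" for t
  proof -
    have "lor n (D 2 (C 0) t) (D 0 Y t) = 0"
      using b by (simp add: D2_C0[OF t] D_0 Y_def lor_simps lor_C_table[OF t])
    then show ?thesis using lor_const_deriv[OF opI v(1) v(3) a t \<sigma>0[OF t]] by simp
  qed
  show ?A by (rule A[OF t])
  have B: "lor n (D 2 (C 0) t) (D 1 Y t) + lor n (D 1 (C 0) t) (D 2 Y t) = 0" if t: "t \<in> I" for t
    by (rule lor_const_deriv[OF opI v(1) v(4) A t \<sigma>0[OF t]])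
  show ?B by (rule B[OF t])
  have "(lor n (D 3 (C 0) t) (D 1 Y t) + lor n (D 2 (C 0) t) (D 2 Y t))
      + (lor n (D 2 (C 0) t) (D 2 Y t) + lor n (D 1 (C 0) t) (D 3 Y t)) = 0"
    by (rule sderiv_unique[OF opI sderiv_add[OF sderiv_lor[OF v(2) v(4)] sderiv_lor[OF v(1) v(5)]] sderiv_const B t \<sigma>0[OF t]])
  then show "lor n (D 1 (C 0) t) (D 3 Y t) + lor n (D 3 (C 0) t) (D 1 Y t) = - 2 * lor n (D 2 (C 0) t) (D 2 Y t)"
    by simp
qed

definition "first_var t = lor n (D 3 (C 0) t) (D 3 Y t) + 4 * \<mu> t * lor n (D 2 (C 0) t) (D 2 Y t)"

text \<open>At \<open>\<epsilon> = 0\<close> only the variations of \<open><g_3, g_3>\<close> and of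
  \<open>- <g_1, g_3>^2\<close> survive; the value \<open><g_1, g_3> = 2 \<mu>\<close> is the origin
  of the coefficient \<open>4 \<mu>\<close> in \<open>first_var\<close>.\<close>

lemma dquartic_0:
  assumes t: "t \<in> I"
  shows "dquartic 0 t = 2 * first_var t"
proof -
  have dg0: "dg k 0 t = D k Y t" for k by (simp add: dg_def)
  note A = lor_g_at_0[OF t]
  have T: "T' 1 1 0 t = 0" "T' 1 2 0 t = 0" "T' 1 3 0 t = - 2 * lor n (D 2 (C 0) t) (D 2 Y t)"
      "T' 3 3 0 t = 2 * lor n (D 3 (C 0) t) (D 3 Y t)"
    using lor_first_order[OF t] unfolding T'_def dg0 g_0
    by (simp_all add: lor_commute[of n "D k Y t" for k])
  have r: "\<rho> 0 t = 1" "\<rho>' 0 t = 0" unfolding \<rho>_def \<rho>'_def A T by simp_all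
  show ?thesis
    unfolding dquartic_def Let_def r T A first_var_def by simp
qed

text \<open>Leibniz' rule computes the derivative of the length at 0, and criticality says that this
  derivative is 0; uniqueness of derivatives equates the two.\<close>

lemma first_variation:
  assumes cg: "conformal_geodesic n I f" and pq: "p < q" "{p..q} \<subseteq> I" "{l..r} \<subseteq> {p<..<q}"
  shows "integral {p..q} (\<lambda>t. \<bar>\<sigma> t\<bar> * first_var t) = 0"
proof -
  obtain d where d: "admissible d" using admissible_exists by blast
  then have d0: "0 < d" and R: "\<And>\<epsilon> t. \<bar>\<epsilon>\<bar> \<le> d \<Longrightarrow> t \<in> I \<Longrightarrow> 0 < lor n (g 1 \<epsilon> t) (g 1 \<epsilon> t)"
    and M: "\<And>\<epsilon> t. \<bar>\<epsilon>\<bar> \<le> d \<Longrightarrow> t \<in> I \<Longrightarrow> 0 < arclength_quartic n (g 1 \<epsilon> t) (g 2 \<epsilon> t) (g 3 \<epsilon> t)"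
    unfolding admissible_def by blast+
  define U where "U = {-d<..<d}"
  define h where "h \<epsilon> t = \<bar>\<sigma> t\<bar> * arclength_quartic n (g 1 \<epsilon> t) (g 2 \<epsilon> t) (g 3 \<epsilon> t) powr (1/4)" for \<epsilon> t
  define h' where "h' \<epsilon> t = \<bar>\<sigma> t\<bar> * (1/4 * arclength_quartic n (g 1 \<epsilon> t) (g 2 \<epsilon> t) (g 3 \<epsilon> t) powr (1/4 - 1) * dquartic \<epsilon> t)" for \<epsilon> t
  have U: "\<bar>\<epsilon>\<bar> \<le> d" if "\<epsilon> \<in> U" for \<epsilon> using that by (auto simp: U_def)
  have sub: "U \<times> {p..q} \<subseteq> UNIV \<times> I" using pq by auto
  have RU: "0 < lor n (g 1 \<epsilon> t) (g 1 \<epsilon> t)" if "(\<epsilon>, t) \<in> U \<times> {p..q}" for \<epsilon> t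
    using R U that pq by auto
  have MU: "arclength_quartic n (g 1 \<epsilon> t) (g 2 \<epsilon> t) (g 3 \<epsilon> t) \<noteq> 0" if "\<epsilon> \<in> U" "p \<le> t" "t \<le> q" for \<epsilon> t
    using M[of \<epsilon> t] U that pq by fastforce
  have cs: "continuous_on (U \<times> {p..q}) (\<lambda>z. \<sigma> (snd z))"
    using continuous_on_compose2[OF Cinf_on_continuous_on[OF Cinf_\<sigma>] continuous_on_snd[OF continuous_on_id], of "U \<times> {p..q}"] pq(2)
    by fastforce
  have ch: "continuous_on (U \<times> {p..q}) (\<lambda>z. h (fst z) (snd z))"
    unfolding h_def by (intro continuous_intros cs continuous_on_quartic[OF sub RU]) (auto dest: MU)
  have ch': "continuous_on (U \<times> {p..q}) (\<lambda>z. h' (fst z) (snd z))"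
    unfolding h'_def by (intro continuous_intros cs continuous_on_quartic[OF sub RU] continuous_on_dquartic[OF sub RU]) (auto dest: MU)
  have "((\<lambda>\<epsilon>. integral (cbox p q) (h \<epsilon>)) has_field_derivative integral (cbox p q) (h' 0)) (at 0 within U)"
  proof (rule leibniz_rule_field_derivative)
    show "((\<lambda>\<epsilon>. h \<epsilon> t) has_field_derivative h' \<epsilon> t) (at \<epsilon> within U)" if "\<epsilon> \<in> U" "t \<in> cbox p q" for \<epsilon> t
    proof -
      have t: "t \<in> I" using that pq by auto
      note e = U[OF that(1)]
      show ?thesis
        unfolding h_def h'_def
        by (rule has_field_derivative_at_within[OF has_real_derivative_powr_comp[OF dquartic_deriv[OF R[OF e t]] M[OF e t]]])
    qed
    show "h \<epsilon> integrable_on cbox p q" if "\<epsilon> \<in> U" for \<epsilon>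
    proof -
      have "continuous_on {p..q} (\<lambda>t. h (fst (\<epsilon>, t)) (snd (\<epsilon>, t)))"
        by (rule continuous_on_compose2[OF ch]) (use that in \<open>auto intro!: continuous_intros\<close>)
      then show ?thesis by (simp add: integrable_continuous_interval)
    qed
    show "continuous_on (U \<times> cbox p q) (\<lambda>(\<epsilon>, t). h' \<epsilon> t)"
      using ch' by (simp add: split_beta)
  qed (use d0 in \<open>auto simp: U_def\<close>)
  moreover have "at 0 within U = at 0" using d0 by (intro at_within_open) (auto simp: U_def)
  ultimately have 1: "((\<lambda>\<epsilon>. integral {p..q} (h \<epsilon>)) has_real_derivative integral {p..q} (h' 0)) (at 0)" by simp
  have "\<forall>\<epsilon>\<in>{-d<..<d}. arclength_density n I (\<lambda>t. proj (g 0 \<epsilon> t)) (h \<epsilon>)"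
    unfolding h_def using density_g[OF d] by auto
  then have "((\<lambda>\<epsilon>. integral {p..q} (h \<epsilon>)) has_real_derivative 0) (at 0)"
    using cg pq variation_g[OF d pq(3)] unfolding conformal_geodesic_def by blast
  with 1 have "integral {p..q} (h' 0) = 0" by (rule DERIV_unique)
  \<comment> \<open>The factor 1/2 is the exponent 1/4 times the 2 from \<open>dquartic_0\<close>;
    the remaining power is taken of the value 1.\<close>
  moreover have "integral {p..q} (h' 0) = integral {p..q} (\<lambda>t. (1/2) * (\<bar>\<sigma> t\<bar> * first_var t))"
  proof (rule integral_cong)
    fix t assume "t \<in> {p..q}"
    then have t: "t \<in> I" using pq by auto
    show "h' 0 t = (1/2) * (\<bar>\<sigma> t\<bar> * first_var t)"
      unfolding h'_def quartic_0[OF t] dquartic_0[OF t] by simp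
  qed
  ultimately show ?thesis unfolding integral_mult_right by simp
qed

end

context special_frame
begin

text \<open>\<open>B\<close> is \<open>D^4 e_0 - 4 \<mu> D^2 e_0\<close>: integrating the first variation by parts leaves \<open>D^2 B\<close>.\<close>

definition "\<kappa> t = 1 + \<mu>2 t - 2 * (\<mu> t)\<^sup>2"
definition "B t = X t + sc (3 * \<mu>1 t) (C 1 t) - sc (2 * \<mu> t) (C (n+1) t) + sc (\<kappa> t) (C 0 t)"
definition "S t = lor n (X t) (X t) + 2 * \<mu> t"

lemma Cinf_\<kappa>: "Cinf_on I \<kappa>" and Cinf_S: "Cinf_on I S"
  unfolding \<kappa>_def[abs_def] S_def[abs_def]
  by (intro Cinf_on_diff Cinf_on_add Cinf_on_mult Cinf_on_const Cinf_on_power Cinf_on_lor opI Cinf_\<mu> Cinf_\<mu>2 smooth_X)+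

lemma smooth_B: "vsmooth_on I B"
  unfolding B_def[abs_def]
  by (intro vsmooth_add vsmooth_diff vsmooth_sc opI smooth_X smooth_C Cinf_on_mult Cinf_on_const Cinf_\<mu> Cinf_\<mu>1 Cinf_\<kappa>) simp_all

lemma sderiv_cmult: "has_sderiv_on I \<sigma> k k' \<Longrightarrow> has_sderiv_on I \<sigma> (\<lambda>t. c * k t) (\<lambda>t. c * k' t)"
  using sderiv_mult[OF sderiv_const[of I \<sigma> c], of k k'] by simp

lemma D4_C0: "t \<in> I \<Longrightarrow> D 4 (C 0) t = B t + sc (4 * \<mu> t) (D 2 (C 0) t)"
proof -
  assume t: "t \<in> I"
  have v: "has_vderiv_on I \<sigma> (\<lambda>t. C 2 t + sc (2 * \<mu> t) (C 1 t) + sc (\<mu>1 t) (C 0 t))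
     (\<lambda>t. (C 0 t + X t) + (sc (2 * \<mu>1 t) (C 1 t) + sc (2 * \<mu> t) (sc (\<mu> t) (C 0 t) + C (n+1) t))
        + (sc (\<mu>2 t) (C 0 t) + sc (\<mu>1 t) (C 1 t)))"
    by (intro vderiv_add vderiv_sc deriv_C0 deriv_C1 deriv_C2 sderiv_cmult sderiv_\<mu> sderiv_\<mu>1)
  have "D 4 (C 0) t = (C 0 t + X t) + (sc (2 * \<mu>1 t) (C 1 t) + sc (2 * \<mu> t) (sc (\<mu> t) (C 0 t) + C (n+1) t))
        + (sc (\<mu>2 t) (C 0 t) + sc (\<mu>1 t) (C 1 t))"
    using D_Suc_eq[OF smooth_C0 D3_C0 v t] by simp
  then show ?thesis
    unfolding D2_C0[OF t] B_def \<kappa>_def by (simp add: fun_eq_iff sc_def algebra_simps power2_eq_square)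
qed

text \<open>In \<open>D^2 B\<close> the only contributions along \<open>e_b\<close>,
  \<open>b \<ge> 3\<close>, are those of \<open>D N\<close> and \<open>- S X\<close>, so the
  Euler-Lagrange equation fixes these components of \<open>D N\<close>. The others follow from
  orthogonality of \<open>N\<close> to the remaining legs; the one along \<open>e_2\<close> is
  \<open>- <N, D e_2> = - <N, X>\<close>.\<close>

lemma nabla_deriv_of_EL:
  assumes EL: "\<And>t b. t \<in> I \<Longrightarrow> b \<in> {3..n} \<Longrightarrow> lor n (D 2 B t) (C b t) = 0"
  shows "has_vderiv_on I \<sigma> N (\<lambda>t. sc (S t) (X t) - sc (lor n (X t) (N t)) (C 2 t))"
proof (rule vderiv_cong[OF opI deriv_D[OF smooth_N, of 0]])
  show "D 0 N t = N t" for t by (simp add: D_0)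
  fix t assume t: "t \<in> I"
  obtain \<kappa>' where s\<kappa>: "has_sderiv_on I \<sigma> \<kappa> \<kappa>'" and C\<kappa>': "Cinf_on I \<kappa>'"
    using sderiv_exists[OF Cinf_\<kappa>, of \<sigma>] Cinf_on_sderiv[OF opI Cinf_\<kappa> Cinf_\<sigma>] \<sigma>0 by blast
  define k1 where "k1 t = 3 * \<mu>2 t - 2 * (\<mu> t * \<mu> t) + \<kappa> t" for t
  define k0 where "k0 t = 3 * (\<mu>1 t * \<mu> t) + \<kappa>' t" for t
  have Ck: "Cinf_on I k1" "Cinf_on I k0"
    unfolding k1_def k0_def
    by (intro Cinf_on_diff Cinf_on_add Cinf_on_mult Cinf_on_const opI Cinf_\<mu> Cinf_\<mu>1 Cinf_\<mu>2 Cinf_\<kappa> C\<kappa>')+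
  \<comment> \<open>Existence of these derivatives suffices: they multiply only \<open>e_0\<close>,
    \<open>e_1\<close> and \<open>e_2\<close>, which are orthogonal to the \<open>e_b\<close> with
    \<open>b \<ge> 3\<close>.\<close>
  obtain k1' k0' S' where sk: "has_sderiv_on I \<sigma> k1 k1'" "has_sderiv_on I \<sigma> k0 k0'" "has_sderiv_on I \<sigma> S S'"
    using sderiv_exists[OF Ck(1), of \<sigma>] sderiv_exists[OF Ck(2), of \<sigma>] sderiv_exists[OF Cinf_S, of \<sigma>] \<sigma>0 by blast
  \<comment> \<open>The coefficient of \<open>e_2\<close> in \<open>D B\<close> is
    \<open>- S\<close>: \<open>D X\<close> contributes \<open>- <X, X>\<close> and
    \<open>- 2 \<mu> D e_(n+1)\<close> contributes \<open>- 2 \<mu>\<close>. One more derivative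
    turns it into the term \<open>- S X\<close>.\<close>
  define B1 where "B1 t = N t - sc (S t) (C 2 t) + sc (k1 t) (C 1 t) + sc (\<mu>1 t) (C (n+1) t) + sc (k0 t) (C 0 t)" for t
  have vB: "has_vderiv_on I \<sigma> B (\<lambda>t. (N t - sc (lor n (X t) (X t)) (C 2 t))
      + (sc (3 * \<mu>2 t) (C 1 t) + sc (3 * \<mu>1 t) (sc (\<mu> t) (C 0 t) + C (n+1) t))
      - (sc (2 * \<mu>1 t) (C (n+1) t) + sc (2 * \<mu> t) (sc (\<mu> t) (C 1 t) + C 2 t))
      + (sc (\<kappa>' t) (C 0 t) + sc (\<kappa> t) (C 1 t)))"
    unfolding B_def[abs_def] by (intro vderiv_add vderiv_diff vderiv_sc deriv_X deriv_C0 deriv_C1 deriv_C_last sderiv_cmult sderiv_\<mu> sderiv_\<mu>1 s\<kappa>)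
  have D1B: "D 1 B t = B1 t" if "t \<in> I" for t
    using D_Suc_eq[OF smooth_B _ vB that, of 0]
    by (simp add: D_0 One_nat_def B1_def S_def k1_def k0_def fun_eq_iff sc_def algebra_simps)
  have vN: "has_vderiv_on I \<sigma> N (D (Suc 0) N)" using deriv_D[OF smooth_N, of 0] by (simp add: D_0)
  have vB1: "has_vderiv_on I \<sigma> B1 (\<lambda>t. D (Suc 0) N t - (sc (S' t) (C 2 t) + sc (S t) (C 0 t + X t))
      + (sc (k1' t) (C 1 t) + sc (k1 t) (sc (\<mu> t) (C 0 t) + C (n+1) t))
      + (sc (\<mu>2 t) (C (n+1) t) + sc (\<mu>1 t) (sc (\<mu> t) (C 1 t) + C 2 t))
      + (sc (k0' t) (C 0 t) + sc (k0 t) (C 1 t)))"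
    unfolding B1_def[abs_def] by (intro vderiv_add vderiv_diff vderiv_sc vN deriv_C0 deriv_C1 deriv_C2 deriv_C_last sderiv_\<mu>1 sk)
  have D2B: "D 2 B t = D (Suc 0) N t - (sc (S' t) (C 2 t) + sc (S t) (C 0 t + X t))
      + (sc (k1' t) (C 1 t) + sc (k1 t) (sc (\<mu> t) (C 0 t) + C (n+1) t))
      + (sc (\<mu>2 t) (C (n+1) t) + sc (\<mu>1 t) (sc (\<mu> t) (C 1 t) + C 2 t))
      + (sc (k0' t) (C 0 t) + sc (k0 t) (C 1 t))"
    using D_Suc_eq[OF smooth_B D1B vB1 t] by (simp add: numeral_2_eq_2 One_nat_def)
  have z: "lor n (D (Suc 0) N t) (C a t) = - lor n (N t) (C' a t)"
    if "a \<le> n + 1" "\<And>t. t \<in> I \<Longrightarrow> lor n (N t) (C a t) = 0" for a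
    using lor_const_deriv[OF opI vN deriv_C[OF that(1)] that(2) t \<sigma>0[OF t]] by simp
  show "D (Suc 0) N t = sc (S t) (X t) - sc (lor n (X t) (N t)) (C 2 t)"
  proof (rule lor_frame_eqI[OF lor_frame_C[OF t]])
    show "isvec n (D (Suc 0) N t)" by (rule isvec_D[OF smooth_N isvec_N t])
    show "isvec n (sc (S t) (X t) - sc (lor n (X t) (N t)) (C 2 t))" by (intro isvec_closed isvec_X isvec_C)
    show "lor n (D (Suc 0) N t) (C a t) = lor n (sc (S t) (X t) - sc (lor n (X t) (N t)) (C 2 t)) (C a t)"
      if a: "a \<le> n + 1" for a
      using a
    proof (cases a rule: index_cases)
      case 5
      have "lor n (D (Suc 0) N t) (C a t) = S t * lor n (X t) (C a t)"
        using EL[OF t 5] 5 unfolding D2B lor_simps by (simp add: lor_C_table[OF t])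
      then show ?thesis using 5 by (simp add: lor_simps lor_C_table[OF t])
    qed (use n3 t lor_commute[of n "X t" "N t"] in \<open>simp_all add: z structure_equations lor_X lor_N lor_simps lor_C_table\<close>)
  qed
qed

end

text \<open>Integration by parts is done with respect to \<open>\<sigma> dt\<close>, while the
  length carries the absolute value of \<open>\<sigma>\<close>; the constant \<open>c\<close> is the
  sign of \<open>\<sigma>\<close> on the interval.\<close>

lemma (in frame_variation) euler_lagrange_integral:
  assumes cg: "conformal_geodesic n I f" and pq: "p < q" "{p..q} \<subseteq> I" "{l..r} \<subseteq> {p<..<q}"
    and sgn: "\<And>t. t \<in> {p..q} \<Longrightarrow> \<bar>\<sigma> t\<bar> = c * \<sigma> t"
  shows "((\<lambda>t. c * \<sigma> t * (\<eta> t * lor n (D 2 B t) (C b t))) has_integral 0) {p..q}"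
proof -
  have v: "has_vderiv_on I \<sigma> (D 3 (C 0)) (D 4 (C 0))" "has_vderiv_on I \<sigma> (D 2 Y) (D 3 Y)"
    "has_vderiv_on I \<sigma> (D 0 B) (D 1 B)" "has_vderiv_on I \<sigma> (D 1 Y) (D 2 Y)" "has_vderiv_on I \<sigma> (D 1 B) (D 2 B)"
    "has_vderiv_on I \<sigma> (D 0 Y) (D 1 Y)"
    using deriv_D[OF smooth_C0, of 3] deriv_D[OF smooth_Y, of 2] deriv_D_numeral[OF smooth_Y] deriv_D_numeral[OF smooth_B] by simp_all
  \<comment> \<open>The boundary expression of three integrations by parts. Its arclength derivative
    is \<open>first_var\<close> plus \<open>\<eta> <D^2 B, e_b>\<close>: the terms in
    \<open>D B\<close> cancel, and so do those in \<open>B\<close> once \<open>D^4 e_0\<close> is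
    replaced by \<open>B + 4 \<mu> D^2 e_0\<close>.\<close>
  define \<Phi> where "\<Phi> t = lor n (D 3 (C 0) t) (D 2 Y t) - lor n (D 0 B t) (D 1 Y t) + lor n (D 1 B t) (D 0 Y t)" for t
  have s\<Phi>0: "has_sderiv_on I \<sigma> \<Phi> (\<lambda>t. (lor n (D 4 (C 0) t) (D 2 Y t) + lor n (D 3 (C 0) t) (D 3 Y t))
     - (lor n (D 1 B t) (D 1 Y t) + lor n (D 0 B t) (D 2 Y t)) + (lor n (D 2 B t) (D 0 Y t) + lor n (D 1 B t) (D 1 Y t)))"
    unfolding \<Phi>_def[abs_def] by (intro sderiv_add sderiv_diff sderiv_lor v)
  have s\<Phi>: "has_sderiv_on I \<sigma> \<Phi> (\<lambda>t. first_var t + \<eta> t * lor n (D 2 B t) (C b t))"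
    by (rule sderiv_cong[OF opI s\<Phi>0 refl])
      (simp add: D4_C0 D_0 Y_def first_var_def lor_left lor_right(4))
  have "((\<lambda>t. \<sigma> t * (first_var t + \<eta> t * lor n (D 2 B t) (C b t))) has_integral \<Phi> q - \<Phi> p) {p..q}"
  proof (rule fundamental_theorem_of_calculus[where f = \<Phi>])
    show "(\<Phi> has_vector_derivative \<sigma> t * (first_var t + \<eta> t * lor n (D 2 B t) (C b t))) (at t within {p..q})"
      if "t \<in> {p..q}" for t
    proof -
      have "t \<in> I" using that pq(2) by blast
      then have "(\<Phi> has_real_derivative \<sigma> t * (first_var t + \<eta> t * lor n (D 2 B t) (C b t))) (at t)"
        using s\<Phi> by (simp add: has_sderiv_on_def)
      then show ?thesis
        unfolding has_real_derivative_iff_has_vector_derivative by (rule has_vector_derivative_at_within)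
    qed
  qed (use pq in simp)
  moreover have "\<Phi> x = 0" if "x = p \<or> x = q" for x
  proof -
    have x: "x \<in> I" "x \<notin> {l..r}" using that pq by auto
    have "D k Y x = 0" for k
      by (rule D_support[OF smooth_Y, of "{l..r}"]) (use x supp in \<open>auto simp: Y_def\<close>)
    then show ?thesis by (simp add: \<Phi>_def lor_simps)
  qed
  ultimately have "((\<lambda>t. \<sigma> t * (first_var t + \<eta> t * lor n (D 2 B t) (C b t))) has_integral 0) {p..q}" by simp
  then have 1: "((\<lambda>t. c * (\<sigma> t * (first_var t + \<eta> t * lor n (D 2 B t) (C b t)))) has_integral c * 0) {p..q}"
    by (rule has_integral_mult_right)
  have "Cinf_on I first_var"
    unfolding first_var_def[abs_def]
    by (intro Cinf_on_add Cinf_on_mult Cinf_on_const Cinf_on_lor smooth_D smooth_C0 smooth_Y opI Cinf_\<mu>)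
  then have "continuous_on {p..q} (\<lambda>t. \<bar>\<sigma> t\<bar> * first_var t)"
    using pq(2) continuous_on_subset[OF Cinf_on_continuous_on[OF Cinf_\<sigma>]] continuous_on_subset[OF Cinf_on_continuous_on]
    by (intro continuous_intros) blast+
  then have "((\<lambda>t. \<bar>\<sigma> t\<bar> * first_var t) has_integral 0) {p..q}"
    using integrable_integral[OF integrable_continuous_interval] first_variation[OF cg pq] by metis
  then have "((\<lambda>t. c * \<sigma> t * first_var t) has_integral 0) {p..q}"
    by (rule has_integral_eq[rotated]) (simp add: sgn)
  from has_integral_diff[OF 1 this] show ?thesis by (simp add: algebra_simps)
qed

text \<open>The fundamental lemma of the calculus of variations: were the product nonzero at
  \<open>t0\<close>, a bump concentrated where the integrand and \<open>\<sigma>\<close> keep their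
  signs would give a nonzero integral.\<close>

lemma (in special_frame) euler_lagrange:
  assumes cg: "conformal_geodesic n I f" and t0: "t0 \<in> I" and b: "b \<in> {3..n}"
  shows "lor n (D 2 B t0) (C b t0) = 0"
proof (rule ccontr)
  \<comment> \<open>The density is included in \<open>w\<close>. Multiplying by the constant
    \<open>w t0\<close> later makes the integrand nonnegative whichever sign occurs.\<close>
  define w where "w t = \<sigma> t * lor n (D 2 B t) (C b t)" for t
  assume "lor n (D 2 B t0) (C b t0) \<noteq> 0"
  then have w0: "w t0 \<noteq> 0" using \<sigma>0[OF t0] by (simp add: w_def)
  have Cw: "Cinf_on I w" unfolding w_def[abs_def]
    using b by (intro Cinf_on_mult Cinf_on_lor opI Cinf_\<sigma> smooth_D smooth_B smooth_C) simp
  have op: "open (I \<inter> {t. t \<in> I \<and> 0 < w t * w t0} \<inter> {t. t \<in> I \<and> 0 < \<sigma> t * \<sigma> t0})"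
  proof -
    have "open (I \<inter> (\<lambda>t. w t * w t0) -` {0<..})" "open (I \<inter> (\<lambda>t. \<sigma> t * \<sigma> t0) -` {0<..})"
      by (intro continuous_open_preimage continuous_intros Cinf_on_continuous_on Cw Cinf_\<sigma> opI open_greaterThan)+
    then have "open ((I \<inter> (\<lambda>t. w t * w t0) -` {0<..}) \<inter> (I \<inter> (\<lambda>t. \<sigma> t * \<sigma> t0) -` {0<..}))"
      by (rule open_Int)
    also have "(I \<inter> (\<lambda>t. w t * w t0) -` {0<..}) \<inter> (I \<inter> (\<lambda>t. \<sigma> t * \<sigma> t0) -` {0<..}) =
        I \<inter> {t. t \<in> I \<and> 0 < w t * w t0} \<inter> {t. t \<in> I \<and> 0 < \<sigma> t * \<sigma> t0}" by auto
    finally show ?thesis .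
  qed
  moreover have "t0 \<in> I \<inter> {t. t \<in> I \<and> 0 < w t * w t0} \<inter> {t. t \<in> I \<and> 0 < \<sigma> t * \<sigma> t0}"
    using t0 w0 \<sigma>0[OF t0] by (auto simp: zero_less_mult_iff linorder_neq_iff)
  ultimately obtain \<delta> where \<delta>: "0 < \<delta>" "cball t0 \<delta> \<subseteq> I \<inter> {t. t \<in> I \<and> 0 < w t * w t0} \<inter> {t. t \<in> I \<and> 0 < \<sigma> t * \<sigma> t0}"
    unfolding open_contains_cball by blast
  define p q where "p = t0 - \<delta>" and "q = t0 + \<delta>"
  have pq: "p < q" "{p..q} \<subseteq> I" "\<And>t. t \<in> {p..q} \<Longrightarrow> 0 < w t * w t0" "\<And>t. t \<in> {p..q} \<Longrightarrow> 0 < \<sigma> t * \<sigma> t0"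
    using \<delta> by (auto simp: p_def q_def cball_def dist_real_def subset_iff abs_le_iff)
  obtain \<eta> where \<eta>: "Cinf_on I \<eta>" "\<And>t. 0 \<le> \<eta> t" "\<And>t. t \<in> {t0 - \<delta>/2<..<t0 + \<delta>/2} \<Longrightarrow> 0 < \<eta> t"
      "\<And>t. t \<notin> {t0 - \<delta>/2..t0 + \<delta>/2} \<Longrightarrow> \<eta> t = 0"
    using smooth_bump_exists[of "t0 - \<delta>/2" "t0 + \<delta>/2" I] \<delta>(1) by auto
  \<comment> \<open>The bump lives on the inner half of the interval, as a variation must be
    supported in the interior of the domain of integration.\<close>
  have lr: "{t0 - \<delta>/2..t0 + \<delta>/2} \<subseteq> {p<..<q}" using \<delta>(1) by (auto simp: p_def q_def)
  have lrI: "{t0 - \<delta>/2..t0 + \<delta>/2} \<subseteq> I"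
    using lr greaterThanLessThan_subseteq_atLeastAtMost_iff[of p q p q] pq(2) by blast
  interpret frame_variation n I f e b \<eta> "t0 - \<delta>/2" "t0 + \<delta>/2"
    using b \<eta> lrI by unfold_locales auto
  have sgn: "\<bar>\<sigma> t\<bar> = sgn (\<sigma> t0) * \<sigma> t" if "t \<in> {p..q}" for t
    using pq(4)[OF that] by (auto simp: zero_less_mult_iff)
  define c where "c = sgn (\<sigma> t0)"
  have "((\<lambda>t. c * \<sigma> t * (\<eta> t * lor n (D 2 B t) (C b t))) has_integral 0) {p..q}"
    unfolding c_def by (rule euler_lagrange_integral[OF cg pq(1,2) lr sgn])
  then have "((\<lambda>t. (c * w t0) * (c * \<sigma> t * (\<eta> t * lor n (D 2 B t) (C b t)))) has_integral (c * w t0) * 0) {p..q}"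
    by (rule has_integral_mult_right)
  moreover have "c * c = 1" using \<sigma>0[OF t0] by (simp add: c_def sgn_if)
  then have "(c * w t0) * (c * \<sigma> t * (\<eta> t * lor n (D 2 B t) (C b t))) = \<eta> t * (w t * w t0)" for t
  proof -
    have "(c * w t0) * (c * \<sigma> t * (\<eta> t * lor n (D 2 B t) (C b t))) = (c * c) * (\<eta> t * (w t * w t0))"
      by (simp add: w_def)
    then show ?thesis using \<open>c * c = 1\<close> by simp
  qed
  ultimately have int0: "((\<lambda>t. \<eta> t * (w t * w t0)) has_integral 0) (cbox p q)" by simp
  have "\<eta> t0 * (w t0 * w t0) = 0"
  proof (rule has_integral_0_cbox_imp_0[OF _ _ int0])
    show "continuous_on (cbox p q) (\<lambda>t. \<eta> t * (w t * w t0))"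
      using pq(2) by (intro continuous_intros continuous_on_subset[OF Cinf_on_continuous_on[OF \<eta>(1)]]
          continuous_on_subset[OF Cinf_on_continuous_on[OF Cw]]) auto
    show "0 \<le> \<eta> t * (w t * w t0)" if "t \<in> box p q" for t
      using \<eta>(2)[of t] pq(3)[of t] that by (auto intro!: mult_nonneg_nonneg less_imp_le)
  qed (use \<delta>(1) in \<open>auto simp: p_def q_def\<close>)
  then show False using \<eta>(3)[of t0] \<delta>(1) w0 by auto
qed

section \<open>Constancy of the subspace\<close>

text \<open>\<open>E\<close> times \<open>exp (- L t)\<close> is nonincreasing and \<open>E\<close>
  times \<open>exp (L t)\<close> is nondecreasing. The first propagates the zero forwards from
  \<open>s\<close>, the second backwards.\<close>

lemma gronwall_zero:
  fixes E E' :: "real \<Rightarrow> real"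
  assumes d: "\<And>t. t \<in> J \<Longrightarrow> (E has_real_derivative E' t) (at t)" and nn: "\<And>t. t \<in> J \<Longrightarrow> 0 \<le> E t"
    and bd: "\<And>t. t \<in> J \<Longrightarrow> \<bar>E' t\<bar> \<le> L * E t" and E0: "E s = 0" and J: "closed_segment s t \<subseteq> J"
  shows "E t = 0"
proof (cases "s \<le> t")
  case True
  have "E t * exp (- L * t) \<le> E s * exp (- L * s)"
  proof (rule DERIV_nonpos_imp_nonincreasing[OF True])
    fix x assume "s \<le> x" "x \<le> t"
    then have x: "x \<in> J" using J True by (auto simp: closed_segment_eq_real_ivl)
    have "((\<lambda>x. E x * exp (- L * x)) has_real_derivative (E' x - L * E x) * exp (- L * x)) (at x)"
      by (auto intro!: derivative_eq_intros d[OF x] simp: algebra_simps)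
    moreover have "(E' x - L * E x) * exp (- L * x) \<le> 0"
      using bd[OF x] by (intro mult_nonpos_nonneg) auto
    ultimately show "\<exists>y. ((\<lambda>x. E x * exp (- L * x)) has_real_derivative y) (at x) \<and> y \<le> 0" by blast
  qed
  then have "E t \<le> 0" using E0 by (simp add: mult_le_0_iff)
  moreover have "t \<in> J" using J by auto
  ultimately show ?thesis using nn by fastforce
next
  case False
  then have ts: "t \<le> s" by simp
  have "E t * exp (L * t) \<le> E s * exp (L * s)"
  proof (rule DERIV_nonneg_imp_nondecreasing[OF ts])
    fix x assume "t \<le> x" "x \<le> s"
    then have x: "x \<in> J" using J False by (auto simp: closed_segment_eq_real_ivl)
    have "((\<lambda>x. E x * exp (L * x)) has_real_derivative (E' x + L * E x) * exp (L * x)) (at x)"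
      by (auto intro!: derivative_eq_intros d[OF x] simp: algebra_simps)
    moreover have "0 \<le> (E' x + L * E x) * exp (L * x)"
      using bd[OF x] by (intro mult_nonneg_nonneg) auto
    ultimately show "\<exists>y. ((\<lambda>x. E x * exp (L * x)) has_real_derivative y) (at x) \<and> 0 \<le> y" by blast
  qed
  then have "E t \<le> 0" using E0 by (simp add: mult_le_0_iff)
  moreover have "t \<in> J" using J by auto
  ultimately show ?thesis using nn by fastforce
qed

section \<open>Lorentz-orthonormal bases and dimension\<close>

lemma vspan_alt: "vspan S = vs.span S" and vdim_alt: "vdim S = vs.dim S"
  by (simp_all add: vspan_def vdim_def)

lemma lor_span_eq_0:
  assumes "\<And>x. x \<in> S \<Longrightarrow> lor n x w = 0" "v \<in> vs.span S"
  shows "lor n v w = 0"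
proof -
  have "vs.subspace {v. lor n v w = 0}"
    by (simp add: vs.subspace_def lor_left)
  then have "vs.span S \<subseteq> {v. lor n v w = 0}"
    using assms(1) by (intro vs.span_minimal) auto
  then show ?thesis using assms(2) by blast
qed

lemma isvec_span:
  assumes "\<And>x. x \<in> S \<Longrightarrow> isvec n x" "v \<in> vs.span S"
  shows "isvec n v"
  using assms(2)
proof (induction rule: vs.span_induct_alt)
  case base
  then show ?case by (rule isvec_closed)
next
  case (step c x y)
  then show ?case using assms(1) by (intro isvec_closed)
qed

text \<open>The condition inside \<open>lorentzian_subspace\<close> with basis and length exposed:
  the dimension and the Lorentzian property must be read off the same basis.\<close>

definition lor_basis :: "nat \<Rightarrow> nat \<Rightarrow> (nat \<Rightarrow> nat \<Rightarrow> real) \<Rightarrow> bool" where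
  "lor_basis n d b \<longleftrightarrow> (\<forall>i<d. isvec n (b i)) \<and>
     (\<forall>i<d. \<forall>j<d. lor n (b i) (b j) = (if i \<noteq> j then 0 else if i = 0 then -1 else 1))"

lemma lor_basis_coeff:
  assumes "lor_basis n d b" "j < d"
  shows "lor n (\<Sum>i<d. sc (c i) (b i)) (b j) = (if j = 0 then - c j else c j)"
proof -
  have "(\<Sum>i<d. c i * lor n (b i) (b j)) = (\<Sum>i<d. if i = j then (if j = 0 then - c j else c j) else 0)"
    by (rule sum.cong) (use assms in \<open>auto simp: lor_basis_def\<close>)
  then show ?thesis using assms(2) by (simp add: lor_simps)
qed

lemma lor_basis_dim:
  assumes "lor_basis n d b"
  shows "vdim (vspan (b ` {..<d})) = d"
proof -
  have z: "c j = 0" if "(\<Sum>i<d. sc (c i) (b i)) = 0" "j < d" for c j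
    using lor_basis_coeff[OF assms that(2), of c] that(1) by (simp add: lor_simps split: if_splits)
  have inj: "inj_on b {..<d}"
  proof (rule inj_onI, rule ccontr)
    fix i j assume ij: "i \<in> {..<d}" "j \<in> {..<d}" "b i = b j" "i \<noteq> j"
    have B: "lor n (b i) (b k) = (if i \<noteq> k then 0 else if i = 0 then -1 else 1)" if "k < d" for k
      using assms ij(1) that unfolding lor_basis_def by blast
    show False using B[of i] B[of j] ij by (simp split: if_splits)
  qed
  have "vs.independent (b ` {..<d})"
  proof (rule vs.independent_if_scalars_zero)
    fix f x assume "(\<Sum>x\<in>b ` {..<d}. sc (f x) x) = 0" "x \<in> b ` {..<d}"
    then show "f x = 0"
      using z[of "\<lambda>i. f (b i)"] unfolding sum.reindex[OF inj] o_def by blast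
  qed simp
  then show ?thesis
    by (simp add: vspan_alt vdim_alt vs.dim_eq_card_independent card_image[OF inj])
qed

text \<open>Gram-Schmidt without assuming independence: \<open>m\<close> is the rank, and
  \<open>x\<close> or \<open>z\<close> may be zero or they may be proportional. Positivity on
  nonzero vectors of the span is what allows each remainder to be normalised.\<close>

lemma gram_schmidt_pair:
  assumes psd: "\<And>v. v \<in> vs.span {x, z} \<Longrightarrow> v \<noteq> 0 \<Longrightarrow> 0 < lor n v v"
  shows "\<exists>(m::nat) c. m \<le> 2 \<and> vs.span (c ` {..<m}) = vs.span {x, z} \<and>
     (\<forall>i<m. \<forall>j<m. lor n (c i) (c j) = (if i = j then 1 else 0))"
proof -
  define u where "u v = sc (1 / sqrt (lor n v v)) v" for v
  have u1: "lor n (u v) (u v) = 1" if "v \<in> vs.span {x, z}" "v \<noteq> 0" for v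
    using psd[OF that] by (simp add: u_def lor_simps)
  have uv: "v = sc (sqrt (lor n v v)) (u v)" if "v \<in> vs.span {x, z}" "v \<noteq> 0" for v
    using psd[OF that] by (simp add: u_def)
  have us: "u v \<in> vs.span {x, z}" if "v \<in> vs.span {x, z}" for v
    unfolding u_def by (rule vs.span_scale[OF that])
  have xz: "x \<in> vs.span {x, z}" "z \<in> vs.span {x, z}" by (auto intro: vs.span_base)
  have span_u: "v \<in> vs.span T" if "u v \<in> vs.span T" "v \<in> vs.span {x, z}" for v T
    using uv[OF that(2)] vs.span_scale[OF that(1)] vs.span_zero[of T] by (cases "v = 0") metis+
  have one: "\<exists>(m::nat) c. m \<le> 2 \<and> vs.span (c ` {..<m}) = vs.span {x, z} \<and>
     (\<forall>i<m. \<forall>j<m. lor n (c i) (c j) = (if i = j then 1 else 0))"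
    if y: "y \<in> vs.span {x, z}" "y \<noteq> 0" and sp: "x \<in> vs.span {u y}" "z \<in> vs.span {u y}" for y
  proof -
    have im: "(\<lambda>_::nat. u y) ` {..<1} = {u y}" by auto
    have "vs.span {u y} = vs.span {x, z}"
      by (rule vs.span_eq[THEN iffD2]) (use sp us[OF y(1)] in auto)
    then show ?thesis
      using im u1[OF y] by (intro exI[of _ "1::nat"] exI[of _ "\<lambda>_. u y"]) simp
  qed
  consider "x = 0" "z = 0" | "x = 0" "z \<noteq> 0" | "x \<noteq> 0" by blast
  then show ?thesis
  proof cases
    case 1
    have "vs.span {0} = vs.span {}" by (metis vs.span_insert_0)
    then show ?thesis using 1 by (intro exI[of _ 0]) auto
  next
    case 2
    show ?thesis
      by (rule one[OF xz(2) 2(2)]) (use 2 xz span_u[OF vs.span_base[of "u z"] xz(2)] in \<open>auto simp: vs.span_zero\<close>)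
  next
    case 3
    note ux = u1[OF xz(1) 3]
    define w where "w = z - sc (lor n z (u x)) (u x)"
    have w: "w \<in> vs.span {x, z}" unfolding w_def by (intro vs.span_diff vs.span_scale xz us)
    have xu: "x \<in> vs.span {u x}" by (rule span_u[OF vs.span_base xz(1)]) simp
    show ?thesis
    proof (cases "w = 0")
      case True
      then have "z = sc (lor n z (u x)) (u x)" by (simp add: w_def)
      then have "z \<in> vs.span {u x}" using vs.span_scale[OF vs.span_base[of "u x" "{u x}"]] by (metis singletonI)
      then show ?thesis using one[OF xz(1) 3 xu] by blast
    next
      case False
      note uw = u1[OF w False]
      have wx: "lor n w (u x) = 0" unfolding w_def lor_simps ux by simp
      then have o: "lor n (u w) (u x) = 0" "lor n (u x) (u w) = 0"
        by (simp_all add: u_def[of w] lor_simps lor_commute[of n "u x"])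
      define c where "c i = (if i = (0::nat) then u x else u w)" for i
      have im: "c ` {..<2} = {u x, u w}" by (auto simp: c_def lessThan_Suc numeral_2_eq_2)
      have "vs.span {u x, u w} = vs.span {x, z}"
      proof (rule vs.span_eq[THEN iffD2], intro conjI)
        show "{u x, u w} \<subseteq> vs.span {x, z}" using us xz w by auto
        have x': "x \<in> vs.span {u x, u w}" and w': "w \<in> vs.span {u x, u w}"
          using span_u[OF vs.span_base xz(1), of "{u x, u w}"] span_u[OF vs.span_base w, of "{u x, u w}"] by auto
        have "z = w + sc (lor n z (u x)) (u x)" by (simp add: w_def)
        also have "\<dots> \<in> vs.span {u x, u w}" by (intro vs.span_add vs.span_scale w' vs.span_base) simp
        finally show "{x, z} \<subseteq> vs.span {u x, u w}" using x' by auto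
      qed
      moreover have "\<forall>i<2. \<forall>j<2. lor n (c i) (c j) = (if i = j then 1 else 0)"
        using ux uw o by (auto simp: c_def less_2_cases_iff)
      ultimately show ?thesis using im by (intro exI[of _ 2] exI[of _ c]) simp
    qed
  qed
qed

context special_frame
begin

lemma V_eq: "Vspace n e t = vs.span {C 0 t, C 1 t, C 2 t, C (n+1) t, X t, N t}"
  by (simp add: Vspace_def vspan_alt C_def X_def N_def)

text \<open>Vectors in the span of \<open>X\<close> and \<open>N\<close> are orthogonal to
  \<open>e_0\<close> and \<open>e_(n+1)\<close>, so by the Parseval identity their square is a sum
  of real squares and the form is positive definite there. An orthonormal basis of this span, of
  length \<open>m \<le> 2\<close>, complements the four fixed legs, whence the bounds on
  \<open>d\<close>.\<close>

lemma lor_basis_V: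
  assumes t: "t \<in> I"
  shows "\<exists>d b. 4 \<le> d \<and> d \<le> 6 \<and> lor_basis n d b \<and> Vspace n e t = vspan (b ` {..<d})"
proof -
  have pos: "0 < lor n v v" if v: "v \<in> vs.span {X t, N t}" "v \<noteq> 0" for v
  proof -
    have iv: "isvec n v" using isvec_span[OF _ v(1)] isvec_X isvec_N by blast
    have v0: "lor n v (C a t) = 0" if "a \<in> {0, n+1}" for a
      using lor_span_eq_0[OF _ v(1), of n "C a t"] lor_X[OF t] lor_N[OF t] that by auto
    have eq: "lor n v v = (\<Sum>i\<in>{1..n}. (lor n v (C i t))\<^sup>2)"
      using lor_frame_parseval[OF lor_frame_C[OF t] iv, of v] v0 by (simp add: power2_eq_square)
    have "lor n v v \<noteq> 0"
    proof
      assume "lor n v v = 0"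
      then have z: "\<forall>i\<in>{1..n}. (lor n v (C i t))\<^sup>2 = 0"
        unfolding eq by (subst (asm) sum_nonneg_eq_0_iff) auto
      have "v = 0"
      proof (rule lor_frame_eq_0[OF lor_frame_C[OF t] iv])
        fix a assume "a \<le> n + 1"
        then have "a \<in> {0, n+1} \<or> a \<in> {1..n}" by auto
        then show "lor n v (C a t) = 0" using v0 z by auto
      qed
      then show False using v(2) by simp
    qed
    moreover have "0 \<le> lor n v v" unfolding eq by (intro sum_nonneg) simp
    ultimately show ?thesis by simp
  qed
  have "\<exists>(m::nat) c. m \<le> 2 \<and> vs.span (c ` {..<m}) = vs.span {X t, N t} \<and>
      (\<forall>i<m. \<forall>j<m. lor n (c i) (c j) = (if i = j then 1 else 0))"
    by (rule gram_schmidt_pair) (rule pos)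
  then obtain m :: nat and c where mc: "m \<le> 2 \<and> vs.span (c ` {..<m}) = vs.span {X t, N t} \<and>
      (\<forall>i<m. \<forall>j<m. lor n (c i) (c j) = (if i = j then 1 else 0))"
    by (elim exE)
  then have c: "m \<le> 2" "vs.span (c ` {..<m}) = vs.span {X t, N t}"
      "\<And>i j. i < m \<Longrightarrow> j < m \<Longrightarrow> lor n (c i) (c j) = (if i = j then 1 else 0)"
    by simp_all
  have cs: "c i \<in> vs.span {X t, N t}" if "i < m" for i
    using c(2) that vs.span_base[of "c i" "c ` {..<m}"] by auto
  have ivc: "isvec n (c i)" if "i < m" for i
    using isvec_span[OF _ cs[OF that]] isvec_X isvec_N by blast
  have co: "lor n (c i) (C a t) = 0" "lor n (C a t) (c i) = 0" if "i < m" "a \<in> {0, 1, 2, n+1}" for i a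
  proof -
    show "lor n (c i) (C a t) = 0"
      by (rule lor_span_eq_0[OF _ cs[OF that(1)]]) (use that(2) lor_X[OF t] lor_N[OF t] in auto)
    then show "lor n (C a t) (c i) = 0" by (simp add: lor_commute)
  qed
  \<comment> \<open>The null pair \<open>e_0\<close>, \<open>e_(n+1)\<close> with product -1 is
    replaced by its sum and difference; the scale \<open>1 / sqrt 2\<close> gives them squares -1
    and 1.\<close>
  define h where "h = 1 / sqrt 2"
  have hh: "h * h = 1 / 2" by (simp add: h_def)
  define b0 b1 where "b0 = sc h (C 0 t) + sc h (C (n+1) t)" and "b1 = sc h (C 0 t) - sc h (C (n+1) t)"
  \<comment> \<open>The time-like vector has to sit at index 0; the shift by 4 skips the fixed
    vectors.\<close>
  define b where "b i = (if i = 0 then b0 else if i = 1 then b1 else if i = 2 then C 1 t else if i = 3 then C 2 t else c (i - 4))" for i :: nat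
  have bv: "b 0 = b0" "b 1 = b1" "b 2 = C 1 t" "b 3 = C 2 t" "\<And>i. b (i + 4) = c i"
    by (auto simp: b_def)
  have hsum: "h * (h * x) = x / 2" for x using hh by (simp flip: mult.assoc)
  have bb: "lor n b0 b0 = -1" "lor n b1 b1 = 1" "lor n b0 b1 = 0" "lor n b1 b0 = 0"
      "lor n b0 (C 1 t) = 0" "lor n b0 (C 2 t) = 0" "lor n b1 (C 1 t) = 0" "lor n b1 (C 2 t) = 0"
      "lor n (C 1 t) b0 = 0" "lor n (C 2 t) b0 = 0" "lor n (C 1 t) b1 = 0" "lor n (C 2 t) b1 = 0"
    unfolding b0_def b1_def lor_simps lor_C_table[OF t] using hh by simp_all
  have bc: "lor n b0 (c i) = 0" "lor n b1 (c i) = 0" "lor n (c i) b0 = 0" "lor n (c i) b1 = 0"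
      "lor n (C 1 t) (c i) = 0" "lor n (C 2 t) (c i) = 0" "lor n (c i) (C 1 t) = 0" "lor n (c i) (C 2 t) = 0"
    if "i < m" for i
    unfolding b0_def b1_def lor_simps using co[OF that] by simp_all
  have cases: "i = 0 \<or> i = 1 \<or> i = 2 \<or> i = 3 \<or> (\<exists>k<m. i = k + 4)" if "i < 4 + m" for i
  proof (cases "i < 4")
    case False
    then have "i - 4 < m \<and> i = (i - 4) + 4" using that by auto
    then show ?thesis by blast
  qed auto
  have basis: "lor_basis n (4 + m) b"
    unfolding lor_basis_def
  proof (intro conjI allI impI)
    fix i assume "i < 4 + m"
    from cases[OF this] show "isvec n (b i)"
      by (elim disjE exE conjE) (auto simp: bv b0_def b1_def ivc intro!: isvec_closed isvec_C)
    fix j assume "j < 4 + m"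
    from cases[OF this] cases[OF \<open>i < 4 + m\<close>]
    show "lor n (b i) (b j) = (if i \<noteq> j then 0 else if i = 0 then -1 else 1)"
      by (elim disjE exE conjE) (simp_all add: bv bb bc c(3) lor_C_table[OF t])
  qed
  have im: "b ` {..<4+m} = {b0, b1, C 1 t, C 2 t} \<union> c ` {..<m}"
  proof (intro equalityI subsetI)
    fix x assume "x \<in> b ` {..<4+m}"
    then obtain i where i: "i < 4 + m" "x = b i" by auto
    from cases[OF i(1)] show "x \<in> {b0, b1, C 1 t, C 2 t} \<union> c ` {..<m}"
      unfolding i(2) by (elim disjE exE conjE) (auto simp: bv)
  next
    fix x assume "x \<in> {b0, b1, C 1 t, C 2 t} \<union> c ` {..<m}"
    then show "x \<in> b ` {..<4+m}"
    proof
      assume "x \<in> {b0, b1, C 1 t, C 2 t}"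
      then have "x \<in> b ` {0, 1, 2, 3}" by (auto simp: bv)
      then show ?thesis by auto
    next
      assume "x \<in> c ` {..<m}"
      then obtain k where "k < m" "x = b (k + 4)" by (auto simp: bv)
      then show ?thesis by (intro image_eqI[of _ _ "k + 4"]) auto
    qed
  qed
  let ?G = "{C 0 t, C 1 t, C 2 t, C (n+1) t, X t, N t}"
  have "vs.span (b ` {..<4+m}) = vs.span ?G"
  proof (rule vs.span_eq[THEN iffD2], intro conjI)
    have "vs.span {X t, N t} \<subseteq> vs.span ?G" by (rule vs.span_mono) auto
    then have "c ` {..<m} \<subseteq> vs.span ?G" using cs by auto
    moreover have "b0 \<in> vs.span ?G" "b1 \<in> vs.span ?G"
      unfolding b0_def b1_def by (intro vs.span_add vs.span_diff vs.span_scale vs.span_base; simp)+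
    ultimately show "b ` {..<4+m} \<subseteq> vs.span ?G"
      unfolding im by (auto intro: vs.span_base)
    let ?B = "vs.span (b ` {..<4+m})"
    have b01: "b0 \<in> ?B" "b1 \<in> ?B" "C 1 t \<in> ?B" "C 2 t \<in> ?B" unfolding im by (auto intro: vs.span_base)
    have "C 0 t = sc h (b0 + b1)" "C (n+1) t = sc h (b0 - b1)"
      unfolding b0_def b1_def by (auto simp: fun_eq_iff sc_def algebra_simps hsum)
    moreover have "sc h (b0 + b1) \<in> ?B" "sc h (b0 - b1) \<in> ?B"
      by (intro vs.span_scale vs.span_add vs.span_diff b01)+
    ultimately have c0: "C 0 t \<in> ?B" "C (n+1) t \<in> ?B" by simp_all
    have "vs.span {X t, N t} \<subseteq> ?B" unfolding c(2)[symmetric] im by (rule vs.span_mono) auto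
    moreover have "{X t, N t} \<subseteq> vs.span {X t, N t}" by (rule vs.span_superset)
    ultimately have "X t \<in> ?B" "N t \<in> ?B" by auto
    then show "?G \<subseteq> ?B" using b01 c0 by auto
  qed
  then show ?thesis
    using basis c(1) by (intro exI[of _ "4 + m"] exI[of _ b]) (auto simp: V_eq vspan_alt)
qed

lemma V_perp_transport:
  assumes I: "is_interval I"
    and vN: "has_vderiv_on I \<sigma> N (\<lambda>t. sc (S t) (X t) - sc (lor n (X t) (N t)) (C 2 t))"
    and s: "s \<in> I" and t: "t \<in> I" and w: "\<And>x. x \<in> Vspace n e s \<Longrightarrow> lor n x w = 0" and x: "x \<in> Vspace n e t"
  shows "lor n x w = 0"
proof -
  define y0 y1 y2 y3 y4 y5 where "y0 t = lor n (C 0 t) w" and "y1 t = lor n (C 1 t) w" and "y2 t = lor n (C 2 t) w"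
    and "y3 t = lor n (C (n+1) t) w" and "y4 t = lor n (X t) w" and "y5 t = lor n (N t) w" for t
  have vw: "has_vderiv_on I \<sigma> (\<lambda>_. w) (\<lambda>_. 0)"
    by (simp add: has_vderiv_on_def has_sderiv_on_def)
  define a where "a t = lor n (X t) (X t)" for t
  define z where "z t = lor n (X t) (N t)" for t
  have d: "has_sderiv_on I \<sigma> y0 y1" "has_sderiv_on I \<sigma> y1 (\<lambda>t. \<mu> t * y0 t + y3 t)"
      "has_sderiv_on I \<sigma> y2 (\<lambda>t. y0 t + y4 t)" "has_sderiv_on I \<sigma> y3 (\<lambda>t. \<mu> t * y1 t + y2 t)"
      "has_sderiv_on I \<sigma> y4 (\<lambda>t. y5 t - a t * y2 t)" "has_sderiv_on I \<sigma> y5 (\<lambda>t. S t * y4 t - z t * y2 t)"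
    using sderiv_lor[OF deriv_C0 vw, of n] sderiv_lor[OF deriv_C1 vw, of n] sderiv_lor[OF deriv_C2 vw, of n]
      sderiv_lor[OF deriv_C_last vw, of n] sderiv_lor[OF deriv_X vw, of n] sderiv_lor[OF vN vw, of n]
    unfolding y0_def[abs_def] y1_def[abs_def] y2_def[abs_def] y3_def[abs_def] y4_def[abs_def] y5_def[abs_def] a_def z_def
    by (simp_all add: lor_simps)
  define E where "E t = y0 t * y0 t + y1 t * y1 t + y2 t * y2 t + y3 t * y3 t + y4 t * y4 t + y5 t * y5 t" for t
  define E1 where "E1 t = (y1 t * y0 t + y0 t * y1 t)
      + ((\<mu> t * y0 t + y3 t) * y1 t + y1 t * (\<mu> t * y0 t + y3 t))
      + ((y0 t + y4 t) * y2 t + y2 t * (y0 t + y4 t))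
      + ((\<mu> t * y1 t + y2 t) * y3 t + y3 t * (\<mu> t * y1 t + y2 t))
      + ((y5 t - a t * y2 t) * y4 t + y4 t * (y5 t - a t * y2 t))
      + ((S t * y4 t - z t * y2 t) * y5 t + y5 t * (S t * y4 t - z t * y2 t))" for t
  have dE: "has_sderiv_on I \<sigma> E E1"
    unfolding E_def[abs_def] E1_def[abs_def] by (intro sderiv_add sderiv_mult d)
  \<comment> \<open>Each cross term \<open>2 u v\<close> in \<open>E1\<close> is at most
    \<open>E\<close> in absolute value. Six of them have coefficient of modulus 1, two carry
    \<open>\<mu>\<close>, and \<open>a\<close>, \<open>S\<close>, \<open>z\<close> occur once
    each.\<close>
  define k where "k t = \<bar>\<sigma> t\<bar> * (6 + 2 * \<bar>\<mu> t\<bar> + \<bar>a t\<bar> + \<bar>S t\<bar> + \<bar>z t\<bar>)" for t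
  have bound: "\<bar>\<sigma> t * E1 t\<bar> \<le> k t * E t" for t
  proof -
    have p: "\<bar>2 * (u * v)\<bar> \<le> u * u + v * v" for u v :: real
    proof -
      have "0 \<le> (u - v) * (u - v)" "0 \<le> (u + v) * (u + v)" by simp_all
      then have "2 * (u * v) \<le> u * u + v * v" "- (2 * (u * v)) \<le> u * u + v * v"
        by (simp_all add: algebra_simps)
      then show ?thesis by (simp add: abs_le_iff)
    qed
    have nn: "0 \<le> y0 t * y0 t" "0 \<le> y1 t * y1 t" "0 \<le> y2 t * y2 t" "0 \<le> y3 t * y3 t" "0 \<le> y4 t * y4 t" "0 \<le> y5 t * y5 t"
      by simp_all
    have q: "\<bar>2 * (y0 t * y1 t)\<bar> \<le> E t" "\<bar>2 * (y1 t * y3 t)\<bar> \<le> E t" "\<bar>2 * (y0 t * y2 t)\<bar> \<le> E t"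
      "\<bar>2 * (y2 t * y4 t)\<bar> \<le> E t" "\<bar>2 * (y2 t * y3 t)\<bar> \<le> E t" "\<bar>2 * (y4 t * y5 t)\<bar> \<le> E t" "\<bar>2 * (y2 t * y5 t)\<bar> \<le> E t"
      using p[of "y0 t" "y1 t"] p[of "y1 t" "y3 t"] p[of "y0 t" "y2 t"] p[of "y2 t" "y4 t"] p[of "y2 t" "y3 t"]
        p[of "y4 t" "y5 t"] p[of "y2 t" "y5 t"] nn unfolding E_def by linarith+
    have cq: "\<bar>c * (2 * (u * v))\<bar> \<le> \<bar>c\<bar> * E t" if "\<bar>2 * (u * v)\<bar> \<le> E t" for c u v
      unfolding abs_mult[of c] by (rule mult_left_mono[OF that]) simp
    have eq: "E1 t = 2 * (y0 t * y1 t) + \<mu> t * (2 * (y0 t * y1 t)) + 2 * (y1 t * y3 t) + 2 * (y0 t * y2 t) + 2 * (y2 t * y4 t)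
        + \<mu> t * (2 * (y1 t * y3 t)) + 2 * (y2 t * y3 t) + 2 * (y4 t * y5 t) - a t * (2 * (y2 t * y4 t))
        + S t * (2 * (y4 t * y5 t)) - z t * (2 * (y2 t * y5 t))"
      by (simp add: E1_def algebra_simps)
    have "\<bar>E1 t\<bar> \<le> 6 * E t + \<bar>\<mu> t\<bar> * E t + \<bar>\<mu> t\<bar> * E t + \<bar>a t\<bar> * E t + \<bar>S t\<bar> * E t + \<bar>z t\<bar> * E t"
    proof -
      define m1 m2 m3 m4 where "m1 = \<bar>\<mu> t\<bar> * E t" and "m2 = \<bar>a t\<bar> * E t" and "m3 = \<bar>S t\<bar> * E t" and "m4 = \<bar>z t\<bar> * E t"
      note bd = q cq[OF q(1), of "\<mu> t", folded m1_def] cq[OF q(2), of "\<mu> t", folded m1_def]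
        cq[OF q(4), of "a t", folded m2_def] cq[OF q(6), of "S t", folded m3_def] cq[OF q(7), of "z t", folded m4_def]
      show ?thesis
        unfolding eq m1_def[symmetric] m2_def[symmetric] m3_def[symmetric] m4_def[symmetric]
        using bd[THEN abs_le_D1] bd[THEN abs_le_D2] by (intro abs_leI) linarith+
    qed
    also have "\<dots> = (6 + 2 * \<bar>\<mu> t\<bar> + \<bar>a t\<bar> + \<bar>S t\<bar> + \<bar>z t\<bar>) * E t" by (simp add: algebra_simps)
    finally show ?thesis
      unfolding k_def abs_mult mult.assoc by (rule mult_left_mono) simp
  qed
  have J: "closed_segment s t \<subseteq> I"
    using I s t by (simp add: closed_segment_subset is_interval_convex)
  have "continuous_on I k"
    unfolding k_def[abs_def] a_def z_def
    by (intro continuous_intros Cinf_on_continuous_on Cinf_\<sigma> Cinf_\<mu> Cinf_S Cinf_on_lor opI smooth_X smooth_N)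
  then have "continuous_on (closed_segment s t) k" using J continuous_on_subset by blast
  \<comment> \<open>\<open>k\<close> need not be bounded on \<open>I\<close>; its maximum over the
    compact segment from \<open>s\<close> to \<open>t\<close> is enough.\<close>
  then obtain L where L: "\<And>u. u \<in> closed_segment s t \<Longrightarrow> k u \<le> L"
    using continuous_attains_sup[OF compact_segment, of s t k] ends_in_segment(1)[of s t] by blast
  have En: "0 \<le> E u" for u by (simp add: E_def)
  have gen: "{C 0 s, C 1 s, C 2 s, C (n+1) s, X s, N s} \<subseteq> Vspace n e s"
    unfolding V_eq by (rule vs.span_superset)
  have "E t = 0"
  proof (rule gronwall_zero[where E = E and t = t and J = "closed_segment s t" and s = s and L = L and E' = "\<lambda>u. \<sigma> u * E1 u"])
    show "(E has_real_derivative \<sigma> u * E1 u) (at u)" if "u \<in> closed_segment s t" for u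
      using dE J that by (auto simp: has_sderiv_on_def)
    show "\<bar>\<sigma> u * E1 u\<bar> \<le> L * E u" if "u \<in> closed_segment s t" for u
      using bound[of u] mult_right_mono[OF L[OF that] En[of u]] by linarith
    show "E s = 0" using w gen by (simp add: E_def y0_def y1_def y2_def y3_def y4_def y5_def)
  qed (use En in auto)
  then have "y0 t = 0 \<and> y1 t = 0 \<and> y2 t = 0 \<and> y3 t = 0 \<and> y4 t = 0 \<and> y5 t = 0"
    unfolding E_def by (simp add: add_nonneg_eq_0_iff)
  then show ?thesis
    using lor_span_eq_0[of "{C 0 t, C 1 t, C 2 t, C (n+1) t, X t, N t}" n w x] x
    by (auto simp: V_eq y0_def y1_def y2_def y3_def y4_def y5_def)
qed

text \<open>Subtract from \<open>v\<close> its orthogonal projection \<open>P\<close> to the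
  nondegenerate \<open>V(s)\<close>. The remainder \<open>w\<close> is orthogonal to
  \<open>V(s)\<close>, hence by transport to \<open>v\<close> itself, so \<open><w, w> = 0\<close>.
  Being orthogonal to \<open>e_0(s)\<close> and \<open>e_(n+1)(s)\<close>, it has a sum of real
  squares as its square and must be 0. Thus \<open>v = P\<close>.\<close>

lemma V_subset:
  assumes I: "is_interval I"
    and vN: "has_vderiv_on I \<sigma> N (\<lambda>t. sc (S t) (X t) - sc (lor n (X t) (N t)) (C 2 t))"
    and s: "s \<in> I" and t: "t \<in> I"
  shows "Vspace n e t \<subseteq> Vspace n e s"
proof
  fix v assume v: "v \<in> Vspace n e t"
  obtain d b where b: "lor_basis n d b" "Vspace n e s = vspan (b ` {..<d})"
    using lor_basis_V[OF s] by blast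
  \<comment> \<open>The minus sign at index 0 compensates the square -1 of the time-like basis
    vector.\<close>
  define P where "P = (\<Sum>i<d. sc (if i = 0 then - lor n v (b i) else lor n v (b i)) (b i))"
  define w where "w = v - P"
  have PV: "P \<in> Vspace n e s"
    unfolding b(2) vspan_alt P_def by (intro vs.span_sum vs.span_scale vs.span_base) auto
  have "lor n w (b j) = 0" if "j < d" for j
    unfolding w_def P_def lor_diff_left lor_basis_coeff[OF b(1) that] by simp
  then have "lor n y w = 0" if "y \<in> b ` {..<d}" for y
    using that by (auto simp: lor_commute[of n _ w])
  then have perp: "lor n y w = 0" if "y \<in> Vspace n e s" for y
    using lor_span_eq_0[of "b ` {..<d}" n w y] that by (simp add: b(2) vspan_alt)
  have "lor n w w = lor n v w - lor n P w" by (subst (1) w_def) (rule lor_diff_left)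
  then have ww: "lor n w w = 0"
    using V_perp_transport[OF I vN s t perp v] perp[OF PV] by simp
  have gen: "C 0 s \<in> Vspace n e s" "C (n+1) s \<in> Vspace n e s"
    unfolding V_eq by (auto intro: vs.span_base)
  have wC: "lor n w (C 0 s) = 0" "lor n w (C (n+1) s) = 0"
    using perp gen by (simp_all add: lor_commute[of n w])
  have iv: "isvec n w"
  proof -
    have "isvec n v" using v isvec_span[of "{C 0 t, C 1 t, C 2 t, C (n+1) t, X t, N t}" n v] isvec_C isvec_X isvec_N by (auto simp: V_eq)
    moreover have "isvec n P" using PV isvec_span[of "{C 0 s, C 1 s, C 2 s, C (n+1) s, X s, N s}" n P] isvec_C isvec_X isvec_N by (auto simp: V_eq)
    ultimately show ?thesis unfolding w_def by (rule isvec_closed)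
  qed
  have "(\<Sum>i\<in>{1..n}. (lor n w (C i s))\<^sup>2) = 0"
    using lor_frame_parseval[OF lor_frame_C[OF s] iv, of w] ww wC by (simp add: power2_eq_square)
  then have "\<forall>i\<in>{1..n}. (lor n w (C i s))\<^sup>2 = 0"
    by (subst (asm) sum_nonneg_eq_0_iff) auto
  then have z: "lor n w (C i s) = 0" if "i \<in> {1..n}" for i using that by simp
  have "w = 0"
  proof (rule lor_frame_eq_0[OF lor_frame_C[OF s] iv])
    fix a assume "a \<le> n + 1"
    then have "a = 0 \<or> a = n+1 \<or> a \<in> {1..n}" by auto
    then show "lor n w (C a s) = 0" using wC z by auto
  qed
  then have "v = P" by (simp add: w_def)
  then show "v \<in> Vspace n e s" using PV by simp
qed

end

theorem mainTheorem6:
  fixes n :: nat and I :: "real set"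
    and f :: "real \<Rightarrow> (nat \<Rightarrow> real) set"
    and e :: "real \<Rightarrow> nat \<Rightarrow> nat \<Rightarrow> real"
  assumes "3 \<le> n"
    and "is_interval I" and "open I" and "I \<noteq> {}"
    and "f ` I \<subseteq> Qn n"
    and "one_generic n I f"
    and "conformal_geodesic n I f"
    and "special_third_order_frame n I f e"
  shows "\<exists>V. (\<forall>s\<in>I. Vspace n e s = V) \<and> lorentzian_subspace n V \<and>
             4 \<le> vdim V \<and> vdim V \<le> 6 \<and>
             conformal_sphere n (vdim V - 2) (proj_null n V) \<and>
             f ` I \<subseteq> proj_null n V"
proof -
  interpret special_frame n I f e
    using assms by unfold_locales auto
  have vN: "has_vderiv_on I \<sigma> N (\<lambda>t. sc (S t) (X t) - sc (lor n (X t) (N t)) (C 2 t))"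
    by (rule nabla_deriv_of_EL) (rule euler_lagrange[OF assms(7)])
  obtain s0 where s0: "s0 \<in> I" using assms(4) by blast
  define V where "V = Vspace n e s0"
  \<comment> \<open>The inclusion is available for either order of the two points, so equality needs
    no comparison of dimensions.\<close>
  have const: "Vspace n e s = V" if "s \<in> I" for s
    unfolding V_def using V_subset[OF assms(2) vN] that s0 by blast
  obtain d b where b: "4 \<le> d" "d \<le> 6" "lor_basis n d b" "V = vspan (b ` {..<d})"
    using lor_basis_V[OF s0] unfolding V_def by blast
  have dim: "vdim V = d" unfolding b(4) by (rule lor_basis_dim[OF b(3)])
  have lor: "lorentzian_subspace n V"
    unfolding lorentzian_subspace_def
    by (intro exI[of _ d] exI[of _ b] conjI) (use b in \<open>simp_all add: lor_basis_def\<close>)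
  \<comment> \<open>The bound \<open>4 \<le> d\<close> makes the truncated subtraction exact, so
    that \<open>vdim V - 2 + 2 = vdim V\<close>.\<close>
  have "conformal_sphere n (vdim V - 2) (proj_null n V)"
    unfolding conformal_sphere_def using lor dim b(1) by (intro exI[of _ V]) auto
  moreover have "f t \<in> proj_null n V" if t: "t \<in> I" for t
  proof -
    have "C 0 t \<in> V" unfolding const[OF t, symmetric] V_eq by (rule vs.span_base) simp
    moreover have "C 0 t \<noteq> 0"
    proof
      assume "C 0 t = 0"
      then show False using lor_C_table(23)[OF t] by (simp add: lor_simps)
    qed
    moreover have "f t = proj (C 0 t)" using frame_e t by (simp add: frame_def C_def)
    ultimately show ?thesis using lor_C_table(22)[OF t] unfolding proj_null_def by blast
  qed
  ultimately show ?thesis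
    using const lor dim b(1,2) by (intro exI[of _ V]) auto
qed

end
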